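(* Let $q\in \mathrm{GL}_N(R_\pi)$ be symmetric and $i \in \{1,\ldots,n\}$. There is a unique higher $\pi$-Frobenius lift $\phi_i^{\mathrm{Ch}}$ of degree $s$ on $\mathcal A$ extending $\phi_i^{(s)}$ that is $\mathcal B_{q}$-symmetric and metric with respect to $q$; it is given by $$\phi_i^{\mathrm{Ch}}(x) = x^{(p^s)} \left\{ (x^{(p^s)t}\phi_i^{(s)}(q)x^{(p^s)})^{-1}(x^t q x)^{(p^s)}\right\}^{1/2}.$$
   Context: $p$ odd prime; $R$ the $p$-adic completion of the ring of integers of the maximal unramified extension of $\mathbb Q_p$; $\pi$ a prime element of a finite Galois extension of $\mathbb Q_p$, $R_\pi=R[\pi]$. Fix $s,n,N\ge1$ and higher $\pi$-Frobenius lifts $\phi_1^{(s)},\ldots,\phi_n^{(s)}$ of degree $s$ on $R_\pi$ (ring endomorphisms with $\phi(a)\equiv a^{p^s}$ mod $\pi$), applied entrywise to matrices. $x$ is an $N\times N$ matrix of indeterminates, $\mathcal A=R_\pi[x,\det(x)^{-1}]^{\widehat{\ }}$ ($p$-adic completion); $X^{(p^s)}$ is entrywise $p^s$-th power, $X^t$ transpose. A higher $\pi$-Frobenius lift of degree $s$ on $\mathcal A$ extending $\phi_i^{(s)}$ is a ring endomorphism of $\mathcal A$ restricting to $\phi^{(s)}_i$ on $R_\pi$ and congruent to the $p^s$-power map mod $\pi$. $\phi_{i,0}$ denotes the such lift with $\phi_{i,0}(x)=x^{(p^s)}$. $\mathcal H_q:\mathcal A\to\mathcal A$ is the $R_\pi$-algebra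 map with $\mathcal H_q(x)=x^tqx$; a lift $\phi$ is metric w.r.t. $q$ if $\phi\circ\mathcal H_q=\mathcal H_q\circ\phi_{i,0}$. Let $\mathcal B_q:\mathcal A\to\mathcal A\otimes\mathcal A$ be the map with $\mathcal B_q(x)=x_1^tqx_2$, $x_1=x\otimes1$, $x_2=1\otimes x$; $\phi$ is $\mathcal B_q$-symmetric if $(\phi\otimes\phi_{i,0})\circ\mathcal B_q=(\phi_{i,0}\otimes\phi)\circ\mathcal B_q$ as maps to $\mathcal A$ (followed by multiplication); writing $\phi(x)=x^{(p^s)}\Lambda$ and $A_i=x^{(p^s)t}\phi_i^{(s)}(q)x^{(p^s)}$, this is equivalent to $A_i\Lambda=\Lambda^tA_i$. The matrix inside the braces has the form $1+\pi X$ with $X$ over $\mathcal A$, and its square root is defined by the binomial series. *)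

theory Defs
  imports
    "HOL-Analysis.Analysis"
    "HOL-Library.Poly_Mapping"
    "HOL-Library.Countable"
    "HOL-Computational_Algebra.Polynomial"
    "HOL-Computational_Algebra.Fraction_Field"
    "HOL-Computational_Algebra.Primes"
begin

section \<open>Rings and maps\<close>

definition ring_hom_on :: "'a::comm_ring_1 set \<Rightarrow> 'b::comm_ring_1 set \<Rightarrow> ('a \<Rightarrow> 'b) \<Rightarrow> bool" where
  "ring_hom_on S T f \<longleftrightarrow> f ` S \<subseteq> T \<and> f 1 = 1 \<and>
     (\<forall>a\<in>S. \<forall>b\<in>S. f (a + b) = f a + f b \<and> f (a * b) = f a * f b)"

inductive_set subring_gen :: "'a::comm_ring_1 set \<Rightarrow> 'a set" for S where
  gen: "a \<in> S \<Longrightarrow> a \<in> subring_gen S"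
| one: "1 \<in> subring_gen S"
| diff: "\<lbrakk>a \<in> subring_gen S; b \<in> subring_gen S\<rbrakk> \<Longrightarrow> a - b \<in> subring_gen S"
| mult: "\<lbrakk>a \<in> subring_gen S; b \<in> subring_gen S\<rbrakk> \<Longrightarrow> a * b \<in> subring_gen S"

text \<open>The congruence is modulo the ideal of the ring \<open>S\<close> generated by \<open>\<pi>\<close>.\<close>

definition frobenius_lift_on :: "nat \<Rightarrow> nat \<Rightarrow> 'a::comm_ring_1 \<Rightarrow> 'a set \<Rightarrow> ('a \<Rightarrow> 'a) \<Rightarrow> bool" where
  "frobenius_lift_on p s \<pi> S f \<longleftrightarrow> ring_hom_on S S f \<and>
     (\<forall>a\<in>S. \<exists>b\<in>S. f a - a ^ (p ^ s) = \<pi> * b)"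


section \<open>The ground ring\<close>

text \<open>
  All extensions of the \<open>p\<close>-adic numbers are taken inside an algebraically closed field
  that is complete for a nonarchimedean absolute value with \<open>\<bar>p\<bar> = 1/p\<close>, such as the
  completion of an algebraic closure of the \<open>p\<close>-adic numbers. Inside such a field
  completions are closures; on the ring of integers of a subfield the \<open>p\<close>-adic topology
  is the one given by the absolute value.
\<close>

locale padic_ambient_field =
  fixes p :: nat and \<nu> :: "'k::{alg_closed_field, field_char_0} \<Rightarrow> real"
  assumes prime_p: "prime p"
    and nonneg: "\<nu> x \<ge> 0"
    and eq_0_iff: "\<nu> x = 0 \<longleftrightarrow> x = 0"
    and mult: "\<nu> (x * y) = \<nu> x * \<nu> y"
    and ultrametric: "\<nu> (x + y) \<le> max (\<nu> x) (\<nu> y)"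
    and normalized: "\<nu> (of_nat p) = 1 / real p"
    and complete: "\<forall>e>0. \<exists>M. \<forall>k\<ge>M. \<forall>l\<ge>M. \<nu> (u k - u l) < e
                     \<Longrightarrow> \<exists>a. (\<lambda>k. \<nu> (u k - a)) \<longlonglongrightarrow> 0"

definition val_closure :: "('k::field \<Rightarrow> real) \<Rightarrow> 'k set \<Rightarrow> 'k set" where
  "val_closure \<nu> S = {a. \<forall>e>0. \<exists>b\<in>S. \<nu> (a - b) < e}"

definition padic_numbers :: "('k::field_char_0 \<Rightarrow> real) \<Rightarrow> 'k set" where
  "padic_numbers \<nu> = val_closure \<nu> \<rat>"

definition subfield_of :: "'k::field set \<Rightarrow> 'k set \<Rightarrow> bool" where
  "subfield_of F L \<longleftrightarrow> F \<subseteq> L \<and> 1 \<in> L \<and>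
     (\<forall>a\<in>L. \<forall>b\<in>L. a - b \<in> L \<and> a * b \<in> L) \<and> (\<forall>a\<in>L. inverse a \<in> L)"

definition finite_extension :: "'k::field set \<Rightarrow> 'k set \<Rightarrow> bool" where
  "finite_extension F L \<longleftrightarrow> subfield_of F L \<and>
     (\<exists>B. finite B \<and> B \<subseteq> L \<and> L = {\<Sum>b\<in>B. a b * b | a. \<forall>b\<in>B. a b \<in> F})"

definition field_automorphism :: "'k::field set \<Rightarrow> 'k set \<Rightarrow> ('k \<Rightarrow> 'k) \<Rightarrow> bool" where
  "field_automorphism F L \<sigma> \<longleftrightarrow>
     ring_hom_on L L \<sigma> \<and> bij_betw \<sigma> L L \<and> (\<forall>a\<in>F. \<sigma> a = a)"

definition finite_galois_extension :: "'k::field set \<Rightarrow> 'k set \<Rightarrow> bool" where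
  "finite_galois_extension F L \<longleftrightarrow> finite_extension F L \<and>
     {a \<in> L. \<forall>\<sigma>. field_automorphism F L \<sigma> \<longrightarrow> \<sigma> a = a} = F"

definition ring_of_integers :: "('k::field \<Rightarrow> real) \<Rightarrow> 'k set \<Rightarrow> 'k set" where
  "ring_of_integers \<nu> L = {a \<in> L. \<nu> a \<le> 1}"

text \<open>A generator of the maximal ideal of the ring of integers of \<open>L\<close>.\<close>

definition prime_element_of :: "('k::field \<Rightarrow> real) \<Rightarrow> 'k set \<Rightarrow> 'k \<Rightarrow> bool" where
  "prime_element_of \<nu> L \<pi> \<longleftrightarrow>
     {a \<in> L. \<nu> a < 1} = (\<lambda>b. \<pi> * b) ` ring_of_integers \<nu> L"

text \<open>
  A finite extension of the \<open>p\<close>-adic numbers is unramified iff \<open>p\<close> is a prime element of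
  it; the residue field extension is separable since its base is the field with \<open>p\<close>
  elements.
\<close>

definition maximal_unramified :: "nat \<Rightarrow> ('k::field_char_0 \<Rightarrow> real) \<Rightarrow> 'k set" where
  "maximal_unramified p \<nu> =
     \<Union>{L. finite_extension (padic_numbers \<nu>) L \<and> prime_element_of \<nu> L (of_nat p)}"

definition completed_unramified_integers :: "nat \<Rightarrow> ('k::field_char_0 \<Rightarrow> real) \<Rightarrow> 'k set" where
  "completed_unramified_integers p \<nu> =
     val_closure \<nu> (ring_of_integers \<nu> (maximal_unramified p \<nu>))"


section \<open>\<open>p\<close>-adic completion\<close>

definition padic_limit :: "nat \<Rightarrow> (nat \<Rightarrow> 'b::comm_ring_1) \<Rightarrow> 'b \<Rightarrow> bool" where
  "padic_limit p u a \<longleftrightarrow> (\<forall>m. \<exists>M. \<forall>k\<ge>M. of_nat p ^ m dvd u k - a)"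

definition padic_Cauchy :: "nat \<Rightarrow> (nat \<Rightarrow> 'b::comm_ring_1) \<Rightarrow> bool" where
  "padic_Cauchy p u \<longleftrightarrow> (\<forall>m. \<exists>M. \<forall>k\<ge>M. \<forall>l\<ge>M. of_nat p ^ m dvd u k - u l)"

text \<open>Uniqueness of limits makes the ring \<open>p\<close>-adically separated.\<close>

definition padic_complete :: "nat \<Rightarrow> 'b::comm_ring_1 itself \<Rightarrow> bool" where
  "padic_complete p _ \<longleftrightarrow>
     (\<forall>u :: nat \<Rightarrow> 'b. padic_Cauchy p u \<longrightarrow> (\<exists>!a. padic_limit p u a))"

text \<open>
  The ring \<open>'b\<close> is the \<open>p\<close>-adic completion of the ring \<open>P\<close> along \<open>j\<close>: it is complete and
  separated, and \<open>j\<close> induces isomorphisms \<open>P/p\<^sup>mP \<rightarrow> 'b/p\<^sup>m'b\<close> for all \<open>m\<close>.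
\<close>

definition padic_completion ::
    "nat \<Rightarrow> 'a::comm_ring_1 set \<Rightarrow> ('a \<Rightarrow> 'b::comm_ring_1) \<Rightarrow> bool" where
  "padic_completion p P j \<longleftrightarrow> ring_hom_on P UNIV j \<and> padic_complete p TYPE('b) \<and>
     (\<forall>m b. \<exists>f\<in>P. of_nat p ^ m dvd b - j f) \<and>
     (\<forall>m. \<forall>f\<in>P. of_nat p ^ m dvd j f \<longleftrightarrow> (\<exists>g\<in>P. f = of_nat p ^ m * g))"

text \<open>
  The subgroup of the free abelian group on \<open>'b \<times> 'b\<close> by which one divides to obtain the
  tensor product of \<open>'b\<close> with itself over the ring \<open>S\<close>, which acts through \<open>c\<close>.
\<close>

inductive_set tensor_relations ::
    "'k::comm_ring_1 set \<Rightarrow> ('k \<Rightarrow> 'b::comm_ring_1) \<Rightarrow> ('b \<times> 'b \<Rightarrow>\<^sub>0 int) set"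
  for S :: "'k set" and c :: "'k \<Rightarrow> 'b" where
  left: "frag_of (a + a', b) - frag_of (a, b) - frag_of (a', b) \<in> tensor_relations S c"
| right: "frag_of (a, b + b') - frag_of (a, b) - frag_of (a, b') \<in> tensor_relations S c"
| balanced: "r \<in> S \<Longrightarrow> frag_of (c r * a, b) - frag_of (a, c r * b) \<in> tensor_relations S c"
| diff: "\<lbrakk>u \<in> tensor_relations S c; v \<in> tensor_relations S c\<rbrakk> \<Longrightarrow> u - v \<in> tensor_relations S c"

definition tensor_eval ::
    "('b \<Rightarrow> 't) \<Rightarrow> ('b \<Rightarrow> 't) \<Rightarrow> ('b::comm_ring_1 \<times> 'b \<Rightarrow>\<^sub>0 int) \<Rightarrow> 't::comm_ring_1" where
  "tensor_eval i\<^sub>1 i\<^sub>2 u =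
     (\<Sum>z\<in>Poly_Mapping.keys u. of_int (Poly_Mapping.lookup u z) * (i\<^sub>1 (fst z) * i\<^sub>2 (snd z)))"

text \<open>
  The ring \<open>'t\<close> is the \<open>p\<close>-adic completion of the tensor product of \<open>'b\<close> with itself
  over \<open>S\<close>, where \<open>i\<^sub>1 a = a \<otimes> 1\<close> and \<open>i\<^sub>2 a = 1 \<otimes> a\<close>; as before, the last two conditions
  say that the quotients modulo \<open>p\<^sup>m\<close> are isomorphic.
\<close>

definition completed_tensor_square ::
    "nat \<Rightarrow> 'k::comm_ring_1 set \<Rightarrow> ('k \<Rightarrow> 'b::comm_ring_1) \<Rightarrow> ('b \<Rightarrow> 't::comm_ring_1) \<Rightarrow> ('b \<Rightarrow> 't) \<Rightarrow> bool" where
  "completed_tensor_square p S c i\<^sub>1 i\<^sub>2 \<longleftrightarrow>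
     ring_hom_on UNIV UNIV i\<^sub>1 \<and> ring_hom_on UNIV UNIV i\<^sub>2 \<and> padic_complete p TYPE('t) \<and>
     (\<forall>m t. \<exists>u. of_nat p ^ m dvd t - tensor_eval i\<^sub>1 i\<^sub>2 u) \<and>
     (\<forall>m u. of_nat p ^ m dvd tensor_eval i\<^sub>1 i\<^sub>2 u \<longleftrightarrow>
              (\<exists>v. u - frag_cmul (int p ^ m) v \<in> tensor_relations S c))"


section \<open>The coordinate ring of the general linear group\<close>

text \<open>
  The indeterminates are numbered by \<^const>\<open>to_nat\<close> because the fraction field needs
  polynomials in linearly ordered variables; only those with index in the range of the
  numbering of \<open>'n \<times> 'n\<close> occur.
\<close>

type_synonym 'k polys = "(nat \<Rightarrow>\<^sub>0 nat) \<Rightarrow>\<^sub>0 'k"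

definition scalar :: "'k::field \<Rightarrow> 'k polys fract" where
  "scalar r = Fract (Poly_Mapping.single 0 r) 1"

definition indeterminates :: "'k::field polys fract ^ 'n::finite ^ 'n" where
  "indeterminates = (\<chi> i j.
     Fract (Poly_Mapping.single (Poly_Mapping.single (to_nat (i, j)) 1) 1) 1)"

definition GL_coordinate_ring :: "'n::finite itself \<Rightarrow> 'k::field set \<Rightarrow> 'k polys fract set" where
  "GL_coordinate_ring _ S =
     (let X = indeterminates :: 'k polys fract ^ 'n ^ 'n
      in subring_gen (scalar ` S \<union> {X $ i $ j | i j. True} \<union> {inverse (det X)}))"


section \<open>Matrices\<close>

definition GL_over :: "'k::comm_ring_1 set \<Rightarrow> ('k ^ 'n::finite ^ 'n) set" where
  "GL_over S = {q. (\<forall>i j. q $ i $ j \<in> S) \<and>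
     (\<exists>q'. (\<forall>i j. q' $ i $ j \<in> S) \<and> q ** q' = mat 1 \<and> q' ** q = mat 1)}"

abbreviation entry_power :: "nat \<Rightarrow> 'b::comm_ring_1 ^ 'n::finite ^ 'n \<Rightarrow> 'b ^ 'n ^ 'n" where
  "entry_power m \<equiv> map_matrix (\<lambda>a. a ^ m)"

text \<open>\<open>L = {M}\<^bsup>1/2\<^esup>\<close> for \<open>M = 1 + \<pi>X\<close>, as the sum of the binomial series; \<open>c\<close> is the
  structure map of the algebra \<open>'b\<close>.\<close>

definition binomial_sqrt ::
    "nat \<Rightarrow> ('k::field_char_0 \<Rightarrow> 'b::comm_ring_1) \<Rightarrow> 'k \<Rightarrow> 'b ^ 'n::finite ^ 'n \<Rightarrow> 'b ^ 'n ^ 'n \<Rightarrow> bool" where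
  "binomial_sqrt p c \<pi> M L \<longleftrightarrow>
     (\<exists>X. M = mat 1 + map_matrix (\<lambda>a. c \<pi> * a) X \<and>
       (\<forall>i j. padic_limit p
          (\<lambda>m. \<Sum>k<m. c ((1/2) gchoose k) * c \<pi> ^ k * (((\<lambda>Y. X ** Y) ^^ k) (mat 1)) $ i $ j)
          (L $ i $ j)))"


section \<open>Metric and symmetric Frobenius lifts\<close>

text \<open>
  Throughout, \<open>S\<close> is the ground ring, \<open>c\<close> the structure map to the completed coordinate ring
  \<open>'b\<close>, \<open>x\<close> the matrix of coordinates in \<open>'b\<close> and \<open>f\<close> a lift on \<open>S\<close>. The maps described
  by definite descriptions exist and are unique, since ring homomorphisms between
  \<open>p\<close>-adically complete rings are automatically continuous.
\<close>

definition lift_extending ::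
    "nat \<Rightarrow> nat \<Rightarrow> 'k \<Rightarrow> 'k::comm_ring_1 set \<Rightarrow> ('k \<Rightarrow> 'b::comm_ring_1) \<Rightarrow> ('k \<Rightarrow> 'k) \<Rightarrow> ('b \<Rightarrow> 'b) \<Rightarrow> bool" where
  "lift_extending p s \<pi> S c f \<phi> \<longleftrightarrow>
     frobenius_lift_on p s (c \<pi>) UNIV \<phi> \<and> (\<forall>r\<in>S. \<phi> (c r) = c (f r))"

definition base_lift ::
    "nat \<Rightarrow> nat \<Rightarrow> 'k \<Rightarrow> 'k::comm_ring_1 set \<Rightarrow> ('k \<Rightarrow> 'b::comm_ring_1) \<Rightarrow> 'b ^ 'n::finite ^ 'n \<Rightarrow> ('k \<Rightarrow> 'k) \<Rightarrow> 'b \<Rightarrow> 'b" where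
  "base_lift p s \<pi> S c x f =
     (THE \<phi>. lift_extending p s \<pi> S c f \<phi> \<and> map_matrix \<phi> x = entry_power (p ^ s) x)"

definition metric_map ::
    "'k::comm_ring_1 set \<Rightarrow> ('k \<Rightarrow> 'b::comm_ring_1) \<Rightarrow> 'b ^ 'n::finite ^ 'n \<Rightarrow> 'k ^ 'n ^ 'n \<Rightarrow> 'b \<Rightarrow> 'b" where
  "metric_map S c x q =
     (THE h. ring_hom_on UNIV UNIV h \<and> (\<forall>r\<in>S. h (c r) = c r) \<and>
        map_matrix h x = transpose x ** map_matrix c q ** x)"

definition metric_lift ::
    "nat \<Rightarrow> nat \<Rightarrow> 'k \<Rightarrow> 'k::comm_ring_1 set \<Rightarrow> ('k \<Rightarrow> 'b::comm_ring_1) \<Rightarrow> 'b ^ 'n::finite ^ 'n \<Rightarrow> ('k \<Rightarrow> 'k) \<Rightarrow>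
     'k ^ 'n ^ 'n \<Rightarrow> ('b \<Rightarrow> 'b) \<Rightarrow> bool" where
  "metric_lift p s \<pi> S c x f q \<phi> \<longleftrightarrow>
     \<phi> \<circ> metric_map S c x q = metric_map S c x q \<circ> base_lift p s \<pi> S c x f"

definition bilinear_map ::
    "'k::comm_ring_1 set \<Rightarrow> ('k \<Rightarrow> 'b::comm_ring_1) \<Rightarrow> 'b ^ 'n::finite ^ 'n \<Rightarrow>
     ('b \<Rightarrow> 't::comm_ring_1) \<Rightarrow> ('b \<Rightarrow> 't) \<Rightarrow> 'k ^ 'n ^ 'n \<Rightarrow> 'b \<Rightarrow> 't" where
  "bilinear_map S c x i\<^sub>1 i\<^sub>2 q =
     (THE h. ring_hom_on UNIV UNIV h \<and> (\<forall>r\<in>S. h (c r) = i\<^sub>1 (c r)) \<and>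
        map_matrix h x =
          transpose (map_matrix i\<^sub>1 x) ** map_matrix (\<lambda>r. i\<^sub>1 (c r)) q ** map_matrix i\<^sub>2 x)"

definition tensor_map ::
    "('b::comm_ring_1 \<Rightarrow> 't::comm_ring_1) \<Rightarrow> ('b \<Rightarrow> 't) \<Rightarrow> ('b \<Rightarrow> 'b) \<Rightarrow> ('b \<Rightarrow> 'b) \<Rightarrow> 't \<Rightarrow> 't" where
  "tensor_map i\<^sub>1 i\<^sub>2 \<phi> \<psi> =
     (THE h. ring_hom_on UNIV UNIV h \<and>
        (\<forall>a b. h (i\<^sub>1 a * i\<^sub>2 b) = i\<^sub>1 (\<phi> a) * i\<^sub>2 (\<psi> b)))"

definition tensor_multiplication ::
    "('b::comm_ring_1 \<Rightarrow> 't::comm_ring_1) \<Rightarrow> ('b \<Rightarrow> 't) \<Rightarrow> 't \<Rightarrow> 'b" where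
  "tensor_multiplication i\<^sub>1 i\<^sub>2 =
     (THE h. ring_hom_on UNIV UNIV h \<and> (\<forall>a b. h (i\<^sub>1 a * i\<^sub>2 b) = a * b))"

definition symmetric_lift ::
    "nat \<Rightarrow> nat \<Rightarrow> 'k \<Rightarrow> 'k::comm_ring_1 set \<Rightarrow> ('k \<Rightarrow> 'b::comm_ring_1) \<Rightarrow> 'b ^ 'n::finite ^ 'n \<Rightarrow>
     ('b \<Rightarrow> 't::comm_ring_1) \<Rightarrow> ('b \<Rightarrow> 't) \<Rightarrow> ('k \<Rightarrow> 'k) \<Rightarrow> 'k ^ 'n ^ 'n \<Rightarrow> ('b \<Rightarrow> 'b) \<Rightarrow> bool" where
  "symmetric_lift p s \<pi> S c x i\<^sub>1 i\<^sub>2 f q \<phi> \<longleftrightarrow>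
     (let \<phi>\<^sub>0 = base_lift p s \<pi> S c x f;
          \<mu> = tensor_multiplication i\<^sub>1 i\<^sub>2;
          \<B> = bilinear_map S c x i\<^sub>1 i\<^sub>2 q
      in \<mu> \<circ> tensor_map i\<^sub>1 i\<^sub>2 \<phi> \<phi>\<^sub>0 \<circ> \<B> = \<mu> \<circ> tensor_map i\<^sub>1 i\<^sub>2 \<phi>\<^sub>0 \<phi> \<circ> \<B>)"

end

theory Submission
  imports Defs "HOL-Computational_Algebra.Formal_Power_Series"
begin

text \<open>
  A homomorphism from the completed coordinate ring to a \<open>p\<close>-adically complete ring is the same as
  a homomorphism on the ground ring together with an invertible matrix, the image of \<open>x\<close>. So a lift
  \<open>\<phi>\<close> amounts to a matrix \<open>\<Lambda> \<equiv> 1\<close> modulo \<open>\<pi>\<close> with \<open>\<phi>(x) = x\<^bsup>(p^s)\<^esup> \<Lambda>\<close>. With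
  \<open>A = x\<^bsup>(p^s)t\<^esup> \<phi>(q) x\<^bsup>(p^s)\<^esup>\<close> and \<open>B = (x\<^sup>t q x)\<^bsup>(p^s)\<^esup>\<close>, symmetry says \<open>\<Lambda>\<^sup>t A = A \<Lambda>\<close> and
  metricity says \<open>\<Lambda>\<^sup>t A \<Lambda> = B\<close>; together they give \<open>\<Lambda>\<^sup>2 = A\<^sup>-\<^sup>1 B \<equiv> 1\<close>. As 2 is invertible and the
  \<open>\<pi>\<close>-adic and \<open>p\<close>-adic topologies agree, a square root that is 1 modulo \<open>\<pi>\<close> is unique, and the
  binomial series provides one. Its symmetry follows from uniqueness, since \<open>A\<^sup>-\<^sup>1 \<Lambda>\<^sup>t A\<close> is another one.
\<close>


section \<open>Homomorphisms on subrings\<close>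

text \<open>Completeness is p-adic while the congruences are modulo \<open>\<pi>\<close>, so two
  divisibilities are needed: \<open>p\<close> divides a power of \<open>\<pi>\<close>, and
  \<open>\<pi>\<close> divides \<open>p\<close>. Both must hold inside \<open>R[\<pi>]\<close>, and
  an absolute value at most 1 does not by itself put a quotient into that ring. The first therefore
  comes from an explicit relation: the powers of \<open>\<pi>\<close> tend to 0 in a
  finite-dimensional space over the p-adic numbers, so some power is a combination of earlier ones
  with coefficients divisible by \<open>p\<close>. The second is read off from the existence of a
  Frobenius lift. A further obstacle is that the metric, bilinear and tensor maps are definite
  descriptions: nothing can be computed with them until existence and uniqueness are known. This is
  the role of the universal properties of the completed coordinate ring and of the completed tensor
  square. In both, a homomorphism is given on a dense subring and extended by a continuity that
  costs nothing, because ring homomorphisms preserve divisibility by powers of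
  \<open>p\<close>.\<close>

definition is_subring :: "'a::comm_ring_1 set \<Rightarrow> bool" where
  "is_subring S \<longleftrightarrow> 1 \<in> S \<and> (\<forall>a\<in>S. \<forall>b\<in>S. a - b \<in> S \<and> a * b \<in> S)"

lemma is_subring_UNIV [simp]: "is_subring UNIV"
  by (simp add: is_subring_def)

lemma is_subring_subring_gen: "is_subring (subring_gen A)"
  by (simp add: is_subring_def subring_gen.intros)

context
  fixes S :: "'a::comm_ring_1 set"
  assumes S: "is_subring S"
begin

lemma subring_one: "1 \<in> S"
  using S by (simp add: is_subring_def)

lemma subring_diff: "a \<in> S \<Longrightarrow> b \<in> S \<Longrightarrow> a - b \<in> S"
  using S by (simp add: is_subring_def)

lemma subring_mult: "a \<in> S \<Longrightarrow> b \<in> S \<Longrightarrow> a * b \<in> S"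
  using S by (simp add: is_subring_def)

lemma subring_zero: "0 \<in> S"
  using subring_diff[OF subring_one subring_one] by simp

lemma subring_uminus: "a \<in> S \<Longrightarrow> - a \<in> S"
  using subring_diff[OF subring_zero, of a] by simp

lemma subring_add: "a \<in> S \<Longrightarrow> b \<in> S \<Longrightarrow> a + b \<in> S"
  using subring_diff[OF _ subring_uminus, of a b] by simp

lemma subring_of_nat: "of_nat m \<in> S"
  by (induction m) (auto intro: subring_zero subring_one subring_add)

lemma subring_of_int: "of_int m \<in> S"
  by (cases m) (auto intro: subring_of_nat subring_uminus simp del: of_nat_Suc)

lemma subring_power: "a \<in> S \<Longrightarrow> a ^ m \<in> S"
  by (induction m) (auto intro: subring_one subring_mult)

lemma subring_sum: "(\<And>i. i \<in> I \<Longrightarrow> u i \<in> S) \<Longrightarrow> sum u I \<in> S"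
  by (induction I rule: infinite_finite_induct) (auto intro: subring_zero subring_add)

lemma subring_prod: "(\<And>i. i \<in> I \<Longrightarrow> u i \<in> S) \<Longrightarrow> prod u I \<in> S"
  by (induction I rule: infinite_finite_induct) (auto intro: subring_one subring_mult)

lemma subring_det: "(\<And>i j. A $ i $ j \<in> S) \<Longrightarrow> det A \<in> S"
  unfolding det_def by (intro subring_sum subring_mult subring_of_int subring_prod)

end

lemmas subring_closed = subring_one subring_diff subring_mult subring_zero subring_uminus
  subring_add subring_of_nat subring_of_int subring_power subring_sum subring_prod

locale subring_hom =
  fixes S :: "'a::comm_ring_1 set" and h :: "'a \<Rightarrow> 'b::comm_ring_1"
  assumes subring: "is_subring S" and hom: "ring_hom_on S UNIV h"
begin

lemma one: "h 1 = 1"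
  using hom by (simp add: ring_hom_on_def)

lemma add: "a \<in> S \<Longrightarrow> b \<in> S \<Longrightarrow> h (a + b) = h a + h b"
  using hom by (simp add: ring_hom_on_def)

lemma mult: "a \<in> S \<Longrightarrow> b \<in> S \<Longrightarrow> h (a * b) = h a * h b"
  using hom by (simp add: ring_hom_on_def)

lemma zero: "h 0 = 0"
  using add[of 0 0] subring_zero[OF subring] by simp

lemma uminus: "a \<in> S \<Longrightarrow> h (- a) = - h a"
  using add[of a "- a"] zero subring_uminus[OF subring] by (simp add: add_eq_0_iff)

lemma diff: "a \<in> S \<Longrightarrow> b \<in> S \<Longrightarrow> h (a - b) = h a - h b"
  using add[of a "- b"] uminus subring_uminus[OF subring] by simp

lemma of_nat: "h (of_nat m) = of_nat m"
  by (induction m) (simp_all add: zero one add subring_of_nat subring_one subring)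

lemma of_int: "h (of_int m) = of_int m"
  by (cases m) (simp_all add: of_nat uminus subring_of_nat subring del: of_nat_Suc)

lemma power: "a \<in> S \<Longrightarrow> h (a ^ m) = h a ^ m"
  by (induction m) (simp_all add: one mult subring_power subring)

lemma sum: "(\<And>i. i \<in> I \<Longrightarrow> u i \<in> S) \<Longrightarrow> h (\<Sum>i\<in>I. u i) = (\<Sum>i\<in>I. h (u i))"
  by (induction I rule: infinite_finite_induct) (simp_all add: zero add subring_sum subring)

lemma prod: "(\<And>i. i \<in> I \<Longrightarrow> u i \<in> S) \<Longrightarrow> h (\<Prod>i\<in>I. u i) = (\<Prod>i\<in>I. h (u i))"
  by (induction I rule: infinite_finite_induct) (simp_all add: one mult subring_prod subring)

lemma det: "(\<And>i j. A $ i $ j \<in> S) \<Longrightarrow> h (det A) = det (map_matrix h A)"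
  by (simp add: det_def sum mult prod of_int subring_mult subring_of_int subring_prod subring)

lemma matrix_mult:
  "(\<And>i j. A $ i $ j \<in> S) \<Longrightarrow> (\<And>i j. B $ i $ j \<in> S) \<Longrightarrow>
    map_matrix h (A ** B) = map_matrix h A ** map_matrix h B"
  by (simp add: vec_eq_iff matrix_matrix_mult_def sum mult subring_mult subring)

lemma mat_1: "map_matrix h (mat 1) = mat 1"
  by (simp add: vec_eq_iff mat_def zero one)

end

lemma map_matrix_transpose: "map_matrix h (transpose A) = transpose (map_matrix h A)"
  by (simp add: vec_eq_iff transpose_def)

lemma map_matrix_comp: "map_matrix h (map_matrix g A) = map_matrix (\<lambda>a. h (g a)) A"
  by (simp add: vec_eq_iff)

lemma ring_hom_on_id: "ring_hom_on S UNIV (\<lambda>a. a)"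
  by (simp add: ring_hom_on_def)

lemma ring_hom_on_comp:
  "ring_hom_on S T g \<Longrightarrow> ring_hom_on T U h \<Longrightarrow> ring_hom_on S U (\<lambda>a. h (g a))"
  by (auto simp: ring_hom_on_def image_subset_iff)

lemma ring_hom_on_UNIV_target: "ring_hom_on S T g \<Longrightarrow> ring_hom_on S UNIV g"
  by (auto simp: ring_hom_on_def)

lemma subring_hom_agree_on_gen:
  assumes g: "subring_hom (subring_gen A) g" and h: "subring_hom (subring_gen A) h"
    and eq: "\<And>a. a \<in> A \<Longrightarrow> g a = h a" and a: "a \<in> subring_gen A"
  shows "g a = h a"
  using a
proof induction
  case (diff a b)
  then show ?case using subring_hom.diff[OF g] subring_hom.diff[OF h] by simp
next
  case (mult a b)
  then show ?case using subring_hom.mult[OF g] subring_hom.mult[OF h] by simp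
qed (auto simp: eq subring_hom.one[OF g] subring_hom.one[OF h])


section \<open>Congruences and the Frobenius map\<close>

lemma dvd_diff_trans: "(d::'a::comm_ring_1) dvd a - b \<Longrightarrow> d dvd b - e \<Longrightarrow> d dvd a - e"
  using dvd_add[of d "a - b" "b - e"] by simp

lemma dvd_diff_sym: "(d::'a::comm_ring_1) dvd a - b \<Longrightarrow> d dvd b - a"
  using dvd_minus_iff[of d "a - b"] by simp

lemma dvd_diff_mult:
  "(d::'a::comm_ring_1) dvd a - a' \<Longrightarrow> d dvd b - b' \<Longrightarrow> d dvd a * b - a' * b'"
proof -
  assume "d dvd a - a'" "d dvd b - b'"
  then have "d dvd (a - a') * b + a' * (b - b')"
    by (intro dvd_add dvd_mult dvd_mult2)
  then show ?thesis by (simp add: algebra_simps)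
qed

lemma dvd_diff_power: "(d::'a::comm_ring_1) dvd a - b \<Longrightarrow> d dvd a ^ m - b ^ m"
  by (induction m) (auto intro: dvd_diff_mult)

lemma dvd_diff_sum:
  fixes d :: "'a::comm_ring_1"
  assumes "\<And>i. i \<in> I \<Longrightarrow> d dvd u i - v i"
  shows "d dvd sum u I - sum v I"
  unfolding sum_subtractf[symmetric] by (rule dvd_sum) (rule assms)

lemma dvd_diff_prod:
  fixes d :: "'a::comm_ring_1"
  assumes "\<And>i. i \<in> I \<Longrightarrow> d dvd u i - v i"
  shows "d dvd prod u I - prod v I"
  using assms by (induction I rule: infinite_finite_induct) (auto intro: dvd_diff_mult)

lemma dvd_diff_det:
  fixes d :: "'a::comm_ring_1"
  assumes "\<And>i j. d dvd A $ i $ j - B $ i $ j"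
  shows "d dvd det A - det B"
  unfolding det_def by (intro dvd_diff_sum dvd_diff_mult dvd_diff_prod) (auto simp: assms)

lemma dvd_diff_matrix_mult:
  fixes d :: "'a::comm_ring_1"
  assumes "\<And>i j. d dvd A $ i $ j - A' $ i $ j" "\<And>i j. d dvd B $ i $ j - B' $ i $ j"
  shows "d dvd (A ** B) $ i $ j - (A' ** B') $ i $ j"
  unfolding matrix_matrix_mult_def by (auto intro!: dvd_diff_sum dvd_diff_mult assms)

lemma prime_dvd_power_add:
  fixes a b :: "'a::comm_ring_1"
  assumes "prime p"
  shows "of_nat p dvd (a + b) ^ p - (a ^ p + b ^ p)"
proof -
  have p: "p > 1" using assms prime_gt_1_nat by blast
  let ?t = "\<lambda>k. of_nat (p choose k) * a ^ k * b ^ (p - k)"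
  have "{..p} = insert 0 (insert p {0<..<p})" using p by auto
  then have "(a + b) ^ p = b ^ p + a ^ p + (\<Sum>k\<in>{0<..<p}. ?t k)"
    using p by (simp add: binomial_ring add.assoc)
  moreover have "of_nat p dvd (\<Sum>k\<in>{0<..<p}. ?t k)"
  proof (rule dvd_sum)
    fix k assume "k \<in> {0<..<p}"
    then have "p dvd (p choose k)" using assms by (intro dvd_choose_prime) auto
    then have "of_nat p dvd (of_nat (p choose k) :: 'a)" by (metis dvd_def of_nat_mult)
    then show "of_nat p dvd ?t k" by simp
  qed
  ultimately show ?thesis by (simp add: algebra_simps)
qed

lemma Frobenius_add:
  fixes a b :: "'a::comm_ring_1"
  assumes "prime p"
  shows "of_nat p dvd (a + b) ^ (p ^ s) - (a ^ (p ^ s) + b ^ (p ^ s))"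
proof (induction s)
  case (Suc s)
  have "of_nat p dvd ((a + b) ^ (p ^ s)) ^ p - (a ^ (p ^ s) + b ^ (p ^ s)) ^ p"
    by (rule dvd_diff_power[OF Suc])
  from dvd_diff_trans[OF this prime_dvd_power_add[OF assms]] show ?case
    by (simp add: power_mult[symmetric] mult.commute)
qed simp

lemma Frobenius_diff:
  fixes a b :: "'a::comm_ring_1"
  assumes "prime p"
  shows "of_nat p dvd (a - b) ^ (p ^ s) - (a ^ (p ^ s) - b ^ (p ^ s))"
  using Frobenius_add[OF assms, of "a - b" b s] by (subst dvd_minus_iff[symmetric])
    (simp add: algebra_simps)

lemma Frobenius_sum:
  fixes u :: "'i \<Rightarrow> 'a::comm_ring_1"
  assumes "prime p"
  shows "of_nat p dvd sum u I ^ (p ^ s) - (\<Sum>i\<in>I. u i ^ (p ^ s))"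
proof (induction I rule: infinite_finite_induct)
  case (insert i I)
  then have "of_nat p dvd (u i ^ (p ^ s) + sum u I ^ (p ^ s)) -
      (u i ^ (p ^ s) + (\<Sum>i\<in>I. u i ^ (p ^ s)))"
    by simp
  from dvd_diff_trans[OF Frobenius_add[OF assms] this] show ?case
    using insert by simp
qed (use assms in \<open>auto simp: power_0_left prime_gt_0_nat\<close>)

text \<open>Entrywise powers do not respect matrix products, but modulo \<open>p\<close> they do,
  since each entry of a product is a sum. This is what makes the powered matrices comparable with
  products of powers later.\<close>

lemma Frobenius_matrix_mult:
  fixes A B :: "'a::comm_ring_1 ^ 'n::finite ^ 'n"
  assumes "prime p"
  shows "of_nat p dvd (entry_power (p ^ s) (A ** B)) $ i $ j -
    (entry_power (p ^ s) A ** entry_power (p ^ s) B) $ i $ j"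
  using Frobenius_sum[OF assms, of "\<lambda>k. A $ i $ k * B $ k $ j" UNIV s]
  by (simp add: matrix_matrix_mult_def power_mult_distrib)


section \<open>The ground ring\<close>

context padic_ambient_field
begin

abbreviation Qp :: "'k set" where
  "Qp \<equiv> padic_numbers \<nu>"

lemma p_gt_1: "real p > 1"
  using prime_gt_1_nat[OF prime_p] by simp

lemma nu_zero [simp]: "\<nu> 0 = 0"
  by (simp add: eq_0_iff)

lemma nu_one [simp]: "\<nu> 1 = 1"
  using mult[of 1 1] eq_0_iff[of 1] by simp

lemma nu_minus [simp]: "\<nu> (- x) = \<nu> x"
proof -
  have "\<nu> (- 1) * \<nu> (- 1) = 1" using mult[of "- 1" "- 1"] by simp
  then have "(\<nu> (- 1) - 1) * (\<nu> (- 1) + 1) = 0" by (simp add: algebra_simps)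
  then have "\<nu> (- 1) = 1" using nonneg[of "- 1"] by auto
  then show ?thesis using mult[of "- 1" x] by simp
qed

lemma nu_minus_commute: "\<nu> (x - y) = \<nu> (y - x)"
  using nu_minus[of "x - y"] by simp

lemma nu_diff: "\<nu> (x - y) \<le> max (\<nu> x) (\<nu> y)"
  using ultrametric[of x "- y"] by simp

lemma nu_add_le: "\<nu> (x + y) \<le> \<nu> x + \<nu> y"
  using ultrametric[of x y] nonneg[of x] nonneg[of y] by linarith

lemma nu_power: "\<nu> (x ^ k) = \<nu> x ^ k"
  by (induction k) (simp_all add: mult)

lemma nu_inverse: "\<nu> (inverse x) = inverse (\<nu> x)"
proof (cases "x = 0")
  case False
  then have "\<nu> x * \<nu> (inverse x) = 1" using mult[of x "inverse x"] by simp
  then show ?thesis by (simp add: inverse_unique)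
qed simp

lemma nu_divide: "\<nu> (x / y) = \<nu> x / \<nu> y"
  by (simp add: divide_inverse mult nu_inverse)

lemma nu_sum_le:
  assumes "\<And>i. i \<in> I \<Longrightarrow> \<nu> (u i) \<le> C" "0 \<le> C"
  shows "\<nu> (sum u I) \<le> C"
  using assms
proof (induction I rule: infinite_finite_induct)
  case (insert i I)
  then have "\<nu> (u i) \<le> C" "\<nu> (sum u I) \<le> C" by auto
  then show ?case using ultrametric[of "u i" "sum u I"] insert.hyps by simp
qed simp_all

lemma nu_sum_le_sum: "\<nu> (sum u I) \<le> (\<Sum>i\<in>I. \<nu> (u i))"
proof (induction I rule: infinite_finite_induct)
  case (insert i I)
  then show ?case using nu_add_le[of "u i" "sum u I"] by simp
qed simp_all

lemma nu_of_nat_le: "\<nu> (of_nat m) \<le> 1"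
proof (induction m)
  case (Suc m)
  then show ?case using ultrametric[of 1 "of_nat m"] by simp
qed simp

lemma nu_of_int_le: "\<nu> (of_int m) \<le> 1"
  by (cases m) (use nu_of_nat_le in \<open>auto simp del: of_nat_Suc\<close>)

lemma nu_of_int_dvd:
  assumes "int p dvd m"
  shows "\<nu> (of_int m) \<le> 1 / p"
proof -
  obtain k where "m = int p * k" using assms by auto
  then have "\<nu> (of_int m) = 1 / p * \<nu> (of_int k)" by (simp add: mult normalized)
  then show ?thesis using nu_of_int_le[of k] p_gt_1 by (simp add: field_simps)
qed

text \<open>In a Bezout relation between \<open>p\<close> and \<open>m\<close> the multiple of
  \<open>p\<close> has value below 1, so the multiple of \<open>m\<close> must have value at least
  1.\<close>

lemma nu_of_int_coprime:
  assumes "\<not> int p dvd m"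
  shows "\<nu> (of_int m) = 1"
proof -
  have "coprime (int p) m"
    using assms prime_p by (simp add: prime_imp_coprime)
  then obtain a b where "a * int p + b * m = 1"
    using bezout_int[of "int p" m] by auto
  then have "(of_int a * of_nat p + of_int b * of_int m :: 'k) = 1"
    by (metis of_int_1 of_int_add of_int_mult of_int_of_nat_eq)
  then have "1 \<le> max (\<nu> (of_int a * of_nat p)) (\<nu> (of_int b * of_int m))"
    using ultrametric[of "of_int a * of_nat p" "of_int b * of_int m"] by simp
  moreover have "\<nu> (of_int a * of_nat p) \<le> 1 / p"
    using nu_of_int_dvd[of "a * int p"] by simp
  moreover have "1 / real p < 1" using p_gt_1 by simp
  ultimately have "1 \<le> \<nu> (of_int b * of_int m)" by linarith
  also have "\<dots> \<le> 1 * \<nu> (of_int m)"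
    unfolding mult using nu_of_int_le nonneg by (intro mult_right_mono) auto
  finally show ?thesis using nu_of_int_le[of m] by simp
qed

text \<open>In lowest terms \<open>p\<close> divides at most one of numerator and denominator. If it
  divides the denominator, the value is at least 1; otherwise the value is that of the
  numerator.\<close>

lemma nu_Rats_discrete:
  assumes "r \<in> \<rat>" "\<nu> r < 1"
  shows "\<nu> r \<le> 1 / p"
proof -
  obtain a b where r: "r = of_int a / of_int b" and b: "b > 0" and ab: "coprime a b"
    using assms(1) by (metis Rats_cases')
  show ?thesis
  proof (cases "int p dvd b")
    case True
    then have "\<not> int p dvd a" using ab prime_p coprime_common_divisor not_prime_unit
      by (metis prime_nat_int_transfer)
    then have "\<nu> r = 1 / \<nu> (of_int b)" by (simp add: r nu_divide nu_of_int_coprime)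
    moreover have "\<nu> (of_int b) \<le> 1" "\<nu> (of_int b) > 0"
      using nu_of_int_le[of b] nonneg[of "of_int b"] eq_0_iff[of "of_int b"] b by auto
    ultimately have "\<nu> r \<ge> 1" by simp
    then show ?thesis using assms(2) by simp
  next
    case False
    then have "\<nu> r = \<nu> (of_int a)" by (simp add: r nu_divide nu_of_int_coprime)
    then show ?thesis using assms(2) nu_of_int_dvd[of a] nu_of_int_coprime[of a] by fastforce
  qed
qed

section \<open>The p-adic numbers as a closed, discretely valued subfield\<close>

lemma Rats_subset_Qp: "\<rat> \<subseteq> Qp"
  unfolding padic_numbers_def val_closure_def by (auto intro!: bexI)

lemma of_nat_in_Qp: "of_nat m \<in> Qp"
  using Rats_subset_Qp Rats_of_nat by blast

lemma Qp_approx: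
  assumes "a \<in> Qp" "e > 0"
  obtains r where "r \<in> \<rat>" "\<nu> (a - r) < e"
  using assms unfolding padic_numbers_def val_closure_def by blast

lemma Qp_I:
  assumes "\<And>e. e > 0 \<Longrightarrow> \<exists>r\<in>\<rat>. \<nu> (a - r) < e"
  shows "a \<in> Qp"
  using assms unfolding padic_numbers_def val_closure_def by blast

lemma Qp_closed:
  assumes "\<And>e. e > 0 \<Longrightarrow> \<exists>b\<in>Qp. \<nu> (a - b) < e"
  shows "a \<in> Qp"
proof (rule Qp_I)
  fix e :: real assume e: "e > 0"
  obtain b where b: "b \<in> Qp" "\<nu> (a - b) < e" using assms e by blast
  obtain r where r: "r \<in> \<rat>" "\<nu> (b - r) < e" using Qp_approx[OF b(1) e] .
  have "\<nu> (a - r) < e" using ultrametric[of "a - b" "b - r"] b r by simp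
  then show "\<exists>r\<in>\<rat>. \<nu> (a - r) < e" using r by blast
qed

lemma Qp_diff:
  assumes "a \<in> Qp" "b \<in> Qp"
  shows "a - b \<in> Qp"
proof (rule Qp_I)
  fix e :: real assume e: "e > 0"
  obtain r where r: "r \<in> \<rat>" "\<nu> (a - r) < e" using Qp_approx[OF assms(1) e] .
  obtain t where t: "t \<in> \<rat>" "\<nu> (b - t) < e" using Qp_approx[OF assms(2) e] .
  have "\<nu> ((a - b) - (r - t)) < e"
    using nu_diff[of "a - r" "b - t"] r t by (simp add: algebra_simps)
  then show "\<exists>r\<in>\<rat>. \<nu> (a - b - r) < e" using r t by (intro bexI[of _ "r - t"]) auto
qed

lemma Qp_mult:
  assumes "a \<in> Qp" "b \<in> Qp"
  shows "a * b \<in> Qp"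
proof (rule Qp_I)
  fix e :: real assume e: "e > 0"
  \<comment> \<open>The splitting is \<open>a * b - r * t = (a - r) * b + r * (b - t)\<close>, so
    \<open>t\<close> is chosen after \<open>r\<close>, with a tolerance depending on it. The added 1
    keeps the denominators positive.\<close>
  obtain r where r: "r \<in> \<rat>" "\<nu> (a - r) < e / (\<nu> b + 1)"
    using Qp_approx[OF assms(1), of "e / (\<nu> b + 1)"] e nonneg[of b] by auto
  obtain t where t: "t \<in> \<rat>" "\<nu> (b - t) < e / (\<nu> r + 1)"
    using Qp_approx[OF assms(2), of "e / (\<nu> r + 1)"] e nonneg[of r] by auto
  have "\<nu> (a - r) * (\<nu> b + 1) < e" "\<nu> (b - t) * (\<nu> r + 1) < e"
    using r t nonneg[of b] nonneg[of r] by (auto simp: pos_less_divide_eq)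
  then have "\<nu> (a - r) * \<nu> b < e" "\<nu> (b - t) * \<nu> r < e"
    using nonneg[of "a - r"] nonneg[of "b - t"] by (auto simp: algebra_simps)
  then have "\<nu> ((a - r) * b) < e" "\<nu> (r * (b - t)) < e"
    by (auto simp: mult mult.commute)
  then have "\<nu> (a * b - r * t) < e"
    using ultrametric[of "(a - r) * b" "r * (b - t)"] by (simp add: algebra_simps)
  then show "\<exists>r\<in>\<rat>. \<nu> (a * b - r) < e" using r t by (intro bexI[of _ "r * t"]) auto
qed

lemma Qp_inverse:
  assumes "a \<in> Qp"
  shows "inverse a \<in> Qp"
proof (cases "a = 0")
  case True
  then show ?thesis using assms by simp
next
  case False
  then have a: "\<nu> a > 0" using nonneg[of a] eq_0_iff[of a] by simp
  show ?thesis
  proof (rule Qp_I)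
    fix e :: real assume e: "e > 0"
    \<comment> \<open>The bound by \<open>\<nu> a\<close> forces \<open>\<nu> r = \<nu> a\<close>,
      as in an ultrametric triangle; the other bound then controls
      \<open>(r - a) / (a * r)\<close>.\<close>
    obtain r where r: "r \<in> \<rat>" "\<nu> (a - r) < min (\<nu> a) (e * (\<nu> a * \<nu> a))"
      using Qp_approx[OF assms, of "min (\<nu> a) (e * (\<nu> a * \<nu> a))"] e a by auto
    have "\<nu> a \<le> \<nu> r" using ultrametric[of "a - r" r] r by (auto simp: max_def split: if_splits)
    moreover have "\<nu> r \<le> \<nu> a" using nu_diff[of a "a - r"] r by simp
    ultimately have ra: "\<nu> r = \<nu> a" by simp
    then have "r \<noteq> 0" using a by auto
    then have "inverse a - inverse r = (r - a) / (a * r)"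
      using False by (simp add: field_simps)
    then have "\<nu> (inverse a - inverse r) = \<nu> (a - r) / (\<nu> a * \<nu> a)"
      by (simp add: nu_divide mult ra nu_minus_commute)
    also have "\<dots> < e" using r a by (simp add: pos_divide_less_eq)
    finally show "\<exists>r\<in>\<rat>. \<nu> (inverse a - r) < e" using r by (intro bexI[of _ "inverse r"]) auto
  qed
qed

lemma subfield_Qp: "subfield_of Qp Qp"
  using Rats_subset_Qp by (auto simp: subfield_of_def Qp_diff Qp_mult Qp_inverse)

lemma is_subring_Qp: "is_subring Qp"
  using Rats_subset_Qp by (auto simp: is_subring_def Qp_diff Qp_mult)

lemma nu_Qp_discrete:
  assumes "a \<in> Qp" "\<nu> a < 1"
  shows "\<nu> a \<le> 1 / p"
proof -
  have "1 / real p > 0" using p_gt_1 by simp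
  then obtain r where r: "r \<in> \<rat>" "\<nu> (a - r) < 1 / p" using Qp_approx[OF assms(1)] by metis
  have "1 / real p < 1" using p_gt_1 by simp
  then have "\<nu> r < 1" using nu_diff[of a "a - r"] r assms(2) by simp
  then have "\<nu> r \<le> 1 / p" using nu_Rats_discrete r by simp
  then show ?thesis using ultrametric[of "a - r" r] r by simp
qed

lemma p_neq_0: "(of_nat p :: 'k) \<noteq> 0"
  using p_gt_1 by simp

lemma Qp_small_eq_p_mult:
  assumes "a \<in> Qp" "\<nu> a < 1"
  obtains b where "b \<in> Qp" "\<nu> b \<le> 1" "a = of_nat p * b"
proof
  show "a = of_nat p * (a / of_nat p)" using p_neq_0 by simp
  show "a / of_nat p \<in> Qp"
    using Qp_mult[OF assms(1) Qp_inverse[OF of_nat_in_Qp]] by (simp add: divide_inverse)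
  show "\<nu> (a / of_nat p) \<le> 1"
    using nu_Qp_discrete[OF assms] p_gt_1 by (simp add: nu_divide normalized field_simps)
qed

text \<open>The field \<open>Qp\<close> is itself one of the unramified extensions: it is spanned by
  1, and discreteness of its values makes \<open>p\<close> a prime element. Later this puts
  coefficients of relations and inverses of integers prime to \<open>p\<close> into the ground
  ring.\<close>

lemma Zp_subset: "a \<in> Qp \<Longrightarrow> \<nu> a \<le> 1 \<Longrightarrow> a \<in> completed_unramified_integers p \<nu>"
proof -
  assume a: "a \<in> Qp" "\<nu> a \<le> 1"
  have "finite_extension Qp Qp"
    unfolding finite_extension_def
    by (rule conjI[OF subfield_Qp exI[of _ "{1}"]]) (use Rats_subset_Qp in auto)
  moreover have "prime_element_of \<nu> Qp (of_nat p)"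
    unfolding prime_element_of_def ring_of_integers_def
  proof (intro equalityI subsetI)
    fix b assume "b \<in> {a \<in> Qp. \<nu> a < 1}"
    then show "b \<in> (*) (of_nat p) ` {a \<in> Qp. \<nu> a \<le> 1}"
      using Qp_small_eq_p_mult[of b] by (metis (mono_tags, lifting) image_eqI mem_Collect_eq)
  next
    fix b assume "b \<in> (*) (of_nat p) ` {a \<in> Qp. \<nu> a \<le> 1}"
    then obtain a where a: "a \<in> Qp" "\<nu> a \<le> 1" "b = of_nat p * a" by blast
    have "\<nu> b \<le> 1 / p" using a p_gt_1 by (simp add: mult normalized field_simps)
    also have "\<dots> < 1" using p_gt_1 by simp
    finally show "b \<in> {a \<in> Qp. \<nu> a < 1}"
      using a Qp_mult[OF of_nat_in_Qp, of a] by auto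
  qed
  ultimately have "a \<in> maximal_unramified p \<nu>"
    unfolding maximal_unramified_def using a by blast
  then show ?thesis
    using a unfolding completed_unramified_integers_def val_closure_def ring_of_integers_def
    by (auto intro!: bexI[of _ a])
qed

lemma inverse_of_int_in_integers:
  assumes "\<not> int p dvd m"
  shows "inverse (of_int m) \<in> completed_unramified_integers p \<nu>"
  by (rule Zp_subset)
    (use Rats_subset_Qp in \<open>auto simp: nu_inverse nu_of_int_coprime[OF assms]\<close>)

section \<open>Finite-dimensional spaces over the p-adic numbers\<close>

lemma geometric_steps_converge:
  assumes "\<And>n. \<nu> (u (Suc n) - u n) \<le> C * (1/2) ^ n" and C: "C \<ge> 0"
  shows "\<exists>a. (\<lambda>n. \<nu> (u n - a)) \<longlonglongrightarrow> 0"
proof (rule complete, intro allI impI)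
  have step: "\<nu> (u (n + k) - u n) \<le> C * (1/2) ^ n" for n k
  proof (induction k)
    case 0
    then show ?case using C by simp
  next
    case (Suc k)
    have "C * (1/2) ^ (n + k) \<le> C * (1/2) ^ n"
      using C by (intro mult_left_mono power_decreasing) auto
    then have "\<nu> (u (Suc (n + k)) - u (n + k)) \<le> C * (1/2) ^ n"
      using assms(1)[of "n + k"] by simp
    then show ?case
      using ultrametric[of "u (Suc (n + k)) - u (n + k)" "u (n + k) - u n"] Suc by simp
  qed
  fix e :: real assume e: "e > 0"
  have "(\<lambda>n. C * (1/2) ^ n) \<longlonglongrightarrow> C * 0"
    by (intro tendsto_mult tendsto_const LIMSEQ_power_zero) auto
  then have "\<forall>\<^sub>F n in sequentially. C * (1/2) ^ n < e"
    using order_tendstoD(2)[of _ "C * 0" sequentially e] e by simp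
  then obtain M where M: "C * (1/2) ^ M < e"
    unfolding eventually_sequentially by blast
  have "\<nu> (u k - u l) < e" if "k \<ge> M" "l \<ge> M" for k l
  proof -
    have "\<nu> (u k - u M) < e" "\<nu> (u l - u M) < e"
      using step[of M "k - M"] step[of M "l - M"] M that by auto
    then show ?thesis using nu_diff[of "u k - u M" "u l - u M"] by simp
  qed
  then show "\<exists>M. \<forall>k\<ge>M. \<forall>l\<ge>M. \<nu> (u k - u l) < e" by blast
qed

lemma Qp_limit:
  assumes "\<And>n. u n \<in> Qp" "(\<lambda>n. \<nu> (u n - a)) \<longlonglongrightarrow> 0"
  shows "a \<in> Qp"
proof (rule Qp_closed)
  fix e :: real assume "e > 0"
  then have "\<forall>\<^sub>F n in sequentially. \<nu> (u n - a) < e"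
    using order_tendstoD(2)[OF assms(2)] by simp
  then obtain n where "\<nu> (u n - a) < e"
    unfolding eventually_sequentially by blast
  then show "\<exists>b\<in>Qp. \<nu> (a - b) < e" using assms(1) nu_minus_commute by metis
qed

text \<open>Approximants of \<open>v\<close> differ by geometrically small vectors, and
  \<open>bounded\<close> writes these with geometrically small coefficients. Completeness supplies
  limits of the accumulated coefficients, and these limits represent \<open>v\<close>.\<close>

lemma bounded_coefficients_imp_closed:
  assumes B: "finite B" and C: "C > 0"
    and bounded: "\<And>a. \<forall>b\<in>B. a b \<in> Qp \<Longrightarrow>
      \<exists>a'. (\<forall>b\<in>B. a' b \<in> Qp \<and> \<nu> (a' b) \<le> C * \<nu> (\<Sum>b\<in>B. a b * b)) \<and>
           (\<Sum>b\<in>B. a' b * b) = (\<Sum>b\<in>B. a b * b)"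
    and approx: "\<And>e. e > 0 \<Longrightarrow> \<exists>a. (\<forall>b\<in>B. a b \<in> Qp) \<and> \<nu> (v - (\<Sum>b\<in>B. a b * b)) < e"
  shows "\<exists>a. (\<forall>b\<in>B. a b \<in> Qp) \<and> v = (\<Sum>b\<in>B. a b * b)"
proof -
  have "\<forall>n. \<exists>a. (\<forall>b\<in>B. a b \<in> Qp) \<and> \<nu> (v - (\<Sum>b\<in>B. a b * b)) < (1/2) ^ n"
    using approx by simp
  then obtain \<alpha> where \<alpha>: "\<And>n b. b \<in> B \<Longrightarrow> \<alpha> n b \<in> Qp"
    and \<alpha>_lim: "\<And>n. \<nu> (v - (\<Sum>b\<in>B. \<alpha> n b * b)) < (1/2) ^ n"
    by metis
  define w where "w n = (\<Sum>b\<in>B. \<alpha> n b * b)" for n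
  have step: "\<nu> (w (Suc n) - w n) \<le> (1/2) ^ n" for n
  proof -
    have "(1/2::real) ^ Suc n \<le> (1/2) ^ n" by (rule power_decreasing) auto
    then have "\<nu> (v - w (Suc n)) < (1/2) ^ n" "\<nu> (v - w n) < (1/2) ^ n"
      using \<alpha>_lim[of n] \<alpha>_lim[of "Suc n"] unfolding w_def by linarith+
    then show ?thesis using nu_diff[of "v - w n" "v - w (Suc n)"] by simp
  qed
  have "\<exists>e. (\<forall>b\<in>B. e b \<in> Qp \<and> \<nu> (e b) \<le> C * (1/2) ^ n) \<and> w (Suc n) - w n = (\<Sum>b\<in>B. e b * b)"
    for n
  proof -
    have eq: "(\<Sum>b\<in>B. (\<alpha> (Suc n) b - \<alpha> n b) * b) = w (Suc n) - w n"
      by (simp add: w_def sum_subtractf left_diff_distrib)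
    obtain a' where a': "\<forall>b\<in>B. a' b \<in> Qp \<and> \<nu> (a' b) \<le> C * \<nu> (w (Suc n) - w n)"
        "(\<Sum>b\<in>B. a' b * b) = w (Suc n) - w n"
      using bounded[of "\<lambda>b. \<alpha> (Suc n) b - \<alpha> n b"] \<alpha> Qp_diff unfolding eq by blast
    have "C * \<nu> (w (Suc n) - w n) \<le> C * (1/2) ^ n" using step C by simp
    then show ?thesis using a' by (intro exI[of _ a']) force
  qed
  then obtain e where e: "\<And>n b. b \<in> B \<Longrightarrow> e n b \<in> Qp"
    and e_le: "\<And>n b. b \<in> B \<Longrightarrow> \<nu> (e n b) \<le> C * (1/2) ^ n"
    and e_sum: "\<And>n. w (Suc n) - w n = (\<Sum>b\<in>B. e n b * b)"
    by metis
  \<comment> \<open>The coefficients \<open>\<alpha> n\<close> need not converge, as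
    \<open>B\<close> may be dependent and coefficients are then not unique. Accumulating the bounded
    coefficients of the increments represents the same \<open>w n\<close> by sequences that do
    converge.\<close>
  define \<sigma> where "\<sigma> n b = \<alpha> 0 b + (\<Sum>k<n. e k b)" for n b
  have \<sigma>_Qp: "\<sigma> n b \<in> Qp" if "b \<in> B" for n b
    unfolding \<sigma>_def using \<alpha> e that
    by (intro subring_add[OF is_subring_Qp] subring_sum[OF is_subring_Qp]) auto
  have \<sigma>_sum: "(\<Sum>b\<in>B. \<sigma> n b * b) = w n" for n
  proof (induction n)
    case (Suc n)
    have "(\<Sum>b\<in>B. \<sigma> (Suc n) b * b) = (\<Sum>b\<in>B. \<sigma> n b * b) + (\<Sum>b\<in>B. e n b * b)"
      by (simp add: \<sigma>_def algebra_simps sum.distrib)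
    then show ?case using Suc by (simp flip: e_sum)
  qed (simp add: \<sigma>_def w_def)
  have "\<forall>b\<in>B. \<exists>a. (\<lambda>n. \<nu> (\<sigma> n b - a)) \<longlonglongrightarrow> 0"
    using e_le C by (intro ballI geometric_steps_converge[of _ C]) (auto simp: \<sigma>_def)
  then obtain a where a: "\<And>b. b \<in> B \<Longrightarrow> (\<lambda>n. \<nu> (\<sigma> n b - a b)) \<longlonglongrightarrow> 0"
    by metis
  have "\<nu> (v - (\<Sum>b\<in>B. a b * b)) \<le> (1/2) ^ n + (\<Sum>b\<in>B. \<nu> (\<sigma> n b - a b) * \<nu> b)" for n
  proof -
    have "v - (\<Sum>b\<in>B. a b * b) = (v - w n) + (\<Sum>b\<in>B. (\<sigma> n b - a b) * b)"
      by (simp add: \<sigma>_sum sum_subtractf left_diff_distrib)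
    then have "\<nu> (v - (\<Sum>b\<in>B. a b * b)) \<le> \<nu> (v - w n) + \<nu> (\<Sum>b\<in>B. (\<sigma> n b - a b) * b)"
      by (simp only: nu_add_le)
    also have "\<dots> \<le> (1/2) ^ n + (\<Sum>b\<in>B. \<nu> ((\<sigma> n b - a b) * b))"
      using \<alpha>_lim[of n] nu_sum_le_sum by (intro add_mono) (auto simp: w_def)
    finally show ?thesis by (simp add: mult)
  qed
  moreover have "(\<lambda>n. (1/2) ^ n + (\<Sum>b\<in>B. \<nu> (\<sigma> n b - a b) * \<nu> b)) \<longlonglongrightarrow> 0 + (\<Sum>b\<in>B. 0 * \<nu> b)"
    by (intro tendsto_add tendsto_sum tendsto_mult tendsto_const a LIMSEQ_power_zero) auto
  ultimately have "\<nu> (v - (\<Sum>b\<in>B. a b * b)) \<le> 0"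
    by (intro LIMSEQ_le_const[of _ 0]) auto
  then have "v = (\<Sum>b\<in>B. a b * b)" using nonneg[of "v - (\<Sum>b\<in>B. a b * b)"] eq_0_iff by simp
  moreover have "\<forall>b\<in>B. a b \<in> Qp" using Qp_limit[OF \<sigma>_Qp a] by blast
  ultimately show ?thesis by blast
qed

text \<open>The norm on a finite-dimensional space over a complete field dominates the coordinates: the
  last basis vector has positive distance from the span of the others, which is closed.\<close>

lemma bounded_coefficients:
  assumes "finite B"
  shows "\<exists>C>0. \<forall>a. (\<forall>b\<in>B. a b \<in> Qp) \<longrightarrow>
    (\<exists>a'. (\<forall>b\<in>B. a' b \<in> Qp \<and> \<nu> (a' b) \<le> C * \<nu> (\<Sum>b\<in>B. a b * b)) \<and>
          (\<Sum>b\<in>B. a' b * b) = (\<Sum>b\<in>B. a b * b))"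
  using assms
proof induction
  case empty
  then show ?case by (intro exI[of _ 1]) auto
next
  case (insert v B)
  from insert.IH obtain C where C: "C > 0"
    and bounded: "\<And>a. \<forall>b\<in>B. a b \<in> Qp \<Longrightarrow>
      \<exists>a'. (\<forall>b\<in>B. a' b \<in> Qp \<and> \<nu> (a' b) \<le> C * \<nu> (\<Sum>b\<in>B. a b * b)) \<and>
           (\<Sum>b\<in>B. a' b * b) = (\<Sum>b\<in>B. a b * b)"
    by blast
  have split: "(\<Sum>b\<in>insert v B. (if b = v then t else a' b) * b) = t * v + (\<Sum>b\<in>B. a' b * b)"
    for t a'
    using insert.hyps by (auto intro!: sum.cong)
  show ?case
  proof (cases "\<exists>a. (\<forall>b\<in>B. a b \<in> Qp) \<and> v = (\<Sum>b\<in>B. a b * b)")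
    case True
    then obtain \<alpha> where \<alpha>: "\<forall>b\<in>B. \<alpha> b \<in> Qp" "v = (\<Sum>b\<in>B. \<alpha> b * b)" by blast
    show ?thesis
    proof (intro exI[of _ C] conjI C allI impI)
      fix a assume a: "\<forall>b\<in>insert v B. a b \<in> Qp"
      let ?w = "\<Sum>b\<in>insert v B. a b * b"
      \<comment> \<open>When \<open>v\<close> depends on \<open>B\<close>, its coefficient is
        distributed over \<open>B\<close> and replaced by 0, so the old constant survives.\<close>
      have eq: "(\<Sum>b\<in>B. (a v * \<alpha> b + a b) * b) = ?w"
      proof -
        have "(\<Sum>b\<in>B. (a v * \<alpha> b + a b) * b) = a v * (\<Sum>b\<in>B. \<alpha> b * b) + (\<Sum>b\<in>B. a b * b)"
          by (simp add: algebra_simps sum.distrib sum_distrib_left)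
        then show ?thesis using insert.hyps by (simp flip: \<alpha>(2))
      qed
      have "\<forall>b\<in>B. a v * \<alpha> b + a b \<in> Qp"
        using a \<alpha> by (auto intro!: subring_closed is_subring_Qp)
      then obtain a' where a': "\<forall>b\<in>B. a' b \<in> Qp \<and> \<nu> (a' b) \<le> C * \<nu> ?w"
          "(\<Sum>b\<in>B. a' b * b) = ?w"
        using bounded[of "\<lambda>b. a v * \<alpha> b + a b"] unfolding eq by blast
      have "\<forall>b\<in>insert v B. (if b = v then 0 else a' b) \<in> Qp \<and>
          \<nu> (if b = v then 0 else a' b) \<le> C * \<nu> ?w"
        using a' C nonneg subring_zero[OF is_subring_Qp] by auto
      moreover have "(\<Sum>b\<in>insert v B. (if b = v then 0 else a' b) * b) = ?w"
        unfolding split using a' by simp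
      ultimately show "\<exists>a'. (\<forall>b\<in>insert v B. a' b \<in> Qp \<and> \<nu> (a' b) \<le> C * \<nu> ?w) \<and>
          (\<Sum>b\<in>insert v B. a' b * b) = ?w"
        by (intro exI[of _ "\<lambda>b. if b = v then 0 else a' b"] conjI)
    qed
  next
    case False
    then obtain \<delta> where \<delta>: "\<delta> > 0"
      and far: "\<And>a. \<forall>b\<in>B. a b \<in> Qp \<Longrightarrow> \<delta> \<le> \<nu> (v - (\<Sum>b\<in>B. a b * b))"
      using bounded_coefficients_imp_closed[OF insert.hyps(1) C bounded, of v] not_less by metis
    \<comment> \<open>The first entry bounds the coefficient of \<open>v\<close>: by
      \<open>far\<close>, \<open>\<delta>\<close> times its value is at most the value of the whole
      sum. Removing the \<open>v\<close>-term from the sum then enlarges its value at most by the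
      factor \<open>max 1 (\<nu> v / \<delta>)\<close>, and \<open>C\<close> bounds the remaining
      coefficients, which explains the second entry.\<close>
    define C' where "C' = max (1 / \<delta>) (C * max 1 (\<nu> v / \<delta>))"
    show ?thesis
    proof (intro exI[of _ C'] conjI allI impI)
      show "C' > 0" using \<delta> by (simp add: C'_def less_max_iff_disj)
      fix a assume a: "\<forall>b\<in>insert v B. a b \<in> Qp"
      let ?w = "\<Sum>b\<in>insert v B. a b * b"
      let ?u = "\<Sum>b\<in>B. a b * b"
      have w: "?w = a v * v + ?u" using insert.hyps by simp
      have av: "\<nu> (a v) * \<delta> \<le> \<nu> ?w"
      proof (cases "a v = 0")
        case False
        have "\<forall>b\<in>B. - a b / a v \<in> Qp"
          using a unfolding divide_inverse
          by (auto intro!: subring_closed is_subring_Qp Qp_inverse)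
        from far[OF this] have "\<delta> \<le> \<nu> (v - (\<Sum>b\<in>B. - a b / a v * b))" .
        also have "v - (\<Sum>b\<in>B. - a b / a v * b) = ?w / a v"
          unfolding w using False by (simp add: field_simps sum_negf flip: sum_divide_distrib)
        finally show ?thesis
          using False nonneg[of "a v"] eq_0_iff[of "a v"] by (simp add: nu_divide field_simps)
      qed (simp add: nonneg)
      obtain a' where a': "\<forall>b\<in>B. a' b \<in> Qp \<and> \<nu> (a' b) \<le> C * \<nu> ?u" "(\<Sum>b\<in>B. a' b * b) = ?u"
        using bounded[of a] a by blast
      have "\<nu> (a v) \<le> 1 / \<delta> * \<nu> ?w" using av \<delta> by (simp add: field_simps)
      also have "\<dots> \<le> C' * \<nu> ?w" using nonneg by (intro mult_right_mono) (auto simp: C'_def)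
      finally have le_v: "\<nu> (a v) \<le> C' * \<nu> ?w" .
      have "\<nu> (a v * v) \<le> \<nu> v / \<delta> * \<nu> ?w"
        using mult_right_mono[OF av nonneg[of v]] \<delta> by (simp add: mult field_simps)
      then have "\<nu> ?u \<le> max (\<nu> ?w) (\<nu> v / \<delta> * \<nu> ?w)"
        using nu_diff[of ?w "a v * v"] by (simp add: w)
      also have "\<dots> \<le> max 1 (\<nu> v / \<delta>) * \<nu> ?w"
        using nonneg[of ?w] mult_right_mono[of 1 "max 1 (\<nu> v / \<delta>)" "\<nu> ?w"]
          mult_right_mono[of "\<nu> v / \<delta>" "max 1 (\<nu> v / \<delta>)" "\<nu> ?w"] by simp
      finally have "C * \<nu> ?u \<le> C * max 1 (\<nu> v / \<delta>) * \<nu> ?w" using C by simp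
      also have "\<dots> \<le> C' * \<nu> ?w" using nonneg by (intro mult_right_mono) (auto simp: C'_def)
      finally have le_B: "C * \<nu> ?u \<le> C' * \<nu> ?w" .
      have "\<forall>b\<in>insert v B. (if b = v then a v else a' b) \<in> Qp \<and>
          \<nu> (if b = v then a v else a' b) \<le> C' * \<nu> ?w"
        using a a' le_v le_B order_trans by auto
      moreover have "(\<Sum>b\<in>insert v B. (if b = v then a v else a' b) * b) = ?w"
        unfolding split using a' w by simp
      ultimately show "\<exists>a'. (\<forall>b\<in>insert v B. a' b \<in> Qp \<and> \<nu> (a' b) \<le> C' * \<nu> ?w) \<and>
          (\<Sum>b\<in>insert v B. a' b * b) = ?w"
        by (intro exI[of _ "\<lambda>b. if b = v then a v else a' b"] conjI)
    qed
  qed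
qed

lemma sum_lessThan_add: "(\<Sum>j<m + d. u j) = (\<Sum>j<m. u j) + (\<Sum>i<d. u (m + i))"
  for u :: "nat \<Rightarrow> 'c::comm_monoid_add"
  by (induction d) (simp_all add: add.assoc)

text \<open>Gaussian elimination: a term with nonzero last coordinate clears that coordinate from all
  sufficiently late terms, with multipliers of absolute value below 1.\<close>

lemma small_combination_of_previous:
  assumes "finite B"
    and "\<And>k. v k = (\<Sum>b\<in>B. c k b * b)" and "\<And>k b. b \<in> B \<Longrightarrow> c k b \<in> Qp"
    and "\<And>b. b \<in> B \<Longrightarrow> (\<lambda>k. \<nu> (c k b)) \<longlonglongrightarrow> 0"
  shows "\<exists>d z. (\<forall>i<d. z i \<in> Qp \<and> \<nu> (z i) \<le> 1 / p) \<and> v d = (\<Sum>i<d. z i * v i)"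
  using assms
proof (induction arbitrary: v c)
  case empty
  then show ?case by (intro exI[of _ 0]) auto
next
  case (insert b\<^sub>0 B)
  show ?case
  proof (cases "\<forall>k. c k b\<^sub>0 = 0")
    case True
    then show ?thesis
      using insert.hyps insert.prems by (intro insert.IH[of v c]) auto
  next
    case False
    then obtain l where l: "c l b\<^sub>0 \<noteq> 0" by blast
    then have "\<nu> (c l b\<^sub>0) > 0" using nonneg[of "c l b\<^sub>0"] eq_0_iff[of "c l b\<^sub>0"] by simp
    then have "\<forall>\<^sub>F k in sequentially. \<nu> (c k b\<^sub>0) < \<nu> (c l b\<^sub>0)"
      using order_tendstoD(2)[OF insert.prems(3)[of b\<^sub>0]] by simp
    then obtain m\<^sub>0 where m\<^sub>0: "\<And>k. k \<ge> m\<^sub>0 \<Longrightarrow> \<nu> (c k b\<^sub>0) < \<nu> (c l b\<^sub>0)"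
      unfolding eventually_sequentially by blast
    \<comment> \<open>Beyond \<open>m\<^sub>0\<close> the multipliers have value below 1; the bound
      \<open>Suc l\<close> ensures that the pivot \<open>v l\<close> precedes all terms it is
      subtracted from.\<close>
    define m where "m = max m\<^sub>0 (Suc l)"
    define \<tau> where "\<tau> k = c (m + k) b\<^sub>0 / c l b\<^sub>0" for k
    have \<tau>_Qp: "\<tau> k \<in> Qp" for k
      using insert.prems(2) by (simp add: \<tau>_def divide_inverse Qp_mult Qp_inverse)
    have "\<nu> (\<tau> k) < 1" for k
      using m\<^sub>0[of "m + k"] \<open>\<nu> (c l b\<^sub>0) > 0\<close> by (simp add: \<tau>_def nu_divide m_def)
    then have \<tau>_small: "\<nu> (\<tau> k) \<le> 1 / p" for k using nu_Qp_discrete[OF \<tau>_Qp] by blast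
    define w where "w k = v (m + k) - \<tau> k * v l" for k
    have w_sum: "w k = (\<Sum>b\<in>B. (c (m + k) b - \<tau> k * c l b) * b)" for k
      using insert.hyps l
      by (simp add: w_def insert.prems(1) algebra_simps sum_subtractf sum_distrib_left)
        (simp add: \<tau>_def add.commute)
    have w_lim: "(\<lambda>k. \<nu> (c (m + k) b - \<tau> k * c l b)) \<longlonglongrightarrow> 0" if b: "b \<in> B" for b
    proof (rule tendsto_sandwich[of "\<lambda>_. 0"])
      have "(\<lambda>k. \<nu> (c (m + k) b)) \<longlonglongrightarrow> 0" "(\<lambda>k. \<nu> (c (m + k) b\<^sub>0)) \<longlonglongrightarrow> 0"
        using LIMSEQ_ignore_initial_segment[OF insert.prems(3)[of b], of m]
          LIMSEQ_ignore_initial_segment[OF insert.prems(3)[of b\<^sub>0], of m] b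
        by (simp_all add: add.commute)
      then have "(\<lambda>k. \<nu> (c (m + k) b) + \<nu> (c (m + k) b\<^sub>0) * (\<nu> (c l b) / \<nu> (c l b\<^sub>0)))
          \<longlonglongrightarrow> 0 + 0 * (\<nu> (c l b) / \<nu> (c l b\<^sub>0))"
        by (intro tendsto_intros)
      then show "(\<lambda>k. \<nu> (c (m + k) b) + \<nu> (c (m + k) b\<^sub>0) * (\<nu> (c l b) / \<nu> (c l b\<^sub>0))) \<longlonglongrightarrow> 0"
        by simp
      show "\<forall>\<^sub>F k in sequentially. \<nu> (c (m + k) b - \<tau> k * c l b)
          \<le> \<nu> (c (m + k) b) + \<nu> (c (m + k) b\<^sub>0) * (\<nu> (c l b) / \<nu> (c l b\<^sub>0))"
      proof (rule always_eventually, rule allI)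
        fix k
        show "\<nu> (c (m + k) b - \<tau> k * c l b)
            \<le> \<nu> (c (m + k) b) + \<nu> (c (m + k) b\<^sub>0) * (\<nu> (c l b) / \<nu> (c l b\<^sub>0))"
          using nu_add_le[of "c (m + k) b" "- (\<tau> k * c l b)"]
          by (simp add: \<tau>_def mult nu_divide)
      qed
    qed (auto simp: nonneg)
    have "\<exists>d z. (\<forall>i<d. z i \<in> Qp \<and> \<nu> (z i) \<le> 1 / p) \<and> w d = (\<Sum>i<d. z i * w i)"
      using insert.prems(2) \<tau>_Qp w_lim
      by (intro insert.IH[OF w_sum]) (auto intro!: subring_closed is_subring_Qp)
    then obtain d z where z: "\<And>i. i < d \<Longrightarrow> z i \<in> Qp" "\<And>i. i < d \<Longrightarrow> \<nu> (z i) \<le> 1 / p"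
      and wd: "w d = (\<Sum>i<d. z i * w i)"
      by blast
    \<comment> \<open>Expanding each \<open>w i\<close> turns the relation into one between the
      \<open>v (m + i)\<close> and \<open>v l\<close>. The total coefficient of \<open>v l\<close>
      is \<open>\<mu>\<close>; at all other indices below \<open>m\<close> the combination
      \<open>z'\<close> is 0.\<close>
    define \<mu> where "\<mu> = \<tau> d - (\<Sum>i<d. z i * \<tau> i)"
    define z' where "z' j = (if j = l then \<mu> else if j < m then 0 else z (j - m))" for j
    have lm: "l < m" by (simp add: m_def)
    have p_le: "1 / real p \<le> 1" using p_gt_1 by simp
    have \<mu>_Qp: "\<mu> \<in> Qp"
      unfolding \<mu>_def using z \<tau>_Qp by (auto intro!: subring_closed is_subring_Qp)
    have "\<nu> (\<Sum>i<d. z i * \<tau> i) \<le> 1 / p"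
    proof (rule nu_sum_le)
      fix i assume "i \<in> {..<d}"
      then have "\<nu> (z i) * \<nu> (\<tau> i) \<le> 1 * (1 / p)"
        using z(2)[of i] \<tau>_small[of i] nonneg p_le by (intro mult_mono) auto
      then show "\<nu> (z i * \<tau> i) \<le> 1 / p" by (simp add: mult)
    qed simp
    then have \<mu>_small: "\<nu> \<mu> \<le> 1 / p"
      unfolding \<mu>_def using nu_diff \<tau>_small[of d] by (meson max.boundedI order_trans)
    show ?thesis
    proof (intro exI[of _ "m + d"] exI[of _ z'] conjI allI impI)
      fix i assume i: "i < m + d"
      show "z' i \<in> Qp" using \<mu>_Qp z(1)[of "i - m"] subring_zero[OF is_subring_Qp] i
        by (auto simp: z'_def)
      show "\<nu> (z' i) \<le> 1 / p" using \<mu>_small z(2)[of "i - m"] i by (auto simp: z'_def)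
    next
      have "v (m + d) = \<tau> d * v l + (\<Sum>i<d. z i * w i)"
        by (simp flip: wd) (simp add: w_def)
      also have "\<dots> = \<mu> * v l + (\<Sum>i<d. z i * v (m + i))"
        by (simp add: \<mu>_def w_def algebra_simps sum_subtractf sum_distrib_left)
      also have "\<mu> * v l = (\<Sum>j<m. z' j * v j)"
      proof -
        have "(\<Sum>j<m. z' j * v j) = (\<Sum>j<m. if j = l then \<mu> * v l else 0)"
          by (rule sum.cong) (auto simp: z'_def)
        then show ?thesis using lm by simp
      qed
      also have "(\<Sum>i<d. z i * v (m + i)) = (\<Sum>i<d. z' (m + i) * v (m + i))"
        using lm by (intro sum.cong) (auto simp: z'_def)
      finally show "v (m + d) = (\<Sum>i<m + d. z' i * v i)" by (simp add: sum_lessThan_add)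
    qed
  qed
qed

section \<open>Divisibility between \<open>p\<close> and the powers of \<open>\<pi>\<close>\<close>

text \<open>Since \<open>\<nu> \<pi> < 1\<close>, the powers of \<open>\<pi>\<close> have
  coordinates tending to 0, and elimination yields a monic equation for \<open>\<pi>\<close> whose
  lower coefficients are divisible by \<open>p\<close>, much like an Eisenstein equation. Dividing
  these coefficients by \<open>p\<close> leaves p-adic integers, so the cofactor is visibly a
  polynomial in \<open>\<pi>\<close> over the ground ring.\<close>

lemma uniformizer_power:
  assumes "finite_extension Qp K" "prime_element_of \<nu> K \<pi>"
  shows "\<exists>d. \<exists>w\<in>subring_gen (completed_unramified_integers p \<nu> \<union> {\<pi>}). \<pi> ^ d = of_nat p * w"
proof -
  let ?R = "completed_unramified_integers p \<nu>"
  from assms(1) obtain B where B: "finite B"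
    and span: "K = {\<Sum>b\<in>B. a b * b | a. \<forall>b\<in>B. a b \<in> Qp}" and K: "subfield_of Qp K"
    unfolding finite_extension_def by blast
  have "\<pi> * 1 \<in> (\<lambda>b. \<pi> * b) ` ring_of_integers \<nu> K"
    using K by (intro imageI) (simp add: ring_of_integers_def subfield_of_def)
  then have \<pi>: "\<pi> \<in> K" "\<nu> \<pi> < 1"
    using assms(2) unfolding prime_element_of_def by auto
  have \<pi>_power: "\<pi> ^ k \<in> K" for k
    using \<pi> K by (induction k) (auto simp: subfield_of_def)
  obtain C where C: "C > 0"
    and bounded: "\<And>a. \<forall>b\<in>B. a b \<in> Qp \<Longrightarrow>
      \<exists>a'. (\<forall>b\<in>B. a' b \<in> Qp \<and> \<nu> (a' b) \<le> C * \<nu> (\<Sum>b\<in>B. a b * b)) \<and>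
           (\<Sum>b\<in>B. a' b * b) = (\<Sum>b\<in>B. a b * b)"
    using bounded_coefficients[OF B] by blast
  have "\<exists>a'. (\<forall>b\<in>B. a' b \<in> Qp \<and> \<nu> (a' b) \<le> C * \<nu> \<pi> ^ k) \<and> \<pi> ^ k = (\<Sum>b\<in>B. a' b * b)" for k
  proof -
    obtain a where "\<pi> ^ k = (\<Sum>b\<in>B. a b * b)" "\<forall>b\<in>B. a b \<in> Qp"
      using \<pi>_power[of k] span by auto
    then show ?thesis using bounded[of a] by (metis nu_power)
  qed
  then obtain c where c: "\<And>k b. b \<in> B \<Longrightarrow> c k b \<in> Qp"
    and c_le: "\<And>k b. b \<in> B \<Longrightarrow> \<nu> (c k b) \<le> C * \<nu> \<pi> ^ k"
    and c_sum: "\<And>k. \<pi> ^ k = (\<Sum>b\<in>B. c k b * b)"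
    by metis
  have "(\<lambda>k. \<nu> (c k b)) \<longlonglongrightarrow> 0" if "b \<in> B" for b
  proof (rule tendsto_sandwich[of "\<lambda>_. 0"])
    have "(\<lambda>k. C * \<nu> \<pi> ^ k) \<longlonglongrightarrow> C * 0"
      using \<pi> nonneg by (intro tendsto_intros LIMSEQ_power_zero) auto
    then show "(\<lambda>k. C * \<nu> \<pi> ^ k) \<longlonglongrightarrow> 0" by simp
  qed (use c_le that nonneg in auto)
  then obtain d z where z: "\<And>i. i < d \<Longrightarrow> z i \<in> Qp \<and> \<nu> (z i) \<le> 1 / p"
    and \<pi>d: "\<pi> ^ d = (\<Sum>i<d. z i * \<pi> ^ i)"
    using small_combination_of_previous[OF B, of "\<lambda>k. \<pi> ^ k" c] c c_sum by blast
  have "1 / real p < 1" using p_gt_1 by simp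
  have "\<exists>y. y \<in> ?R \<and> z i = of_nat p * y" if i: "i < d" for i
  proof -
    have "\<nu> (z i) < 1" using z[OF i] \<open>1 / real p < 1\<close> by simp
    then obtain b where "b \<in> Qp" "\<nu> b \<le> 1" "z i = of_nat p * b"
      using Qp_small_eq_p_mult z[OF i] by metis
    then show ?thesis using Zp_subset by blast
  qed
  then obtain y where y: "\<And>i. i < d \<Longrightarrow> y i \<in> ?R" "\<And>i. i < d \<Longrightarrow> z i = of_nat p * y i"
    by metis
  let ?w = "\<Sum>i<d. y i * \<pi> ^ i"
  have "\<pi> ^ d = of_nat p * ?w"
    using y by (simp add: \<pi>d sum_distrib_left mult.assoc)
  moreover have "?w \<in> subring_gen (?R \<union> {\<pi>})"
    using y(1) by (intro subring_sum subring_mult subring_power is_subring_subring_gen)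
      (auto intro: subring_gen.gen)
  ultimately show ?thesis by blast
qed

text \<open>A lift \<open>f\<close> fixes \<open>p\<close>, so \<open>\<pi>\<close> divides \<open>p - p\<^bsup>p^s\<^esup>\<close>, which is \<open>p\<close> times a unit.\<close>

lemma uniformizer_dvd_p:
  assumes s: "s \<ge> 1"
    and S: "S = subring_gen (completed_unramified_integers p \<nu> \<union> {\<pi>})"
    and f: "frobenius_lift_on p s \<pi> S f"
  shows "\<exists>w\<in>S. of_nat p = \<pi> * w"
proof -
  have subring: "is_subring S" unfolding S by (rule is_subring_subring_gen)
  interpret f: subring_hom S f
    using f subring by (auto simp: frobenius_lift_on_def subring_hom_def ring_hom_on_def)
  obtain b where b: "b \<in> S" "f (of_nat p) - of_nat p ^ (p ^ s) = \<pi> * b"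
    using f subring_of_nat[OF subring] unfolding frobenius_lift_on_def by blast
  \<comment> \<open>As \<open>f\<close> fixes \<open>p\<close>, the difference
    \<open>f p - p ^ (p ^ s)\<close> equals \<open>p * m\<close>. Because \<open>s \<ge> 1\<close>,
    the exponent \<open>p ^ s - 1\<close> is positive, so \<open>m\<close> is 1 modulo
    \<open>p\<close> and has an inverse in the ground ring.\<close>
  define m where "m = 1 - int p ^ (p ^ s - 1)"
  have ps: "p ^ s > 1" using one_less_power[of p s] prime_gt_1_nat[OF prime_p] s by simp
  then have "int p dvd int p ^ (p ^ s - 1)" by (intro dvd_power) simp
  then have m: "\<not> int p dvd m"
    using prime_gt_1_nat[OF prime_p] dvd_add[of "int p" m "int p ^ (p ^ s - 1)"]
    by (auto simp: m_def)
  have "f (of_nat p) - of_nat p ^ (p ^ s) = (of_nat p * of_int m :: 'k)"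
    using ps prime_gt_0_nat[OF prime_p]
    by (simp add: f.of_nat m_def algebra_simps power_eq_if[of _ "p ^ s"])
  then have eq: "of_nat p * of_int m = \<pi> * b" using b by simp
  have "m \<noteq> 0" using m by auto
  then have "of_nat p = \<pi> * (b * inverse (of_int m))"
    using eq by (simp add: field_simps)
  moreover have "inverse (of_int m) \<in> S"
    unfolding S using inverse_of_int_in_integers[OF m] by (auto intro: subring_gen.gen)
  then have "b * inverse (of_int m) \<in> S" using b subring_mult[OF subring] by blast
  ultimately show ?thesis by blast
qed

end

section \<open>Binomial coefficients of one half\<close>

lemma gbinomial_minus_half: "(- 1 / 2 :: 'a::field_char_0) gchoose k = (- 1 / 4) ^ k * of_nat ((2 * k) choose k)"
proof (induction k)
  case (Suc k)
  let ?g = "\<lambda>k. (- 1 / 2 :: 'a) gchoose k"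
  let ?b = "\<lambda>k. of_nat ((2 * k) choose k) :: 'a"
  have "of_nat (Suc k) * ?g (Suc k) = (- 1 / 2 - of_nat k) * ?g k"
    by (simp add: gbinomial_absorption gbinomial_absorb_comp del: of_nat_Suc)
  also have "\<dots> = (- 1 / 4) ^ Suc k * (2 * (2 * of_nat k + 1) * ?b k)"
    unfolding Suc.IH by (simp add: field_simps)
  also have "2 * (2 * of_nat k + 1) * ?b k = of_nat (Suc k) * ?b (Suc k)"
  proof -
    have b1: "?b (Suc k) = fact (2 * k + 2) / (fact (Suc k) * fact (Suc k))"
      by (subst binomial_fact) auto
    have b0: "?b k = fact (2 * k) / (fact k * fact k)"
      by (subst binomial_fact) auto
    have double: "fact (2 * k + 2) = (2 * of_nat (Suc k) * (2 * of_nat k + 1) * fact (2 * k) :: 'a)"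
      by (simp add: algebra_simps)
    have "of_nat (Suc k) \<noteq> (0 :: 'a)" by (rule of_nat_neq_0)
    then show ?thesis
      unfolding b1 b0 double fact_Suc by (simp add: divide_simps del: of_nat_Suc)
  qed
  finally have "of_nat (Suc k) * ?g (Suc k) = of_nat (Suc k) * ((- 1 / 4) ^ Suc k * ?b (Suc k))"
    by (simp only: mult.left_commute)
  then show ?case by (metis mult_cancel_left of_nat_neq_0)
qed simp

text \<open>For the exponent -1/2 the coefficients are central binomial coefficients times powers of
  -1/4, so only powers of 2 appear as denominators. Pascal's rule carries this over to the exponent
  1/2.\<close>

lemma gbinomial_half_in_subring:
  assumes S: "is_subring S" and half: "(1 / 2 :: 'a::field_char_0) \<in> S"
  shows "(1 / 2) gchoose k \<in> S"
proof -
  have "(- 1 / 4 :: 'a) = - (1 / 2 * (1 / 2))" by simp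
  moreover have "- (1 / 2 * (1 / 2) :: 'a) \<in> S"
    by (intro subring_uminus subring_mult S half)
  ultimately have quarter: "(- 1 / 4 :: 'a) \<in> S" by simp
  have *: "(- 1 / 2 :: 'a) gchoose m \<in> S" for m
    unfolding gbinomial_minus_half using quarter S by (auto intro!: subring_closed)
  show ?thesis
  proof (cases k)
    case (Suc m)
    have "(1 / 2 :: 'a) gchoose Suc m = ((- 1 / 2) gchoose m) + ((- 1 / 2) gchoose Suc m)"
      using gbinomial_Suc_Suc[of "- 1 / 2 :: 'a" m] by simp
    then show ?thesis using Suc * S subring_add by metis
  qed (use S subring_one in auto)
qed


section \<open>\<open>p\<close>-adically complete rings\<close>

lemma padic_separated:
  fixes a :: "'b::comm_ring_1"
  assumes "padic_complete p TYPE('b)" and "\<And>m. of_nat p ^ m dvd a"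
  shows "a = 0"
proof -
  have "padic_Cauchy p (\<lambda>_. 0 :: 'b)" by (simp add: padic_Cauchy_def)
  then have "\<exists>!a. padic_limit p (\<lambda>_. 0 :: 'b) a"
    using assms(1) by (simp add: padic_complete_def)
  moreover have "padic_limit p (\<lambda>_. 0) a" using assms(2) by (simp add: padic_limit_def)
  moreover have "padic_limit p (\<lambda>_. 0 :: 'b) 0" by (simp add: padic_limit_def)
  ultimately show ?thesis by blast
qed

lemma padic_Cauchy_convergent:
  fixes u :: "nat \<Rightarrow> 'b::comm_ring_1"
  assumes "padic_complete p TYPE('b)" and "\<And>m k. m \<le> k \<Longrightarrow> of_nat p ^ m dvd u k - u m"
  shows "\<exists>a. \<forall>m. of_nat p ^ m dvd u m - a"
proof -
  have step: "of_nat p ^ m dvd u k - u l" if "m \<le> k" "m \<le> l" for m k l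
    using dvd_diff[OF assms(2)[OF that(1)] assms(2)[OF that(2)]] by simp
  then have "padic_Cauchy p u" unfolding padic_Cauchy_def by blast
  then obtain a where a: "padic_limit p u a"
    using assms(1) unfolding padic_complete_def by blast
  have "of_nat p ^ m dvd u m - a" for m
  proof -
    obtain M where M: "\<forall>k\<ge>M. of_nat p ^ m dvd u k - a"
      using a unfolding padic_limit_def by blast
    have "of_nat p ^ m dvd u m - u (max m M)" using step by simp
    from dvd_diff_trans[OF this] show ?thesis using M by simp
  qed
  then show ?thesis by blast
qed

text \<open>The geometric series in \<open>of_nat p * a\<close> converges p-adically to an
  inverse.\<close>

lemma one_minus_p_mult_unit:
  fixes a :: "'b::comm_ring_1"
  assumes "padic_complete p TYPE('b)"
  shows "(1 - of_nat p * a) dvd 1"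
proof -
  let ?t = "of_nat p * a"
  define u where "u m = (\<Sum>k<m. ?t ^ k)" for m
  have geo: "(1 - ?t) * u m = 1 - ?t ^ m" for m
    unfolding u_def by (rule one_diff_power_eq[symmetric])
  have "of_nat p ^ m dvd u k - u m" if "m \<le> k" for m k
  proof -
    have "u k - u m = (\<Sum>i\<in>{..<k} - {..<m}. ?t ^ i)"
      unfolding u_def using that by (subst sum_diff) auto
    moreover have "of_nat p ^ m dvd ?t ^ i" if "i \<in> {..<k} - {..<m}" for i
      using that by (auto simp: power_mult_distrib intro!: dvd_mult2 le_imp_power_dvd)
    ultimately show ?thesis by (simp only: dvd_sum)
  qed
  then obtain b where b: "\<And>m. of_nat p ^ m dvd u m - b"
    using padic_Cauchy_convergent[OF assms, of u] by blast
  have "(1 - ?t) * b - 1 = 0"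
  proof (rule padic_separated[OF assms])
    fix m
    have "of_nat p ^ m dvd (1 - ?t) * (u m - b)" using b by simp
    moreover have "of_nat p ^ m dvd ?t ^ m" by (simp add: power_mult_distrib)
    ultimately have "of_nat p ^ m dvd - ((1 - ?t) * (u m - b) + ?t ^ m)"
      by (simp only: dvd_minus_iff dvd_add)
    moreover have "- ((1 - ?t) * (u m - b) + ?t ^ m) = (1 - ?t) * b - 1"
      using geo[of m] by (simp add: algebra_simps)
    ultimately show "of_nat p ^ m dvd (1 - ?t) * b - 1" by simp
  qed
  then show ?thesis by (intro dvdI[of _ _ b]) simp
qed

lemma subring_hom_p_power_dvd:
  assumes "subring_hom UNIV h" "of_nat p ^ m dvd a"
  shows "of_nat p ^ m dvd h a"
proof -
  interpret subring_hom UNIV h by fact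
  from assms(2) obtain b where "a = of_nat p ^ m * b" ..
  then have "h a = of_nat p ^ m * h b" by (simp add: mult power of_nat)
  then show ?thesis by simp
qed

lemma subring_hom_eq_if_agree_on_dense:
  fixes g h :: "'a::comm_ring_1 \<Rightarrow> 'b::comm_ring_1"
  assumes "padic_complete p TYPE('b)" "subring_hom UNIV g" "subring_hom UNIV h"
    and dense: "\<And>m a. \<exists>d\<in>D. of_nat p ^ m dvd a - d" and eq: "\<And>d. d \<in> D \<Longrightarrow> g d = h d"
  shows "g = h"
proof
  interpret g: subring_hom UNIV g by fact
  interpret h: subring_hom UNIV h by fact
  fix a
  have "g a - h a = 0"
  proof (rule padic_separated[OF assms(1)])
    fix m
    obtain d where d: "d \<in> D" "of_nat p ^ m dvd a - d" using dense by blast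
    have "of_nat p ^ m dvd g (a - d) - h (a - d)"
      using d subring_hom_p_power_dvd assms(2,3) by (intro dvd_diff) blast+
    then show "of_nat p ^ m dvd g a - h a" using eq[OF d(1)] by (simp add: g.diff h.diff)
  qed
  then show "g a = h a" by simp
qed

text \<open>A ring homomorphism given on a dense subring extends by continuity; it is presented by its
  graph \<open>G\<close>, and the divisibility condition makes \<open>G\<close> functional and continuous at once.\<close>

lemma extend_dense_graph:
  fixes G :: "('a::comm_ring_1 \<times> 'b::comm_ring_1) set"
  assumes complete: "padic_complete p TYPE('b)"
    and one: "(1, 1) \<in> G"
    and diff: "\<And>a b a' b'. (a, b) \<in> G \<Longrightarrow> (a', b') \<in> G \<Longrightarrow> (a - a', b - b') \<in> G"
    and mult: "\<And>a b a' b'. (a, b) \<in> G \<Longrightarrow> (a', b') \<in> G \<Longrightarrow> (a * a', b * b') \<in> G"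
    and dense: "\<And>m a. \<exists>d e. (d, e) \<in> G \<and> of_nat p ^ m dvd a - d"
    and cont: "\<And>m a b. (a, b) \<in> G \<Longrightarrow> of_nat p ^ m dvd a \<Longrightarrow> of_nat p ^ m dvd b"
  shows "\<exists>h. subring_hom UNIV h \<and> (\<forall>a b. (a, b) \<in> G \<longrightarrow> h a = b)"
proof -
  \<comment> \<open>The value \<open>t\<close> has to match every approximation of \<open>a\<close>
    by the graph, at every precision. By \<open>cont\<close>, approximations of \<open>a\<close> to
    the same precision have second components agreeing to that precision, so such a \<open>t\<close>
    exists whatever approximating sequence is used to find it.\<close>
  let ?P = "\<lambda>a t. \<forall>m d e. (d, e) \<in> G \<longrightarrow> of_nat p ^ m dvd a - d \<longrightarrow> of_nat p ^ m dvd t - e"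
  have ex: "\<exists>t. ?P a t" for a
  proof -
    obtain D E where D: "\<And>m. (D m, E m) \<in> G" "\<And>m. of_nat p ^ m dvd a - D m"
      using dense[of _ a] by metis
    have "of_nat p ^ m dvd E k - E m" if "m \<le> k" for m k
    proof (rule cont[OF diff[OF D(1) D(1)]])
      have "of_nat p ^ m dvd a - D k"
        using D(2)[of k] that by (meson dvd_trans le_imp_power_dvd)
      then have "of_nat p ^ m dvd (a - D m) - (a - D k)" using D(2)[of m] by (rule dvd_diff[rotated])
      then show "of_nat p ^ m dvd D k - D m" by simp
    qed
    then obtain t where t: "\<And>m. of_nat p ^ m dvd E m - t"
      using padic_Cauchy_convergent[OF complete] by blast
    have "of_nat p ^ m dvd t - e" if "(d, e) \<in> G" "of_nat p ^ m dvd a - d" for m d e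
    proof -
      have "of_nat p ^ m dvd (a - d) - (a - D m)" using that(2) D(2) by (rule dvd_diff)
      then have "of_nat p ^ m dvd D m - d" by simp
      then have "of_nat p ^ m dvd E m - e" using cont[OF diff[OF D(1) that(1)]] by blast
      then have "of_nat p ^ m dvd (E m - e) - (E m - t)" using t by (rule dvd_diff)
      then show ?thesis by simp
    qed
    then show ?thesis by blast
  qed
  then obtain h where h: "\<And>a m d e. (d, e) \<in> G \<Longrightarrow> of_nat p ^ m dvd a - d \<Longrightarrow> of_nat p ^ m dvd h a - e"
    by metis
  \<comment> \<open>Conversely, one approximation at each precision already identifies the value, by
    separatedness. Differences and products are handled by approximating the arguments.\<close>
  have h_eq: "h a = t" if "\<And>m. \<exists>d e. (d, e) \<in> G \<and> of_nat p ^ m dvd a - d \<and> of_nat p ^ m dvd t - e"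
    for a t
  proof -
    have "h a - t = 0"
    proof (rule padic_separated[OF complete])
      fix m
      obtain d e where "(d, e) \<in> G" "of_nat p ^ m dvd a - d" "of_nat p ^ m dvd t - e"
        using \<open>\<And>m. \<exists>d e. _ m d e\<close> by blast
      then have "of_nat p ^ m dvd (h a - e) - (t - e)" by (intro dvd_diff[OF h])
      then show "of_nat p ^ m dvd h a - t" by simp
    qed
    then show ?thesis by simp
  qed
  have graph: "h a = b" if "(a, b) \<in> G" for a b
    by (rule h_eq) (use that in \<open>auto intro!: exI\<close>)
  have minus: "h (a - b) = h a - h b" for a b
  proof (rule h_eq)
    fix m
    obtain d e d' e' where G: "(d, e) \<in> G" "of_nat p ^ m dvd a - d" "(d', e') \<in> G" "of_nat p ^ m dvd b - d'"
      using dense by meson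
    have "of_nat p ^ m dvd (a - d) - (b - d')" "of_nat p ^ m dvd (h a - e) - (h b - e')"
      using G h by (auto intro!: dvd_diff)
    then show "\<exists>d e. (d, e) \<in> G \<and> of_nat p ^ m dvd a - b - d \<and> of_nat p ^ m dvd h a - h b - e"
      using diff[OF G(1,3)] by (intro exI[of _ "d - d'"] exI[of _ "e - e'"]) (auto simp: algebra_simps)
  qed
  have times: "h (a * b) = h a * h b" for a b
  proof (rule h_eq)
    fix m
    obtain d e d' e' where G: "(d, e) \<in> G" "of_nat p ^ m dvd a - d" "(d', e') \<in> G" "of_nat p ^ m dvd b - d'"
      using dense by meson
    have "of_nat p ^ m dvd a * b - d * d'" "of_nat p ^ m dvd h a * h b - e * e'"
      using G h by (auto intro!: dvd_diff_mult)
    then show "\<exists>d e. (d, e) \<in> G \<and> of_nat p ^ m dvd a * b - d \<and> of_nat p ^ m dvd h a * h b - e"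
      using mult[OF G(1,3)] by blast
  qed
  have plus: "h (a + b) = h a + h b" for a b
  proof -
    have "h 0 = 0" using minus[of 0 0] by simp
    then have "h (- b) = - h b" using minus[of 0 b] by simp
    then show ?thesis using minus[of a "- b"] by simp
  qed
  have "subring_hom UNIV h"
    by (simp add: subring_hom_def ring_hom_on_def graph[OF one] plus times)
  then show ?thesis using graph by blast
qed


section \<open>Evaluation of polynomials\<close>

definition monomial_eval :: "(nat \<Rightarrow> 'b::comm_ring_1) \<Rightarrow> (nat \<Rightarrow>\<^sub>0 nat) \<Rightarrow> 'b" where
  "monomial_eval y m = (\<Prod>v\<in>Poly_Mapping.keys m. y v ^ Poly_Mapping.lookup m v)"

text \<open>In use, \<open>g\<close> respects the ring operations only on a subring
  \<open>S\<close>; the evaluation is then a homomorphism on the polynomials with coefficients in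
  \<open>S\<close>.\<close>

definition polys_eval :: "('k::field \<Rightarrow> 'b::comm_ring_1) \<Rightarrow> (nat \<Rightarrow> 'b) \<Rightarrow> 'k polys \<Rightarrow> 'b" where
  "polys_eval g y F = (\<Sum>m\<in>Poly_Mapping.keys F. g (Poly_Mapping.lookup F m) * monomial_eval y m)"

definition polys_over :: "'k::field set \<Rightarrow> 'k polys set" where
  "polys_over S = {F. \<forall>m. Poly_Mapping.lookup F m \<in> S}"

lemma monomial_eval_superset:
  "finite V \<Longrightarrow> Poly_Mapping.keys m \<subseteq> V \<Longrightarrow>
    monomial_eval y m = (\<Prod>v\<in>V. y v ^ Poly_Mapping.lookup m v)"
  unfolding monomial_eval_def by (rule prod.mono_neutral_left) (auto simp: in_keys_iff)

lemma monomial_eval_add: "monomial_eval y (m + n) = monomial_eval y m * monomial_eval y n"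
proof -
  let ?V = "Poly_Mapping.keys m \<union> Poly_Mapping.keys n"
  have "monomial_eval y (m + n) = (\<Prod>v\<in>?V. y v ^ Poly_Mapping.lookup (m + n) v)"
    by (rule monomial_eval_superset) (simp_all add: keys_add)
  also have "\<dots> = (\<Prod>v\<in>?V. y v ^ Poly_Mapping.lookup m v) * (\<Prod>v\<in>?V. y v ^ Poly_Mapping.lookup n v)"
    by (simp add: lookup_add power_add prod.distrib)
  also have "\<dots> = monomial_eval y m * monomial_eval y n"
    by (simp add: monomial_eval_superset[of ?V])
  finally show ?thesis .
qed

lemma monomial_eval_zero [simp]: "monomial_eval y 0 = 1"
  by (simp add: monomial_eval_def)

lemma monomial_eval_single [simp]: "monomial_eval y (Poly_Mapping.single v (Suc 0)) = y v"
  by (simp add: monomial_eval_def)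

lemma sum_singles: "(\<Sum>m\<in>Poly_Mapping.keys F. Poly_Mapping.single m (Poly_Mapping.lookup F m)) = F"
proof (rule poly_mapping_eqI)
  fix k
  have "(\<Sum>m\<in>Poly_Mapping.keys F. Poly_Mapping.lookup (Poly_Mapping.single m (Poly_Mapping.lookup F m)) k)
      = (\<Sum>m\<in>Poly_Mapping.keys F. if m = k then Poly_Mapping.lookup F k else 0)"
    by (rule sum.cong) (auto simp: lookup_single when_def)
  then show "Poly_Mapping.lookup (\<Sum>m\<in>Poly_Mapping.keys F. Poly_Mapping.single m (Poly_Mapping.lookup F m)) k
      = Poly_Mapping.lookup F k"
    by (simp add: lookup_sum in_keys_iff)
qed

lemma is_subring_polys_over:
  assumes S: "is_subring S"
  shows "is_subring (polys_over S)"
  unfolding is_subring_def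
proof (intro conjI ballI)
  show "1 \<in> polys_over S"
    using S by (auto simp: polys_over_def lookup_one when_def intro: subring_closed)
next
  fix F G assume F: "F \<in> polys_over S" and G: "G \<in> polys_over S"
  then show "F - G \<in> polys_over S"
    using S by (auto simp: polys_over_def lookup_minus intro: subring_closed)
  have "(if b then a else 0) \<in> S" if "a \<in> S" for a b
    using that S by (auto intro: subring_closed)
  then show "F * G \<in> polys_over S"
    using F G S
    by (auto simp: polys_over_def lookup_mult Sum_any.expand_set when_def intro!: subring_sum subring_mult)
qed

locale subring_field_hom = subring_hom S h
  for S :: "'k::field set" and h :: "'k \<Rightarrow> 'b::comm_ring_1"
begin

lemma polys_eval_superset:
  assumes "finite V" "Poly_Mapping.keys F \<subseteq> V"
  shows "polys_eval h y F = (\<Sum>m\<in>V. h (Poly_Mapping.lookup F m) * monomial_eval y m)"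
  unfolding polys_eval_def
  by (rule sum.mono_neutral_left) (use assms in \<open>auto simp: in_keys_iff zero\<close>)

lemma polys_eval_single: "polys_eval h y (Poly_Mapping.single m a) = h a * monomial_eval y m"
  by (subst polys_eval_superset[of "{m}"]) (auto simp: zero)

lemma polys_eval_add:
  assumes "F \<in> polys_over S" "G \<in> polys_over S"
  shows "polys_eval h y (F + G) = polys_eval h y F + polys_eval h y G"
proof -
  let ?V = "Poly_Mapping.keys F \<union> Poly_Mapping.keys G"
  have "polys_eval h y (F + G) = (\<Sum>m\<in>?V. h (Poly_Mapping.lookup (F + G) m) * monomial_eval y m)"
    by (rule polys_eval_superset) (simp_all add: keys_add)
  also have "\<dots> = (\<Sum>m\<in>?V. h (Poly_Mapping.lookup F m) * monomial_eval y m) +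
      (\<Sum>m\<in>?V. h (Poly_Mapping.lookup G m) * monomial_eval y m)"
    using assms by (simp add: lookup_add add polys_over_def distrib_right sum.distrib)
  also have "\<dots> = polys_eval h y F + polys_eval h y G"
    by (simp add: polys_eval_superset[of ?V])
  finally show ?thesis .
qed

lemma polys_eval_sum:
  assumes "\<And>i. i \<in> I \<Longrightarrow> F i \<in> polys_over S"
  shows "polys_eval h y (\<Sum>i\<in>I. F i) = (\<Sum>i\<in>I. polys_eval h y (F i))"
  using assms
  by (induction I rule: infinite_finite_induct)
    (simp_all add: polys_eval_add subring_sum is_subring_polys_over subring, simp_all add: polys_eval_def)

lemma single_in_polys_over: "a \<in> S \<Longrightarrow> Poly_Mapping.single m a \<in> polys_over S"
  by (auto simp: polys_over_def lookup_single when_def subring_zero subring)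

lemma polys_eval_mult:
  assumes F: "F \<in> polys_over S" and G: "G \<in> polys_over S"
  shows "polys_eval h y (F * G) = polys_eval h y F * polys_eval h y G"
proof -
  let ?F = "Poly_Mapping.lookup F" and ?G = "Poly_Mapping.lookup G"
  have S: "?F m \<in> S" "?G m \<in> S" for m using F G by (auto simp: polys_over_def)
  have "F * G = (\<Sum>m\<in>Poly_Mapping.keys F. Poly_Mapping.single m (?F m)) *
      (\<Sum>n\<in>Poly_Mapping.keys G. Poly_Mapping.single n (?G n))"
    by (simp only: sum_singles)
  also have "\<dots> = (\<Sum>m\<in>Poly_Mapping.keys F. \<Sum>n\<in>Poly_Mapping.keys G.
      Poly_Mapping.single (m + n) (?F m * ?G n))"
    by (simp only: sum_product mult_single)
  also have "polys_eval h y \<dots> = (\<Sum>m\<in>Poly_Mapping.keys F. \<Sum>n\<in>Poly_Mapping.keys G.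
      h (?F m * ?G n) * monomial_eval y (m + n))"
    using S
    by (simp add: polys_eval_sum polys_eval_single single_in_polys_over subring_mult subring
        subring_sum is_subring_polys_over)
  also have "\<dots> = polys_eval h y F * polys_eval h y G"
    unfolding polys_eval_def sum_product
    by (intro sum.cong refl) (simp add: mult S monomial_eval_add ac_simps)
  finally show ?thesis .
qed

lemma subring_hom_polys_eval: "subring_hom (polys_over S) (polys_eval h y)"
proof -
  have "polys_eval h y 1 = 1"
    using polys_eval_single[of y 0 1] by (simp add: one)
  then show ?thesis
    by (simp add: subring_hom_def is_subring_polys_over subring ring_hom_on_def
        polys_eval_add polys_eval_mult)
qed

end


section \<open>The universal property of the completed coordinate ring\<close>

text \<open>The generic matrix before passage to the fraction field: polynomials can be evaluated at
  any matrix, fractions only when their denominators become units.\<close>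

definition polys_matrix :: "'k::field polys ^ 'n::finite ^ 'n" where
  "polys_matrix = (\<chi> i j. Poly_Mapping.single (Poly_Mapping.single (to_nat (i, j)) 1) 1)"

text \<open>The assignment of values to numbered variables that puts \<open>Y\<close> for the
  generic matrix. Outside the range of \<open>to_nat\<close> the value is arbitrary;
  \<open>polys_matrix\<close> contains no such variable.\<close>

definition matrix_entry :: "'b ^ 'n::finite ^ 'n \<Rightarrow> nat \<Rightarrow> 'b" where
  "matrix_entry Y v = (case from_nat v of (i, j) \<Rightarrow> Y $ i $ j)"

lemma matrix_entry_to_nat [simp]: "matrix_entry Y (to_nat (i, j)) = Y $ i $ j"
  by (simp add: matrix_entry_def)

lemma subring_hom_Fract: "subring_hom UNIV (\<lambda>F::'a::idom. Fract F 1)"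
  by (simp add: subring_hom_def ring_hom_on_def One_fract_def)

lemma indeterminates_eq: "indeterminates = map_matrix (\<lambda>F. Fract F 1) polys_matrix"
  by (simp add: indeterminates_def polys_matrix_def vec_eq_iff)

lemma det_indeterminates:
  "det (indeterminates :: 'k::field polys fract ^ 'n::finite ^ 'n) = 
    Fract (det (polys_matrix :: 'k polys ^ 'n ^ 'n)) 1"
  unfolding indeterminates_eq by (simp add: subring_hom.det[OF subring_hom_Fract])

context subring_field_hom
begin

lemma polys_eval_polys_matrix:
  "map_matrix (polys_eval h (matrix_entry Y)) (polys_matrix :: 'k polys ^ 'n::finite ^ 'n) = Y"
  by (simp add: vec_eq_iff polys_matrix_def polys_eval_single one)

lemma polys_matrix_over: "(polys_matrix :: 'k polys ^ 'n::finite ^ 'n) $ i $ j \<in> polys_over S"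
  by (simp add: polys_matrix_def single_in_polys_over subring_one subring)

lemma det_polys_matrix_over: "det (polys_matrix :: 'k polys ^ 'n::finite ^ 'n) \<in> polys_over S"
  by (intro subring_det is_subring_polys_over subring polys_matrix_over)

lemma polys_eval_det:
  fixes Y :: "'b ^ 'n::finite ^ 'n"
  shows "polys_eval h (matrix_entry Y) (det (polys_matrix :: 'k polys ^ 'n ^ 'n)) = det Y"
  by (simp add: subring_hom.det[OF subring_hom_polys_eval] polys_matrix_over polys_eval_polys_matrix)

end

text \<open>Specializing the generic matrix to the identity would turn a vanishing determinant into
  1 = 0.\<close>

lemma det_indeterminates_nonzero:
  "det (indeterminates :: 'k::field polys fract ^ 'n::finite ^ 'n) \<noteq> 0"
proof
  interpret subring_field_hom UNIV "\<lambda>a::'k. a"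
    by (simp add: subring_field_hom_def subring_hom_def ring_hom_on_def)
  assume "det (indeterminates :: 'k polys fract ^ 'n ^ 'n) = 0"
  then have "det (polys_matrix :: 'k polys ^ 'n ^ 'n) = 0"
    unfolding det_indeterminates by (simp add: Zero_fract_def eq_fract)
  then have "det (mat 1 :: 'k ^ 'n ^ 'n) = 0"
    using polys_eval_det[of "mat 1 :: 'k ^ 'n ^ 'n"] by (simp add: polys_eval_def)
  then show False by simp
qed

locale completed_GL =
  fixes p :: nat and S :: "'k::field set" and j :: "'k polys fract \<Rightarrow> 'b::comm_ring_1"
    and x :: "'b ^ 'n::finite ^ 'n" and c :: "'k \<Rightarrow> 'b"
    and X :: "'k polys fract ^ 'n ^ 'n" and coordinate_ring :: "'k polys fract set"
  assumes subring_S: "is_subring S"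
    and X_eq: "X = indeterminates" and coordinate_ring_def: "coordinate_ring = GL_coordinate_ring TYPE('n) S"
    and completion: "padic_completion p coordinate_ring j"
    and x_eq: "x = map_matrix j X" and c_eq: "c = (\<lambda>r. j (scalar r))"
begin

abbreviation generators :: "'k polys fract set" where
  "generators \<equiv> scalar ` S \<union> {X $ i $ j | i j. True} \<union> {inverse (det X)}"

lemma coordinate_ring_eq: "coordinate_ring = subring_gen generators"
  by (simp add: coordinate_ring_def GL_coordinate_ring_def Let_def X_eq)

lemma det_X: "det X = Fract (det (polys_matrix :: 'k polys ^ 'n ^ 'n)) 1"
  unfolding X_eq by (rule det_indeterminates)

lemma det_X_nonzero: "det X \<noteq> 0"
  unfolding X_eq by (rule det_indeterminates_nonzero)

lemma is_subring_coordinate_ring: "is_subring coordinate_ring"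
  unfolding coordinate_ring_eq by (rule is_subring_subring_gen)

lemma complete: "padic_complete p TYPE('b)"
  using completion by (simp add: padic_completion_def)

lemma subring_hom_j: "subring_hom coordinate_ring j"
  using completion by (simp add: padic_completion_def subring_hom_def is_subring_coordinate_ring)

lemma dense_j: "\<exists>b\<in>j ` coordinate_ring. of_nat p ^ m dvd a - b"
  using completion by (simp add: padic_completion_def)

lemma scalar_in: "r \<in> S \<Longrightarrow> scalar r \<in> coordinate_ring"
  unfolding coordinate_ring_eq by (rule subring_gen.gen) blast

lemma X_in: "X $ i $ l \<in> coordinate_ring"
  unfolding coordinate_ring_eq by (rule subring_gen.gen) blast

lemma inverse_det_in: "inverse (det X) \<in> coordinate_ring"
  unfolding coordinate_ring_eq by (rule subring_gen.gen) blast

lemma subring_hom_c: "subring_hom S c"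
proof -
  have "subring_hom S scalar"
    by (simp add: subring_hom_def subring_S ring_hom_on_def scalar_def mult_single single_add
        One_fract_def)
  then have "ring_hom_on S coordinate_ring scalar"
    using scalar_in by (auto simp: subring_hom_def ring_hom_on_def)
  then have "ring_hom_on S UNIV (\<lambda>r. j (scalar r))"
    by (rule ring_hom_on_comp) (use subring_hom_j in \<open>simp add: subring_hom_def\<close>)
  then show ?thesis by (simp add: subring_hom_def subring_S c_eq)
qed

text \<open>Only the determinant has been inverted, so a power of it clears all denominators; two
  elements are brought to the common exponent \<open>k + k'\<close>. This reduces evaluation on the
  coordinate ring to evaluation of polynomials.\<close>

lemma coordinate_fraction:
  assumes "a \<in> coordinate_ring"
  shows "\<exists>k. \<exists>F\<in>polys_over S. det X ^ k * a = Fract F 1"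
proof -
  interpret subring_field_hom S c
    unfolding subring_field_hom_def by (rule subring_hom_c)
  interpret Fract: subring_hom UNIV "\<lambda>F::'k polys. Fract F 1" by (rule subring_hom_Fract)
  note poly_subring = is_subring_polys_over[OF subring_S]
  have "det X ^ (k + k') * (a - b) = Fract (D ^ k' * F - D ^ k * F') 1 \<and>
      det X ^ (k + k') * (a * b) = Fract (F * F') 1"
    if "det X ^ k * a = Fract F 1" "det X ^ k' * b = Fract F' 1" "det X = Fract D 1" for k k' a b F F' D
  proof
    have "Fract (D ^ k' * F - D ^ k * F') 1 = det X ^ k' * (det X ^ k * a) - det X ^ k * (det X ^ k' * b)"
      by (simp only: Fract.diff Fract.mult Fract.power UNIV_I flip: that)
    then show "det X ^ (k + k') * (a - b) = Fract (D ^ k' * F - D ^ k * F') 1"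
      by (simp add: power_add algebra_simps)
    have "Fract (F * F') 1 = (det X ^ k * a) * (det X ^ k' * b)"
      by (simp only: Fract.mult UNIV_I flip: that)
    then show "det X ^ (k + k') * (a * b) = Fract (F * F') 1"
      by (simp add: power_add algebra_simps)
  qed
  note closed = this[OF _ _ det_X]
  note poly_closed = subring_closed[OF poly_subring] det_polys_matrix_over
  from assms show ?thesis unfolding coordinate_ring_eq
  proof induction
    case (gen a)
    then consider r where "r \<in> S" "a = scalar r" | i j where "a = X $ i $ j" | "a = inverse (det X)"
      by blast
    then show ?case
    proof cases
      case 1
      then show ?thesis
        by (intro exI[of _ 0] bexI[of _ "Poly_Mapping.single 0 r"])
          (auto simp: scalar_def single_in_polys_over)
    next
      case 2
      then show ?thesis
        by (intro exI[of _ 0] bexI[of _ "polys_matrix $ i $ j"])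
          (auto simp: X_eq indeterminates_eq polys_matrix_over)
    next
      case 3
      then show ?thesis
        by (intro exI[of _ 1] bexI[of _ 1])
          (auto simp: det_X_nonzero One_fract_def[symmetric] subring_one[OF poly_subring])
    qed
  next
    case one
    show ?case by (intro exI[of _ 0] bexI[of _ 1]) (auto simp: One_fract_def intro: poly_closed)
  next
    case (diff a b)
    then obtain k F k' F' where F: "F \<in> polys_over S" "F' \<in> polys_over S"
      "det X ^ k * a = Fract F 1" "det X ^ k' * b = Fract F' 1" by blast
    show ?case
      by (rule exI[of _ "k + k'"], rule bexI, rule conjunct1[OF closed[OF F(3,4)]])
        (intro poly_closed F)
  next
    case (mult a b)
    then obtain k F k' F' where F: "F \<in> polys_over S" "F' \<in> polys_over S"
      "det X ^ k * a = Fract F 1" "det X ^ k' * b = Fract F' 1" by blast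
    show ?case
      by (rule exI[of _ "k + k'"], rule bexI, rule conjunct2[OF closed[OF F(3,4)]])
        (intro poly_closed F)
  qed
qed

text \<open>An element \<open>F / det X ^ k\<close> must go to the value of \<open>F\<close> at
  \<open>Y\<close> divided by \<open>det Y ^ k\<close>, which makes sense because
  \<open>det Y\<close> is a unit. This defines a homomorphism on the uncompleted ring, and
  completeness of the target extends it.\<close>

lemma hom_exists:
  fixes g :: "'k \<Rightarrow> 't::comm_ring_1" and Y :: "'t ^ 'n ^ 'n"
  assumes complete_t: "padic_complete p TYPE('t)" and g: "subring_hom S g" and unit: "det Y dvd 1"
  shows "\<exists>h. subring_hom UNIV h \<and> (\<forall>r\<in>S. h (c r) = g r) \<and> map_matrix h x = Y"
proof -
  interpret g: subring_field_hom S g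
    using g by (simp add: subring_field_hom_def)
  let ?ev = "polys_eval g (matrix_entry Y)"
  interpret ev: subring_hom "polys_over S" ?ev by (rule g.subring_hom_polys_eval)
  interpret Fract: subring_hom UNIV "\<lambda>F::'k polys. Fract F 1" by (rule subring_hom_Fract)
  interpret j: subring_hom coordinate_ring j by (rule subring_hom_j)
  note poly_subring = is_subring_polys_over[OF subring_S]
  define D where "D = det (polys_matrix :: 'k polys ^ 'n ^ 'n)"
  have dX: "det X = Fract D 1" unfolding D_def by (rule det_X)
  have D: "D \<in> polys_over S" unfolding D_def by (rule g.det_polys_matrix_over)
  have ev_D: "?ev D = det Y" unfolding D_def by (rule g.polys_eval_det)
  note poly_closed = subring_closed[OF poly_subring] D
  obtain u where u: "1 = det Y * u" using unit by blast
  have uk: "det Y ^ k * u ^ k = 1" for k by (simp add: u[symmetric] flip: power_mult_distrib)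
  \<comment> \<open>The relation says that \<open>t\<close> is a value of \<open>a\<close> at
    \<open>Y\<close>. Stating it with cleared denominators avoids naming an inverse of
    \<open>det Y\<close> and keeps the choice of \<open>k\<close> and \<open>F\<close> open.\<close>
  define H where "H a t \<longleftrightarrow> (\<exists>k. \<exists>F\<in>polys_over S. det X ^ k * a = Fract F 1 \<and> t * det Y ^ k = ?ev F)"
    for a t
  have H_ex: "\<exists>t. H a t" if a: "a \<in> coordinate_ring" for a
  proof -
    obtain k F where "F \<in> polys_over S" "det X ^ k * a = Fract F 1"
      using coordinate_fraction[OF a] by blast
    moreover have "(?ev F * u ^ k) * det Y ^ k = ?ev F * (det Y ^ k * u ^ k)" by (simp only: ac_simps)
    then have "(?ev F * u ^ k) * det Y ^ k = ?ev F" by (simp add: uk)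
    ultimately show ?thesis unfolding H_def by blast
  qed
  have H_fun: "t = t'" if "H a t" "H a t'" for a t t'
  proof -
    obtain k F k' F' where F: "F \<in> polys_over S" "det X ^ k * a = Fract F 1" "t * det Y ^ k = ?ev F"
      and F': "F' \<in> polys_over S" "det X ^ k' * a = Fract F' 1" "t' * det Y ^ k' = ?ev F'"
      using \<open>H a t\<close> \<open>H a t'\<close> unfolding H_def by blast
    \<comment> \<open>Two fractions for \<open>a\<close> are cross-multiplied; polynomials embed
      into their fraction field, so this is an identity of polynomials, which can be evaluated at
      \<open>Y\<close>. Cancelling powers of the unit \<open>det Y\<close> shows that the two values
      agree.\<close>
    have "Fract (D ^ k' * F) 1 = det X ^ k' * (det X ^ k * a)"
      by (simp only: Fract.mult Fract.power UNIV_I flip: F(2) dX)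
    also have "\<dots> = det X ^ k * (det X ^ k' * a)" by (simp only: mult.left_commute)
    also have "\<dots> = Fract (D ^ k * F') 1"
      by (simp only: Fract.mult Fract.power UNIV_I flip: F'(2) dX)
    finally have "D ^ k' * F = D ^ k * F'" by (simp add: eq_fract)
    then have "det Y ^ k' * ?ev F = det Y ^ k * ?ev F'"
      using F(1) F'(1) by (metis D ev.mult ev.power ev_D subring_power[OF poly_subring])
    then have "t * (det Y ^ k * det Y ^ k') = t' * (det Y ^ k * det Y ^ k')"
      by (simp add: F(3)[symmetric] F'(3)[symmetric] ac_simps)
    then have "t * (det Y ^ k * det Y ^ k') * u ^ (k + k') = t' * (det Y ^ k * det Y ^ k') * u ^ (k + k')"
      by simp
    then show ?thesis by (simp add: mult.assoc uk flip: power_add)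
  qed
  have H_poly: "H (Fract F 1) (?ev F)" if "F \<in> polys_over S" for F
    unfolding H_def using that by (intro exI[of _ 0]) auto
  have H_one: "H 1 1" using H_poly[of 1] by (simp add: ev.one One_fract_def poly_closed)
  have H_ops: "H (a - b) (t - t') \<and> H (a * b) (t * t')" if "H a t" "H b t'" for a b t t'
  proof -
    obtain k F k' F' where F: "F \<in> polys_over S" "det X ^ k * a = Fract F 1" "t * det Y ^ k = ?ev F"
      and F': "F' \<in> polys_over S" "det X ^ k' * b = Fract F' 1" "t' * det Y ^ k' = ?ev F'"
      using \<open>H a t\<close> \<open>H b t'\<close> unfolding H_def by blast
    have "Fract (D ^ k' * F - D ^ k * F') 1 = det X ^ k' * (det X ^ k * a) - det X ^ k * (det X ^ k' * b)"
      by (simp only: Fract.diff Fract.mult Fract.power UNIV_I flip: F(2) F'(2) dX)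
    then have 1: "det X ^ (k + k') * (a - b) = Fract (D ^ k' * F - D ^ k * F') 1"
      by (simp add: power_add algebra_simps)
    have in1: "D ^ k' * F \<in> polys_over S" "D ^ k * F' \<in> polys_over S" by (intro poly_closed F(1) F'(1))+
    have "?ev (D ^ k' * F - D ^ k * F') = det Y ^ k' * ?ev F - det Y ^ k * ?ev F'"
      using F(1) F'(1) in1 D by (simp add: ev.diff ev.mult ev.power ev_D subring_power[OF poly_subring])
    then have 2: "(t - t') * det Y ^ (k + k') = ?ev (D ^ k' * F - D ^ k * F')"
      by (simp add: F(3)[symmetric] F'(3)[symmetric] power_add algebra_simps)
    have "Fract (F * F') 1 = (det X ^ k * a) * (det X ^ k' * b)"
      by (simp only: Fract.mult UNIV_I flip: F(2) F'(2))
    then have 3: "det X ^ (k + k') * (a * b) = Fract (F * F') 1"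
      by (simp add: power_add algebra_simps)
    have 4: "(t * t') * det Y ^ (k + k') = ?ev (F * F')"
      using F(1) F'(1) by (simp add: ev.mult F(3)[symmetric] F'(3)[symmetric] power_add algebra_simps)
    have "H (a - b) (t - t')"
      unfolding H_def using 1 2 subring_diff[OF poly_subring in1] by blast
    moreover have "H (a * b) (t * t')"
      unfolding H_def using 3 4 subring_mult[OF poly_subring F(1) F'(1)] by blast
    ultimately show ?thesis ..
  qed
  define G where "G = {(j a, t) | a t. a \<in> coordinate_ring \<and> H a t}"
  have "\<exists>h. subring_hom UNIV h \<and> (\<forall>a b. (a, b) \<in> G \<longrightarrow> h a = b)"
  proof (rule extend_dense_graph[OF complete_t])
    show "(1, 1) \<in> G"
      unfolding G_def using H_one j.one subring_one[OF is_subring_coordinate_ring] by force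
  next
    fix a b a' b' assume "(a, b) \<in> G" "(a', b') \<in> G"
    then obtain f f' where f: "f \<in> coordinate_ring" "f' \<in> coordinate_ring" "a = j f" "a' = j f'"
      "H f b" "H f' b'" unfolding G_def by blast
    have "a - a' = j (f - f')" "a * a' = j (f * f')"
      using f by (simp_all add: j.diff j.mult)
    moreover have "f - f' \<in> coordinate_ring" "f * f' \<in> coordinate_ring"
      using f by (auto intro: subring_closed is_subring_coordinate_ring)
    ultimately show "(a - a', b - b') \<in> G" "(a * a', b * b') \<in> G"
      unfolding G_def using H_ops[OF f(5,6)] by blast+
  next
    fix m a
    obtain f where "f \<in> coordinate_ring" "of_nat p ^ m dvd a - j f" using dense_j[of m a] by blast
    then show "\<exists>d e. (d, e) \<in> G \<and> of_nat p ^ m dvd a - d" unfolding G_def using H_ex by blast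
  next
    fix m a b assume "(a, b) \<in> G" and dvd: "of_nat p ^ m dvd a"
    then obtain f where f: "f \<in> coordinate_ring" "a = j f" "H f b" unfolding G_def by blast
    \<comment> \<open>Here the completion property enters: divisibility of \<open>j f\<close> by a
      power of \<open>p\<close> in the completion already holds for \<open>f\<close> in the
      coordinate ring, and evaluation preserves it. With \<open>m = 0\<close> removed from
      consideration nothing else is required; for \<open>a = 0\<close> all powers divide, which
      makes the graph functional.\<close>
    obtain f' where f': "f' \<in> coordinate_ring" "f = of_nat p ^ m * f'"
      using dvd f completion unfolding padic_completion_def by blast
    obtain t where t: "H f' t" using H_ex[OF f'(1)] by blast
    have "H (Fract (of_nat p ^ m) 1) (?ev (of_nat p ^ m))" by (intro H_poly poly_closed)
    then have "H (of_nat p ^ m) (of_nat p ^ m)"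
      by (simp add: Fract.power Fract.of_nat ev.power ev.of_nat subring_of_nat[OF poly_subring])
    from H_ops[OF this t] have "H f (of_nat p ^ m * t)" using f' by simp
    then show "of_nat p ^ m dvd b" using H_fun[OF f(3)] by auto
  qed
  then obtain h where h: "subring_hom UNIV h" and hG: "\<And>a b. (a, b) \<in> G \<Longrightarrow> h a = b" by blast
  have "h (c r) = g r" if "r \<in> S" for r
  proof (rule hG)
    have "H (scalar r) (?ev (Poly_Mapping.single 0 r))"
      unfolding scalar_def using that by (intro H_poly g.single_in_polys_over)
    then have "H (scalar r) (g r)" by (simp add: g.polys_eval_single)
    then show "(c r, g r) \<in> G" unfolding G_def c_eq using scalar_in[OF that] by blast
  qed
  moreover have "h (x $ i $ k) = Y $ i $ k" for i k
  proof (rule hG)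
    have "H (X $ i $ k) (?ev (polys_matrix $ i $ k))"
      unfolding X_eq indeterminates_eq nth_map_matrix by (intro H_poly g.polys_matrix_over)
    moreover have "?ev (polys_matrix $ i $ k) = Y $ i $ k"
      using g.polys_eval_polys_matrix[of Y] by (metis nth_map_matrix)
    ultimately show "(x $ i $ k, Y $ i $ k) \<in> G" unfolding G_def x_eq using X_in by auto
  qed
  ultimately show ?thesis using h by (intro exI[of _ h]) (auto simp: vec_eq_iff)
qed

text \<open>Cramer's rule in the fraction field exhibits the entries of the inverse as determinants
  over the coordinate ring times \<open>inverse (det X)\<close>, so they stay in that ring.\<close>

lemma X_inverse:
  "\<exists>X'. (\<forall>i l. X' $ i $ l \<in> coordinate_ring) \<and> X ** X' = mat 1 \<and> X' ** X = mat 1"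
proof -
  define col where "col l = (\<chi> k. det (\<chi> i j. if j = k then axis l 1 $ i else X $ i $ j) / det X)" for l
  define X' where "X' = (\<chi> k l. col l $ k)"
  have col: "X *v col l = axis l 1" for l
    using cramer[OF det_X_nonzero] unfolding col_def by blast
  have "(X ** X') $ i $ l = (X *v col l) $ i" for i l
    by (simp add: matrix_matrix_mult_def matrix_vector_mult_def X'_def)
  then have right: "X ** X' = mat 1" by (simp add: col vec_eq_iff mat_def axis_def)
  have "X' $ k $ l \<in> coordinate_ring" for k l
  proof -
    have "det (\<chi> i j. if j = k then axis l 1 $ i else X $ i $ j) \<in> coordinate_ring"
      by (intro subring_det is_subring_coordinate_ring)
        (auto simp: axis_def X_in subring_zero subring_one is_subring_coordinate_ring)
    then show ?thesis
      using inverse_det_in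
      by (simp add: X'_def col_def divide_inverse subring_mult[OF is_subring_coordinate_ring])
  qed
  then show ?thesis using right matrix_left_right_inverse by blast
qed

lemma x_inverse: "\<exists>x'. x ** x' = mat 1 \<and> x' ** x = mat 1"
proof -
  interpret j: subring_hom coordinate_ring j by (rule subring_hom_j)
  obtain X' where X': "\<And>i l. X' $ i $ l \<in> coordinate_ring" "X ** X' = mat 1" "X' ** X = mat 1"
    using X_inverse by blast
  have "x ** map_matrix j X' = mat 1" "map_matrix j X' ** x = mat 1"
    unfolding x_eq using X' X_in by (simp_all flip: j.matrix_mult add: j.mat_1)
  then show ?thesis by blast
qed

text \<open>A matrix with unit determinant is the image of the generic matrix \<open>x\<close> under
  a homomorphism, so an inverse of \<open>x\<close> is carried to an inverse of it.\<close>

lemma matrix_inverse_exists: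
  fixes g :: "'k \<Rightarrow> 't::comm_ring_1" and Y :: "'t ^ 'n ^ 'n"
  assumes "padic_complete p TYPE('t)" "subring_hom S g" "det Y dvd 1"
  shows "\<exists>Y'. Y ** Y' = mat 1 \<and> Y' ** Y = mat 1"
proof -
  obtain h where h: "subring_hom UNIV h" "map_matrix h x = Y"
    using hom_exists[OF assms] by blast
  interpret subring_hom UNIV h by fact
  obtain x' where "x ** x' = mat 1" "x' ** x = mat 1" using x_inverse by blast
  then have "Y ** map_matrix h x' = mat 1" "map_matrix h x' ** Y = mat 1"
    by (simp_all add: mat_1 flip: h(2) matrix_mult)
  then show ?thesis by blast
qed

lemma j_det_unit: "j (inverse (det X)) * det x = 1"
proof -
  interpret j: subring_hom coordinate_ring j by (rule subring_hom_j)
  have "det x = j (det X)" unfolding x_eq by (rule j.det[symmetric]) (rule X_in)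
  then have "j (inverse (det X)) * det x = j (inverse (det X) * det X)"
    by (simp add: j.mult inverse_det_in subring_det is_subring_coordinate_ring X_in)
  then show ?thesis by (simp add: det_X_nonzero j.one)
qed

lemma hom_unique:
  fixes g h :: "'b \<Rightarrow> 't::comm_ring_1"
  assumes "padic_complete p TYPE('t)" and g: "subring_hom UNIV g" and h: "subring_hom UNIV h"
    and c: "\<And>r. r \<in> S \<Longrightarrow> g (c r) = h (c r)" and x: "map_matrix g x = map_matrix h x"
  shows "g = h"
proof (rule subring_hom_eq_if_agree_on_dense[OF assms(1) g h dense_j])
  interpret j: subring_hom coordinate_ring j by (rule subring_hom_j)
  interpret g: subring_hom UNIV g by fact
  interpret h: subring_hom UNIV h by fact
  have gj: "subring_hom (subring_gen generators) (\<lambda>a. k (j a))" if "subring_hom UNIV k" for k :: "'b \<Rightarrow> 't"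
    using that j.subring_hom_axioms ring_hom_on_comp[of _ UNIV j UNIV k]
    unfolding coordinate_ring_eq subring_hom_def by blast
  have x_eq': "g (x $ i $ k) = h (x $ i $ k)" for i k
    using x by (metis nth_map_matrix)
  have det: "g (det x) = h (det x)" by (simp add: g.det h.det x)
  \<comment> \<open>Inverses are unique, so the value at the inverse determinant is forced by the
    entries of \<open>x\<close>.\<close>
  have inv: "g (j (inverse (det X))) = h (j (inverse (det X)))"
  proof -
    let ?d = "j (inverse (det X))"
    have "g ?d * g (det x) = 1" "h ?d * h (det x) = 1"
      using j_det_unit by (simp_all add: g.one h.one flip: g.mult h.mult)
    then have "g ?d = g ?d * (h ?d * g (det x))" by (simp add: det)
    also have "\<dots> = (g ?d * g (det x)) * h ?d" by (simp only: ac_simps)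
    finally show ?thesis using \<open>g ?d * g (det x) = 1\<close> by simp
  qed
  fix b assume "b \<in> j ` coordinate_ring"
  then obtain a where a: "a \<in> subring_gen generators" "b = j a" unfolding coordinate_ring_eq by blast
  have "g (j a) = h (j a)"
  proof (rule subring_hom_agree_on_gen[OF gj[OF g] gj[OF h] _ a(1)])
    fix a assume "a \<in> generators"
    then show "g (j a) = h (j a)" using c x_eq' inv by (auto simp: c_eq x_eq)
  qed
  then show "g b = h b" using a by simp
qed

end


section \<open>Homomorphisms out of the completed tensor square\<close>

lemma subring_hom_UNIV_iff: "subring_hom UNIV h \<longleftrightarrow> ring_hom_on UNIV UNIV h"
  by (simp add: subring_hom_def)

lemma tensor_eval_superset:
  assumes "finite V" "Poly_Mapping.keys u \<subseteq> V"
  shows "tensor_eval \<alpha> \<beta> u =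
    (\<Sum>z\<in>V. of_int (Poly_Mapping.lookup u z) * (\<alpha> (fst z) * \<beta> (snd z)))"
  unfolding tensor_eval_def
  by (rule sum.mono_neutral_left) (use assms in \<open>auto simp: in_keys_iff\<close>)

lemma tensor_eval_frag_of: "tensor_eval \<alpha> \<beta> (frag_of (a, b)) = \<alpha> a * \<beta> b"
  by (simp add: tensor_eval_def keys_frag_of)

lemma tensor_eval_zero: "tensor_eval \<alpha> \<beta> 0 = 0"
  by (simp add: tensor_eval_def)

lemma tensor_eval_diff: "tensor_eval \<alpha> \<beta> (u - v) = tensor_eval \<alpha> \<beta> u - tensor_eval \<alpha> \<beta> v"
proof -
  let ?V = "Poly_Mapping.keys u \<union> Poly_Mapping.keys v"
  have "tensor_eval \<alpha> \<beta> (u - v) =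
      (\<Sum>z\<in>?V. of_int (Poly_Mapping.lookup (u - v) z) * (\<alpha> (fst z) * \<beta> (snd z)))"
    by (rule tensor_eval_superset) (simp_all add: keys_diff)
  also have "\<dots> = tensor_eval \<alpha> \<beta> u - tensor_eval \<alpha> \<beta> v"
    by (simp add: tensor_eval_superset[of ?V] lookup_minus left_diff_distrib sum_subtractf)
  finally show ?thesis .
qed

lemma tensor_eval_cmul: "tensor_eval \<alpha> \<beta> (frag_cmul k u) = of_int k * tensor_eval \<alpha> \<beta> u"
proof -
  have "tensor_eval \<alpha> \<beta> (frag_cmul k u) =
      (\<Sum>z\<in>Poly_Mapping.keys u. of_int (Poly_Mapping.lookup (frag_cmul k u) z) * (\<alpha> (fst z) * \<beta> (snd z)))"
    by (rule tensor_eval_superset) (simp_all add: keys_cmul)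
  then show ?thesis by (simp add: tensor_eval_def sum_distrib_left mult.assoc)
qed

lemma frag_diff_induct [case_names zero frag diff]:
  assumes "P 0" "\<And>z. P (frag_of z)" "\<And>u v. P u \<Longrightarrow> P v \<Longrightarrow> P (u - v)"
  shows "P u"
  by (rule frag_induction[of u UNIV]) (auto intro: assms)

text \<open>The product of pairs \<open>(a * a', b * b')\<close> extended bilinearly. It matters
  that one \<open>w\<close> serves both evaluations: this makes the graph formed by the two
  evaluations closed under multiplication.\<close>

lemma tensor_eval_mult_exists:
  assumes "subring_hom UNIV \<alpha>" "subring_hom UNIV \<beta>" "subring_hom UNIV \<gamma>" "subring_hom UNIV \<delta>"
  shows "\<exists>w. tensor_eval \<alpha> \<beta> w = tensor_eval \<alpha> \<beta> u * tensor_eval \<alpha> \<beta> v \<and>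
    tensor_eval \<gamma> \<delta> w = tensor_eval \<gamma> \<delta> u * tensor_eval \<gamma> \<delta> v"
proof (induction u rule: frag_diff_induct)
  case zero
  then show ?case by (intro exI[of _ 0]) (simp add: tensor_eval_zero)
next
  case (diff u u')
  then obtain w w' where
    "tensor_eval \<alpha> \<beta> w = tensor_eval \<alpha> \<beta> u * tensor_eval \<alpha> \<beta> v"
    "tensor_eval \<gamma> \<delta> w = tensor_eval \<gamma> \<delta> u * tensor_eval \<gamma> \<delta> v"
    "tensor_eval \<alpha> \<beta> w' = tensor_eval \<alpha> \<beta> u' * tensor_eval \<alpha> \<beta> v"
    "tensor_eval \<gamma> \<delta> w' = tensor_eval \<gamma> \<delta> u' * tensor_eval \<gamma> \<delta> v"
    by blast
  then show ?case
    by (intro exI[of _ "w - w'"]) (simp add: tensor_eval_diff left_diff_distrib)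
next
  case (frag z)
  obtain a b where z: "z = (a, b)" by (cases z)
  show ?case unfolding z
  proof (induction v rule: frag_diff_induct)
    case zero
    then show ?case by (intro exI[of _ 0]) (simp add: tensor_eval_zero)
  next
    case (frag z')
    obtain a' b' where z': "z' = (a', b')" by (cases z')
    show ?case unfolding z'
      by (intro exI[of _ "frag_of (a * a', b * b')"])
        (simp add: tensor_eval_frag_of subring_hom.mult[OF assms(1)] subring_hom.mult[OF assms(2)]
          subring_hom.mult[OF assms(3)] subring_hom.mult[OF assms(4)] ac_simps)
  next
    case (diff v v')
    then obtain w w' where
      "tensor_eval \<alpha> \<beta> w = tensor_eval \<alpha> \<beta> (frag_of (a, b)) * tensor_eval \<alpha> \<beta> v"
      "tensor_eval \<gamma> \<delta> w = tensor_eval \<gamma> \<delta> (frag_of (a, b)) * tensor_eval \<gamma> \<delta> v"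
      "tensor_eval \<alpha> \<beta> w' = tensor_eval \<alpha> \<beta> (frag_of (a, b)) * tensor_eval \<alpha> \<beta> v'"
      "tensor_eval \<gamma> \<delta> w' = tensor_eval \<gamma> \<delta> (frag_of (a, b)) * tensor_eval \<gamma> \<delta> v'"
      by blast
    then show ?case
      by (intro exI[of _ "w - w'"]) (simp add: tensor_eval_diff right_diff_distrib)
  qed
qed

lemma tensor_eval_relations:
  assumes \<alpha>: "subring_hom UNIV \<alpha>" and \<beta>: "subring_hom UNIV \<beta>"
    and agree: "\<And>r. r \<in> S \<Longrightarrow> \<alpha> (c r) = \<beta> (c r)" and u: "u \<in> tensor_relations S c"
  shows "tensor_eval \<alpha> \<beta> u = 0"
  using u
proof induction
  case (left a a' b)
  then show ?case
    by (simp add: tensor_eval_diff tensor_eval_frag_of subring_hom.add[OF \<alpha>] distrib_right)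
next
  case (right a b b')
  then show ?case
    by (simp add: tensor_eval_diff tensor_eval_frag_of subring_hom.add[OF \<beta>] distrib_left)
next
  case (balanced r a b)
  then show ?case
    by (simp add: tensor_eval_diff tensor_eval_frag_of subring_hom.mult[OF \<alpha>]
        subring_hom.mult[OF \<beta>] agree ac_simps)
qed (simp add: tensor_eval_diff)

text \<open>The balancing relation evaluates to the difference of the two sides. As a relation it is
  divisible by every power of \<open>p\<close>, hence 0 in a separated ring.\<close>

lemma tensor_square_scalars:
  fixes i\<^sub>1 i\<^sub>2 :: "'b::comm_ring_1 \<Rightarrow> 't::comm_ring_1"
  assumes square: "completed_tensor_square p S c i\<^sub>1 i\<^sub>2" and r: "r \<in> S"
  shows "i\<^sub>1 (c r) = i\<^sub>2 (c r)"
proof -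
  interpret i\<^sub>1: subring_hom UNIV i\<^sub>1
    using square by (simp add: completed_tensor_square_def subring_hom_UNIV_iff)
  interpret i\<^sub>2: subring_hom UNIV i\<^sub>2
    using square by (simp add: completed_tensor_square_def subring_hom_UNIV_iff)
  let ?u = "frag_of (c r * 1, 1) - frag_of (1, c r * 1)"
  have "?u \<in> tensor_relations S c" by (rule tensor_relations.balanced[OF r])
  then have "\<exists>v. ?u - frag_cmul (int p ^ m) v \<in> tensor_relations S c" for m
    by (intro exI[of _ 0]) simp
  then have "of_nat p ^ m dvd tensor_eval i\<^sub>1 i\<^sub>2 ?u" for m
    using square unfolding completed_tensor_square_def by blast
  then have "tensor_eval i\<^sub>1 i\<^sub>2 ?u = 0"
    using padic_separated square unfolding completed_tensor_square_def by blast
  then show ?thesis by (simp add: tensor_eval_diff tensor_eval_frag_of i\<^sub>1.one i\<^sub>2.one)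
qed

text \<open>Evaluations of formal sums are dense. If such an evaluation is divisible by
  \<open>p ^ m\<close>, the formal sum is \<open>p ^ m\<close> times another one up to a relation,
  and relations evaluate to 0 under \<open>\<alpha>\<close> and \<open>\<beta>\<close> because these
  agree on scalars; this gives the continuity needed to extend.\<close>

lemma tensor_square_hom_ex1:
  fixes i\<^sub>1 i\<^sub>2 :: "'b::comm_ring_1 \<Rightarrow> 't::comm_ring_1" and \<alpha> \<beta> :: "'b \<Rightarrow> 'u::comm_ring_1"
  assumes square: "completed_tensor_square p S c i\<^sub>1 i\<^sub>2" and complete: "padic_complete p TYPE('u)"
    and \<alpha>: "subring_hom UNIV \<alpha>" and \<beta>: "subring_hom UNIV \<beta>"
    and agree: "\<And>r. r \<in> S \<Longrightarrow> \<alpha> (c r) = \<beta> (c r)"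
  shows "\<exists>!h. ring_hom_on UNIV UNIV h \<and> (\<forall>a b. h (i\<^sub>1 a * i\<^sub>2 b) = \<alpha> a * \<beta> b)"
proof -
  have i: "subring_hom UNIV i\<^sub>1" "subring_hom UNIV i\<^sub>2"
    and dense: "\<And>m t. \<exists>u. of_nat p ^ m dvd t - tensor_eval i\<^sub>1 i\<^sub>2 u"
    and torsion: "\<And>m u. of_nat p ^ m dvd tensor_eval i\<^sub>1 i\<^sub>2 u \<Longrightarrow>
      \<exists>v. u - frag_cmul (int p ^ m) v \<in> tensor_relations S c"
    using square unfolding completed_tensor_square_def subring_hom_UNIV_iff by blast+
  define G where "G = (\<lambda>u. (tensor_eval i\<^sub>1 i\<^sub>2 u, tensor_eval \<alpha> \<beta> u)) ` UNIV"
  have "\<exists>h. subring_hom UNIV h \<and> (\<forall>a b. (a, b) \<in> G \<longrightarrow> h a = b)"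
  proof (rule extend_dense_graph[OF complete])
    have "(tensor_eval i\<^sub>1 i\<^sub>2 (frag_of (1, 1)), tensor_eval \<alpha> \<beta> (frag_of (1, 1))) \<in> G"
      unfolding G_def by blast
    then show "(1, 1) \<in> G"
      by (simp add: tensor_eval_frag_of subring_hom.one[OF i(1)] subring_hom.one[OF i(2)]
          subring_hom.one[OF \<alpha>] subring_hom.one[OF \<beta>])
  next
    fix a b a' b' assume "(a, b) \<in> G" "(a', b') \<in> G"
    then obtain u v where uv: "a = tensor_eval i\<^sub>1 i\<^sub>2 u" "b = tensor_eval \<alpha> \<beta> u"
      "a' = tensor_eval i\<^sub>1 i\<^sub>2 v" "b' = tensor_eval \<alpha> \<beta> v" unfolding G_def by blast
    then have "(a - a', b - b') = (tensor_eval i\<^sub>1 i\<^sub>2 (u - v), tensor_eval \<alpha> \<beta> (u - v))"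
      by (simp add: tensor_eval_diff)
    then show "(a - a', b - b') \<in> G" unfolding G_def by blast
    obtain w where "tensor_eval i\<^sub>1 i\<^sub>2 w = a * a'" "tensor_eval \<alpha> \<beta> w = b * b'"
      using tensor_eval_mult_exists[OF i \<alpha> \<beta>, of u v] uv by auto
    then show "(a * a', b * b') \<in> G" unfolding G_def by (intro image_eqI[of _ _ w]) simp_all
  next
    show "\<exists>d e. (d, e) \<in> G \<and> of_nat p ^ m dvd a - d" for m a
      using dense[of m a] unfolding G_def by blast
  next
    fix m a b assume "(a, b) \<in> G" "of_nat p ^ m dvd a"
    then obtain u where u: "b = tensor_eval \<alpha> \<beta> u" "of_nat p ^ m dvd tensor_eval i\<^sub>1 i\<^sub>2 u"
      unfolding G_def by blast
    then obtain v where "u - frag_cmul (int p ^ m) v \<in> tensor_relations S c" using torsion by blast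
    from tensor_eval_relations[OF \<alpha> \<beta> agree this] have "b = of_nat p ^ m * tensor_eval \<alpha> \<beta> v"
      using u by (simp add: tensor_eval_diff tensor_eval_cmul)
    then show "of_nat p ^ m dvd b" by simp
  qed
  then obtain h where h: "subring_hom UNIV h" and hG: "\<And>a b. (a, b) \<in> G \<Longrightarrow> h a = b" by blast
  have h_eq: "h (i\<^sub>1 a * i\<^sub>2 b) = \<alpha> a * \<beta> b" for a b
  proof (rule hG)
    show "(i\<^sub>1 a * i\<^sub>2 b, \<alpha> a * \<beta> b) \<in> G"
      unfolding G_def by (intro image_eqI[of _ _ "frag_of (a, b)"]) (simp_all add: tensor_eval_frag_of)
  qed
  show ?thesis
  proof (rule ex1I[of _ h])
    show "ring_hom_on UNIV UNIV h \<and> (\<forall>a b. h (i\<^sub>1 a * i\<^sub>2 b) = \<alpha> a * \<beta> b)"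
      using h h_eq by (simp add: subring_hom_UNIV_iff)
  next
    fix g assume g: "ring_hom_on UNIV UNIV g \<and> (\<forall>a b. g (i\<^sub>1 a * i\<^sub>2 b) = \<alpha> a * \<beta> b)"
    then have g_hom: "subring_hom UNIV g" by (simp add: subring_hom_UNIV_iff)
    show "g = h"
    proof (rule subring_hom_eq_if_agree_on_dense[OF complete g_hom h])
      show "\<exists>d\<in>range (tensor_eval i\<^sub>1 i\<^sub>2). of_nat p ^ m dvd a - d" for m a
        using dense[of m a] by blast
      fix d assume "d \<in> range (tensor_eval i\<^sub>1 i\<^sub>2)"
      then obtain u where d: "d = tensor_eval i\<^sub>1 i\<^sub>2 u" by blast
      have "g (tensor_eval i\<^sub>1 i\<^sub>2 u) = h (tensor_eval i\<^sub>1 i\<^sub>2 u)"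
      proof (induction u rule: frag_diff_induct)
        case zero
        then show ?case by (simp add: tensor_eval_zero subring_hom.zero[OF g_hom] subring_hom.zero[OF h])
      next
        case (frag z)
        then show ?case using g h_eq by (cases z) (simp add: tensor_eval_frag_of)
      next
        case (diff u v)
        then show ?case
          by (simp add: tensor_eval_diff subring_hom.diff[OF g_hom] subring_hom.diff[OF h])
      qed
      then show "g d = h d" using d by simp
    qed
  qed
qed


section \<open>Square roots of matrices congruent to the identity\<close>

lemma matrix_diff_ldistrib: "A ** (B - C) = A ** B - A ** C"
  for A :: "'a::ring_1 ^ 'm::finite ^ 'n"
  by (simp add: vec_eq_iff matrix_matrix_mult_def right_diff_distrib sum_subtractf)

lemma matrix_diff_rdistrib: "(A - B) ** C = A ** C - B ** C"
  for C :: "'a::ring_1 ^ 'm::finite ^ 'n::finite"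
  by (simp add: vec_eq_iff matrix_matrix_mult_def left_diff_distrib sum_subtractf)

text \<open>Here \<open>\<rho>\<close> plays the role of the image of \<open>\<pi>\<close>. The two
  divisibility assumptions make the p-adic and \<open>\<rho>\<close>-adic topologies coincide; the
  unit 2 serves the uniqueness of square roots.\<close>

locale uniformized_ring =
  fixes p :: nat and \<rho> :: "'b::comm_ring_1"
  assumes complete: "padic_complete p TYPE('b)"
    and uniformizer_power_ex: "\<exists>d w. \<rho> ^ d = of_nat p * w"
    and uniformizer_dvd: "\<rho> dvd of_nat p"
    and two_unit: "(2::'b) dvd 1"
begin

text \<open>Any exponent that turns \<open>\<rho>\<close> into a multiple of \<open>p\<close>; it
  need not be the ramification index.\<close>

definition ramification :: nat where
  "ramification = (SOME d. of_nat p dvd \<rho> ^ d)"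

lemma p_dvd_ramification_power: "of_nat p dvd \<rho> ^ ramification"
  unfolding ramification_def by (rule someI_ex) (use uniformizer_power_ex in \<open>auto simp: dvd_def\<close>)

lemma p_power_dvd: "ramification * m \<le> k \<Longrightarrow> of_nat p ^ m dvd \<rho> ^ k"
  using dvd_power_same[OF p_dvd_ramification_power, of m] le_imp_power_dvd[of "ramification * m" k \<rho>]
  by (metis dvd_trans power_mult)

lemma separated: "(\<And>k. \<rho> ^ k dvd a) \<Longrightarrow> a = 0"
  by (rule padic_separated[OF complete]) (meson dvd_trans order_refl p_power_dvd)

text \<open>With \<open>a = 1 - y\<close> and \<open>y\<close> a multiple of \<open>\<rho>\<close>,
  \<open>a\<close> divides \<open>1 - y ^ d\<close> for every \<open>d\<close>; for
  \<open>d = ramification\<close> this is 1 minus a multiple of \<open>p\<close>, a unit.\<close>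

lemma unit_if_cong_1:
  assumes "\<rho> dvd a - 1"
  shows "a dvd 1"
proof -
  obtain z where z: "a - 1 = \<rho> * z" using assms ..
  have "of_nat p dvd (- \<rho> * z) ^ ramification"
  proof -
    have "(- \<rho> * z) ^ ramification = \<rho> ^ ramification * (- z) ^ ramification"
      by (simp flip: power_mult_distrib)
    then show ?thesis using p_dvd_ramification_power by simp
  qed
  then obtain y where y: "(- \<rho> * z) ^ ramification = of_nat p * y" ..
  have "a = 1 - (- \<rho> * z)" using z by (simp add: algebra_simps)
  then have "a dvd 1 - (- \<rho> * z) ^ ramification" by (simp only: one_diff_power_eq dvd_triv_left)
  also have "\<dots> dvd 1" unfolding y by (rule one_minus_p_mult_unit[OF complete])
  finally show ?thesis .
qed

text \<open>The difference \<open>D\<close> of two square roots satisfies \<open>A D + D B = 0\<close>, that is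
  \<open>2 D = - (A - 1) D - D (B - 1)\<close>, which gains a factor \<open>\<rho>\<close> at every iteration.\<close>

lemma matrix_sqrt_unique:
  fixes A B :: "'b ^ 'n::finite ^ 'n"
  assumes eq: "A ** A = B ** B"
    and A: "\<And>i j. \<rho> dvd A $ i $ j - mat 1 $ i $ j" and B: "\<And>i j. \<rho> dvd B $ i $ j - mat 1 $ i $ j"
  shows "A = B"
proof -
  define D where "D = A - B"
  obtain t where t: "(1::'b) = 2 * t" using two_unit ..
  \<comment> \<open>The mixed terms \<open>A ** B\<close> cancel, so no commutation between
    \<open>A\<close> and \<open>B\<close> is needed.\<close>
  have "A ** D + D ** B = 0" unfolding D_def matrix_diff_ldistrib matrix_diff_rdistrib by (simp add: eq)
  then have "D + D = - ((A - mat 1) ** D + D ** (B - mat 1))"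
    by (simp add: matrix_diff_ldistrib matrix_diff_rdistrib)
  from arg_cong[OF this, of "\<lambda>M. M $ _ $ _"]
  have "D $ i $ j + D $ i $ j = - (((A - mat 1) ** D) $ i $ j + (D ** (B - mat 1)) $ i $ j)" for i j
    by (simp only: vector_add_component vector_uminus_component)
  moreover have "D $ i $ j = t * (D $ i $ j + D $ i $ j)" for i j
  proof -
    have "D $ i $ j = (2 * t) * D $ i $ j" by (simp flip: t)
    then show ?thesis by (simp add: algebra_simps)
  qed
  ultimately have D_eq: "D $ i $ j = t * - (((A - mat 1) ** D) $ i $ j + (D ** (B - mat 1)) $ i $ j)" for i j
    by metis
  have "\<rho> ^ k dvd D $ i $ j" for k i j
  proof (induction k arbitrary: i j)
    case (Suc k)
    have "\<rho> ^ Suc k dvd ((A - mat 1) ** D) $ i $ j"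
      unfolding matrix_matrix_mult_def using A Suc by (auto intro!: dvd_sum mult_dvd_mono)
    moreover have "\<rho> ^ Suc k dvd (D ** (B - mat 1)) $ i $ j"
      unfolding matrix_matrix_mult_def using B Suc
      by (auto intro!: dvd_sum mult_dvd_mono simp: mult.commute[of \<rho>])
    ultimately show ?case by (subst D_eq) (simp only: dvd_mult dvd_minus_iff dvd_add)
  qed simp
  then have "D $ i $ j = 0" for i j by (rule separated)
  then show ?thesis by (simp add: D_def vec_eq_iff)
qed

section \<open>Convergence of the binomial series\<close>

context
  fixes S :: "'k::field_char_0 set" and c :: "'k \<Rightarrow> 'b" and X :: "'b ^ 'n::finite ^ 'n"
  assumes c: "subring_hom S c" and half: "1 / 2 \<in> S"
begin

definition sqrt_coefficient :: "nat \<Rightarrow> 'b" where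
  "sqrt_coefficient k = c ((1 / 2) gchoose k)"

definition matrix_power :: "nat \<Rightarrow> 'b ^ 'n ^ 'n" where
  "matrix_power k = ((\<lambda>Y. X ** Y) ^^ k) (mat 1)"

definition partial_sqrt :: "nat \<Rightarrow> 'b ^ 'n ^ 'n" where
  "partial_sqrt m = (\<chi> i j. \<Sum>k<m. sqrt_coefficient k * \<rho> ^ k * matrix_power k $ i $ j)"

lemma gbinomial_half_in: "(1 / 2) gchoose k \<in> S"
  by (rule gbinomial_half_in_subring[OF subring_hom.subring[OF c] half])

text \<open>The coefficients of the square of \<open>(1 + T)^(1/2)\<close>, by Vandermonde's
  identity for 1/2 + 1/2 = 1.\<close>

lemma sqrt_coefficient_convolution:
  "(\<Sum>a\<le>n. sqrt_coefficient a * sqrt_coefficient (n - a)) = (if n \<le> 1 then 1 else 0)"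
proof -
  interpret c: subring_hom S c by (rule c)
  have "(\<Sum>a\<le>n. ((1 / 2) gchoose a) * ((1 / 2) gchoose (n - a))) = (1 :: 'k) gchoose n"
    using gbinomial_Vandermonde[of "1 / 2 :: 'k" "1 / 2" n] by (simp add: atMost_atLeast0)
  also have "\<dots> = of_nat (1 choose n)" by (metis binomial_gbinomial of_nat_1)
  also have "\<dots> = (if n \<le> 1 then 1 else 0)"
    by (cases "n = 0"; cases "n = 1") (auto simp: binomial_eq_0)
  finally have "c (\<Sum>a\<le>n. ((1 / 2) gchoose a) * ((1 / 2) gchoose (n - a))) = (if n \<le> 1 then 1 else 0)"
    by (simp add: c.one c.zero)
  then show ?thesis
    by (simp add: sqrt_coefficient_def c.sum c.mult gbinomial_half_in subring_mult c.subring)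
qed

lemma sqrt_coefficient_0: "sqrt_coefficient 0 = 1"
  by (simp add: sqrt_coefficient_def subring_hom.one[OF c])

lemma matrix_power_0: "matrix_power 0 = mat 1"
  by (simp add: matrix_power_def)

lemma matrix_power_Suc: "matrix_power (Suc k) = X ** matrix_power k"
  by (simp add: matrix_power_def)

lemma matrix_power_add: "matrix_power k ** matrix_power l = matrix_power (k + l)"
  by (induction k) (simp_all add: matrix_power_0 matrix_power_Suc flip: matrix_mul_assoc)

lemma partial_sqrt_diff:
  assumes "m \<le> k"
  shows "\<rho> ^ m dvd partial_sqrt k $ i $ j - partial_sqrt m $ i $ j"
proof -
  have "partial_sqrt k $ i $ j - partial_sqrt m $ i $ j =
      (\<Sum>l\<in>{..<k} - {..<m}. sqrt_coefficient l * \<rho> ^ l * matrix_power l $ i $ j)"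
    unfolding partial_sqrt_def using assms by (subst sum_diff) auto
  also have "\<rho> ^ m dvd \<dots>"
    by (intro dvd_sum dvd_mult2[OF dvd_mult[OF le_imp_power_dvd]]) auto
  finally show ?thesis .
qed

text \<open>Terms with \<open>a + b < k\<close> form complete convolutions and add up to
  \<open>1 + \<rho> X\<close>, the linear term being present because \<open>k \<ge> 2\<close>. All
  remaining terms carry at least \<open>\<rho> ^ k\<close>.\<close>

lemma partial_sqrt_square:
  assumes k: "k \<ge> 2"
  shows "\<rho> ^ k dvd (partial_sqrt k ** partial_sqrt k) $ i $ j -
    (mat 1 $ i $ j + \<rho> * X $ i $ j)"
proof -
  let ?s = sqrt_coefficient
  define q where "q n = \<rho> ^ n * matrix_power n $ i $ j" for n
  let ?T = "{(a, b). a + b < k}"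
  have sub: "?T \<subseteq> {..<k} \<times> {..<k}" by auto
  have "(partial_sqrt k ** partial_sqrt k) $ i $ j =
      (\<Sum>l\<in>UNIV. \<Sum>a<k. \<Sum>b<k. ?s a * ?s b * \<rho> ^ (a + b) * (matrix_power a $ i $ l * matrix_power b $ l $ j))"
    by (simp add: matrix_matrix_mult_def partial_sqrt_def sum_product power_add ac_simps)
  also have "\<dots> = (\<Sum>a<k. \<Sum>b<k. ?s a * ?s b * \<rho> ^ (a + b) * (matrix_power a ** matrix_power b) $ i $ j)"
    by (simp add: matrix_matrix_mult_def sum_distrib_left sum.swap[of _ UNIV])
  also have "\<dots> = (\<Sum>(a, b)\<in>{..<k} \<times> {..<k}. ?s a * ?s b * q (a + b))"
    by (simp add: matrix_power_add q_def sum.cartesian_product ac_simps)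
  also have "\<dots> = (\<Sum>(a, b)\<in>{..<k} \<times> {..<k} - ?T. ?s a * ?s b * q (a + b)) +
      (\<Sum>(a, b)\<in>?T. ?s a * ?s b * q (a + b))"
    by (rule sum.subset_diff[OF sub]) simp
  also have "(\<Sum>(a, b)\<in>?T. ?s a * ?s b * q (a + b)) = (\<Sum>n<k. (\<Sum>a\<le>n. ?s a * ?s (n - a)) * q n)"
    by (simp add: sum.triangle_reindex sum_distrib_right)
  also have "\<dots> = (\<Sum>n<k. if n \<le> 1 then q n else 0)"
    unfolding sqrt_coefficient_convolution by (rule sum.cong) auto
  also have "\<dots> = (\<Sum>n\<in>{0, 1}. q n)"
    by (rule sum.mono_neutral_cong_right) (use k in auto)
  also have "\<dots> = mat 1 $ i $ j + \<rho> * X $ i $ j"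
    by (simp add: q_def matrix_power_0 matrix_power_Suc)
  finally have "(partial_sqrt k ** partial_sqrt k) $ i $ j - (mat 1 $ i $ j + \<rho> * X $ i $ j) =
      (\<Sum>(a, b)\<in>{..<k} \<times> {..<k} - ?T. ?s a * ?s b * q (a + b))"
    by simp
  also have "\<rho> ^ k dvd \<dots>"
    by (intro dvd_sum) (auto simp: q_def intro!: dvd_mult[OF dvd_mult2[OF le_imp_power_dvd]])
  finally show ?thesis .
qed

lemma binomial_series_sqrt:
  "\<exists>L. (\<forall>i j. padic_limit p (\<lambda>m. \<Sum>k<m. c ((1/2) gchoose k) * \<rho> ^ k *
      (((\<lambda>Y. X ** Y) ^^ k) (mat 1)) $ i $ j) (L $ i $ j)) \<and>
    L ** L = mat 1 + map_matrix (\<lambda>a. \<rho> * a) X \<and> (\<forall>i j. \<rho> dvd L $ i $ j - mat 1 $ i $ j)"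
proof -
  have step: "of_nat p ^ m dvd partial_sqrt k $ i $ j - partial_sqrt l $ i $ j"
    if "k \<ge> ramification * m" "l \<ge> ramification * m" for m k l i j
  proof -
    have "\<rho> ^ (ramification * m) dvd (partial_sqrt k $ i $ j - partial_sqrt (ramification * m) $ i $ j) -
        (partial_sqrt l $ i $ j - partial_sqrt (ramification * m) $ i $ j)"
      using that by (intro dvd_diff partial_sqrt_diff)
    then have "\<rho> ^ (ramification * m) dvd partial_sqrt k $ i $ j - partial_sqrt l $ i $ j" by simp
    then show ?thesis using p_power_dvd[of m "ramification * m"] dvd_trans by blast
  qed
  then have "padic_Cauchy p (\<lambda>m. partial_sqrt m $ i $ j)" for i j
    unfolding padic_Cauchy_def by blast
  then have "\<forall>i j. \<exists>a. padic_limit p (\<lambda>m. partial_sqrt m $ i $ j) a"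
    using complete unfolding padic_complete_def by blast
  then obtain \<Lambda> where \<Lambda>: "\<And>i j. padic_limit p (\<lambda>m. partial_sqrt m $ i $ j) (\<Lambda> i j)" by metis
  define L where "L = (\<chi> i j. \<Lambda> i j)"
  have lim: "padic_limit p (\<lambda>m. partial_sqrt m $ i $ j) (L $ i $ j)" for i j
    using \<Lambda> by (simp add: L_def)
  \<comment> \<open>The definition of a limit gives no rate; comparing with a much later partial sum
    supplies one.\<close>
  have near: "of_nat p ^ m dvd partial_sqrt k $ i $ j - L $ i $ j" if k: "k \<ge> ramification * m" for m k i j
  proof -
    obtain M where M: "\<forall>k\<ge>M. of_nat p ^ m dvd partial_sqrt k $ i $ j - L $ i $ j"
      using lim[of i j] unfolding padic_limit_def by blast
    have "of_nat p ^ m dvd partial_sqrt k $ i $ j - partial_sqrt (max M k) $ i $ j"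
      using k by (intro step) auto
    from dvd_diff_trans[OF this] show ?thesis using M by simp
  qed
  have cong: "\<rho> dvd L $ i $ j - mat 1 $ i $ j" for i j
  proof -
    \<comment> \<open>At least \<open>ramification\<close> terms bring the partial sum within
      \<open>p\<close>, hence within \<open>\<rho>\<close>, of \<open>L\<close>; at least one term
      makes it start with the identity.\<close>
    let ?k = "max 1 ramification"
    have "of_nat p ^ 1 dvd partial_sqrt ?k $ i $ j - L $ i $ j" by (rule near) simp
    then have "of_nat p dvd L $ i $ j - partial_sqrt ?k $ i $ j"
      unfolding power_one_right by (rule dvd_diff_sym)
    then have *: "\<rho> dvd L $ i $ j - partial_sqrt ?k $ i $ j"
      by (rule dvd_trans[OF uniformizer_dvd])
    have "\<rho> ^ 1 dvd partial_sqrt ?k $ i $ j - partial_sqrt 1 $ i $ j"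
      by (rule partial_sqrt_diff) simp
    moreover have "partial_sqrt 1 $ i $ j = mat 1 $ i $ j"
      by (simp add: partial_sqrt_def sqrt_coefficient_0 matrix_power_0)
    ultimately have "\<rho> dvd partial_sqrt ?k $ i $ j - mat 1 $ i $ j" by simp
    with * show ?thesis by (rule dvd_diff_trans)
  qed
  have square: "(L ** L) $ i $ j - (mat 1 $ i $ j + \<rho> * X $ i $ j) = 0" for i j
  proof (rule padic_separated[OF complete])
    fix m
    \<comment> \<open>Enough terms for precision \<open>p ^ m\<close>, and at least the two terms
      needed for the linear part of the square.\<close>
    let ?k = "max 2 (ramification * m)"
    have "of_nat p ^ m dvd L $ a $ b - partial_sqrt ?k $ a $ b" for a b
      by (rule dvd_diff_sym[OF near]) simp
    then have "of_nat p ^ m dvd (L ** L) $ i $ j - (partial_sqrt ?k ** partial_sqrt ?k) $ i $ j"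
      by (intro dvd_diff_matrix_mult)
    moreover have "of_nat p ^ m dvd (partial_sqrt ?k ** partial_sqrt ?k) $ i $ j -
        (mat 1 $ i $ j + \<rho> * X $ i $ j)"
      by (rule dvd_trans[OF p_power_dvd partial_sqrt_square]) auto
    ultimately show "of_nat p ^ m dvd (L ** L) $ i $ j - (mat 1 $ i $ j + \<rho> * X $ i $ j)"
      by (rule dvd_diff_trans)
  qed
  have "L ** L = mat 1 + map_matrix (\<lambda>a. \<rho> * a) X"
    using square by (simp add: vec_eq_iff)
  then show ?thesis
    using lim cong
    by (intro exI[of _ L]) (simp add: partial_sqrt_def sqrt_coefficient_def matrix_power_def)
qed

end

end


section \<open>Frobenius lifts on the completed coordinate ring\<close>

lemma subring_hom_comp:
  "subring_hom UNIV g \<Longrightarrow> subring_hom UNIV h \<Longrightarrow> subring_hom UNIV (\<lambda>a. h (g a))"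
  unfolding subring_hom_UNIV_iff by (rule ring_hom_on_comp)

lemma matrix_inv_eq:
  fixes A :: "'a::comm_ring_1 ^ 'n::finite ^ 'n"
  assumes "A ** A' = mat 1" "A' ** A = mat 1"
  shows "matrix_inv A = A'"
proof -
  have "A ** matrix_inv A = mat 1 \<and> matrix_inv A ** A = mat 1"
    unfolding matrix_inv_def by (rule someI[of _ A']) (use assms in simp)
  then have inv: "A ** matrix_inv A = mat 1" ..
  have "A' = A' ** (A ** matrix_inv A)" unfolding inv by simp
  also have "\<dots> = matrix_inv A" by (simp add: matrix_mul_assoc assms)
  finally show ?thesis by simp
qed

locale lift_setup = completed_GL p S j x c X coordinate_ring + root: uniformized_ring p "c \<pi>"
  for p :: nat and S :: "'k::field_char_0 set" and j :: "'k polys fract \<Rightarrow> 'b::comm_ring_1"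
    and x :: "'b ^ 'n::finite ^ 'n" and c :: "'k \<Rightarrow> 'b" and X coordinate_ring and \<pi> :: 'k +
  fixes s :: nat and f :: "'k \<Rightarrow> 'k"
  assumes prime: "prime p"
    and lift: "frobenius_lift_on p s \<pi> S f" and uniformizer_in: "\<pi> \<in> S"
begin

sublocale c: subring_hom S c by (rule subring_hom_c)

lemma f_in: "r \<in> S \<Longrightarrow> f r \<in> S"
  using lift by (auto simp: frobenius_lift_on_def ring_hom_on_def)

sublocale f: subring_hom S f
  using lift subring_S
  by (auto simp: frobenius_lift_on_def subring_hom_def intro: ring_hom_on_UNIV_target)

lemma p_dvd_imp: "of_nat p dvd a \<Longrightarrow> c \<pi> dvd a"
  using root.uniformizer_dvd dvd_trans by blast

abbreviation m :: nat where
  "m \<equiv> p ^ s"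

abbreviation extends :: "('b \<Rightarrow> 'b) \<Rightarrow> bool" where
  "extends \<phi> \<equiv> lift_extending p s \<pi> S c f \<phi>"

abbreviation xm :: "'b ^ 'n ^ 'n" where
  "xm \<equiv> entry_power m x"

lemma entry_power_mat_1: "entry_power m (mat 1) = (mat 1 :: 'b ^ 'n ^ 'n)"
  using prime by (simp add: vec_eq_iff mat_def power_0_left prime_gt_0_nat)

lemma extends_hom: "extends \<phi> \<Longrightarrow> subring_hom UNIV \<phi>"
  by (simp add: lift_extending_def frobenius_lift_on_def subring_hom_UNIV_iff)

lemma extends_c: "extends \<phi> \<Longrightarrow> r \<in> S \<Longrightarrow> \<phi> (c r) = c (f r)"
  by (simp add: lift_extending_def)

lemma extends_cong: "extends \<phi> \<Longrightarrow> c \<pi> dvd \<phi> a - a ^ m"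
  by (simp add: lift_extending_def frobenius_lift_on_def dvd_def)

text \<open>The elements satisfying the congruence form a subring, because the power map is additive
  modulo \<open>p\<close> and \<open>c \<pi>\<close> divides \<open>p\<close>. It contains the
  generators of the coordinate ring, and approximation modulo \<open>p\<close> reaches everything
  else.\<close>

lemma extends_if_cong:
  assumes \<phi>: "subring_hom UNIV \<phi>" and \<phi>_c: "\<And>r. r \<in> S \<Longrightarrow> \<phi> (c r) = c (f r)"
    and \<phi>_x: "\<And>i k. c \<pi> dvd \<phi> (x $ i $ k) - x $ i $ k ^ m"
  shows "extends \<phi>"
proof -
  interpret \<phi>: subring_hom UNIV \<phi> by fact
  interpret j: subring_hom coordinate_ring j by (rule subring_hom_j)
  define T where "T = {a. c \<pi> dvd \<phi> a - a ^ m}"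
  have T: "is_subring T"
    unfolding is_subring_def
  proof (intro conjI ballI)
    show "1 \<in> T" by (simp add: T_def \<phi>.one)
  next
    fix a b assume ab: "a \<in> T" "b \<in> T"
    then show "a * b \<in> T"
      unfolding T_def by (auto simp: \<phi>.mult power_mult_distrib intro: dvd_diff_mult)
    have "c \<pi> dvd (\<phi> a - a ^ m) - (\<phi> b - b ^ m)" using ab unfolding T_def by (auto intro: dvd_diff)
    then have "c \<pi> dvd \<phi> (a - b) - (a ^ m - b ^ m)" by (simp add: \<phi>.diff algebra_simps)
    moreover have "c \<pi> dvd (a ^ m - b ^ m) - (a - b) ^ m"
      by (rule dvd_diff_sym, rule p_dvd_imp, rule Frobenius_diff[OF prime])
    ultimately show "a - b \<in> T" unfolding T_def using dvd_diff_trans by blast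
  qed
  have x_T: "x $ i $ k \<in> T" for i k using \<phi>_x by (simp add: T_def)
  have det_T: "det x \<in> T" by (rule subring_det[OF T x_T])
  have c_T: "c r \<in> T" if "r \<in> S" for r
  proof -
    obtain b where b: "b \<in> S" "f r - r ^ m = \<pi> * b"
      using lift \<open>r \<in> S\<close> unfolding frobenius_lift_on_def by blast
    have "\<phi> (c r) - c r ^ m = c (f r - r ^ m)"
      using that by (simp add: \<phi>_c c.diff c.power f_in subring_power subring_S)
    also have "\<dots> = c \<pi> * c b" using b uniformizer_in by (simp add: c.mult)
    finally show ?thesis by (simp add: T_def)
  qed
  define u where "u = j (inverse (det X))"
  have u: "u * det x = 1" unfolding u_def by (rule j_det_unit)
  \<comment> \<open>For the inverse \<open>u\<close> of \<open>det x\<close> the congruence is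
    obtained from that of \<open>det x\<close> by bringing the difference of the inverses to a
    common denominator.\<close>
  have "\<phi> u - u ^ m = \<phi> u * u ^ m * (det x ^ m - \<phi> (det x))"
  proof -
    have "u ^ m * det x ^ m = 1" "\<phi> u * \<phi> (det x) = 1"
      by (simp_all add: u \<phi>.one flip: power_mult_distrib \<phi>.mult)
    moreover have "\<phi> u * u ^ m * (det x ^ m - \<phi> (det x)) =
        \<phi> u * (u ^ m * det x ^ m) - u ^ m * (\<phi> u * \<phi> (det x))"
      by (simp add: algebra_simps)
    ultimately show ?thesis by simp
  qed
  then have u_T: "u \<in> T"
    using det_T dvd_diff_sym[of "c \<pi>" "\<phi> (det x)" "det x ^ m"] by (simp add: T_def)
  have j_T: "j a \<in> T" if "a \<in> coordinate_ring" for a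
    using that unfolding coordinate_ring_eq
  proof induction
    case (gen a)
    then show ?case using c_T x_T u_T by (auto simp: c_eq x_eq u_def)
  next
    case one
    show ?case using j.one subring_one[OF T] by simp
  next
    case (diff a b)
    then show ?case using j.diff[of a b] subring_diff[OF T] by (simp add: coordinate_ring_eq)
  next
    case (mult a b)
    then show ?case using j.mult[of a b] subring_mult[OF T] by (simp add: coordinate_ring_eq)
  qed
  have "c \<pi> dvd \<phi> a - a ^ m" for a
  proof -
    obtain b where b: "b \<in> coordinate_ring" "of_nat p ^ 1 dvd a - j b" using dense_j by blast
    have "of_nat p ^ 1 dvd \<phi> (a - j b)" by (rule subring_hom_p_power_dvd[OF \<phi> b(2)])
    then have "c \<pi> dvd \<phi> a - \<phi> (j b)" by (intro p_dvd_imp) (simp add: \<phi>.diff)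
    moreover have "c \<pi> dvd \<phi> (j b) - j b ^ m" using j_T[OF b(1)] by (simp add: T_def)
    ultimately have "c \<pi> dvd \<phi> a - j b ^ m" by (rule dvd_diff_trans)
    moreover have "of_nat p dvd a - j b" using b(2) by simp
    then have "c \<pi> dvd j b ^ m - a ^ m" by (intro dvd_diff_power dvd_diff_sym[OF p_dvd_imp])
    ultimately show ?thesis by (rule dvd_diff_trans)
  qed
  then show ?thesis
    using \<phi> \<phi>_c by (auto simp: lift_extending_def frobenius_lift_on_def subring_hom_UNIV_iff dvd_def)
qed

text \<open>Multiplied by the entrywise power of an inverse of \<open>x\<close>, the matrix
  \<open>Y\<close> becomes congruent to the identity, so the product of the two determinants is
  congruent to 1 and a unit.\<close>

lemma det_unit_if_cong:
  assumes "\<And>i k. c \<pi> dvd Y $ i $ k - x $ i $ k ^ m"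
  shows "det Y dvd 1"
proof -
  obtain x' where x': "x ** x' = mat 1" using x_inverse by blast
  let ?x' = "entry_power m x'"
  have "c \<pi> dvd (Y ** ?x') $ i $ k - (mat 1) $ i $ k" for i k
  proof -
    have "c \<pi> dvd (Y ** ?x') $ i $ k - (xm ** ?x') $ i $ k"
      by (rule dvd_diff_matrix_mult) (use assms in auto)
    moreover have "c \<pi> dvd (xm ** ?x') $ i $ k - entry_power m (x ** x') $ i $ k"
      by (rule dvd_diff_sym, rule p_dvd_imp, rule Frobenius_matrix_mult[OF prime])
    ultimately show ?thesis unfolding x' entry_power_mat_1 by (rule dvd_diff_trans)
  qed
  then have "c \<pi> dvd det (Y ** ?x') - det (mat 1 :: 'b ^ 'n ^ 'n)" by (rule dvd_diff_det)
  then have "det Y * det ?x' dvd 1" using root.unit_if_cong_1 by (simp add: det_mul)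
  then show ?thesis by (rule dvd_mult_left)
qed

lemma lift_exists:
  assumes "\<And>i k. c \<pi> dvd Y $ i $ k - x $ i $ k ^ m"
  shows "\<exists>\<phi>. extends \<phi> \<and> map_matrix \<phi> x = Y"
proof -
  have "ring_hom_on S UNIV (\<lambda>r. c (f r))"
    using lift c.hom unfolding frobenius_lift_on_def by (blast intro: ring_hom_on_comp)
  then have "subring_hom S (\<lambda>r. c (f r))" by (simp add: subring_hom_def subring_S)
  from hom_exists[OF complete this det_unit_if_cong[OF assms]]
  obtain h where h: "subring_hom UNIV h" "\<forall>r\<in>S. h (c r) = c (f r)" "map_matrix h x = Y" by blast
  have "h (x $ i $ k) = Y $ i $ k" for i k using h(3) by (metis nth_map_matrix)
  then have "extends h" using h assms by (intro extends_if_cong) auto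
  then show ?thesis using h by blast
qed

lemma lift_unique: "extends \<phi> \<Longrightarrow> extends \<psi> \<Longrightarrow> map_matrix \<phi> x = map_matrix \<psi> x \<Longrightarrow> \<phi> = \<psi>"
  by (rule hom_unique[OF complete]) (auto simp: extends_hom extends_c)

abbreviation \<phi>\<^sub>0 :: "'b \<Rightarrow> 'b" where
  "\<phi>\<^sub>0 \<equiv> base_lift p s \<pi> S c x f"

lemma base_lift: "extends \<phi>\<^sub>0" "map_matrix \<phi>\<^sub>0 x = xm"
proof -
  have "\<exists>\<phi>. extends \<phi> \<and> map_matrix \<phi> x = xm" by (rule lift_exists) simp
  then have "\<exists>!\<phi>. extends \<phi> \<and> map_matrix \<phi> x = xm" by (auto intro: lift_unique)
  from theI'[OF this] show "extends \<phi>\<^sub>0" "map_matrix \<phi>\<^sub>0 x = xm" unfolding base_lift_def by blast+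
qed

end

locale metric_setup = lift_setup p S j x c X coordinate_ring \<pi> s f
  for p :: nat and S :: "'k::field_char_0 set" and j :: "'k polys fract \<Rightarrow> 'b::comm_ring_1"
    and x :: "'b ^ 'n::finite ^ 'n" and c :: "'k \<Rightarrow> 'b" and X coordinate_ring and \<pi> :: 'k
    and s :: nat and f :: "'k \<Rightarrow> 'k" +
  fixes q :: "'k ^ 'n ^ 'n"
  assumes q: "q \<in> GL_over S"
begin

lemma q_in: "q $ i $ k \<in> S"
  using q by (simp add: GL_over_def)

lemma map_q_invertible:
  assumes "subring_hom S g"
  shows "\<exists>Q'. map_matrix g q ** Q' = mat 1 \<and> Q' ** map_matrix g q = mat 1"
proof -
  interpret g: subring_hom S g by fact
  obtain q' where "\<And>i k. q' $ i $ k \<in> S" "q ** q' = mat 1" "q' ** q = mat 1"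
    using q unfolding GL_over_def by blast
  then show ?thesis
    by (intro exI[of _ "map_matrix g q'"]) (simp add: q_in g.mat_1 flip: g.matrix_mult)
qed

lemma det_unit_if_right_inverse: "A ** A' = mat 1 \<Longrightarrow> det A dvd 1"
  for A :: "'a::comm_ring_1 ^ 'l::finite ^ 'l"
  using det_mul[of A A'] by (metis det_I dvd_triv_left)

lemma det_x_unit: "det x dvd 1"
  using x_inverse det_unit_if_right_inverse by blast

abbreviation Q :: "'b ^ 'n ^ 'n" where
  "Q \<equiv> map_matrix c (map_matrix f q)"

abbreviation H :: "'b \<Rightarrow> 'b" where
  "H \<equiv> metric_map S c x q"

text \<open>The determinant of the prescribed image of \<open>x\<close> is a product of three units,
  so the universal property applies and the definite description denotes.\<close>

lemma metric_map:
  "subring_hom UNIV H" "\<And>r. r \<in> S \<Longrightarrow> H (c r) = c r"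
  "map_matrix H x = transpose x ** map_matrix c q ** x"
proof -
  let ?P = "\<lambda>h. ring_hom_on UNIV UNIV h \<and> (\<forall>r\<in>S. h (c r) = c r) \<and>
    map_matrix h x = transpose x ** map_matrix c q ** x"
  have "det (map_matrix c q) dvd 1"
    using map_q_invertible[OF subring_hom_c] det_unit_if_right_inverse by blast
  then have "det (transpose x ** map_matrix c q ** x) dvd 1 * 1 * 1"
    unfolding det_mul det_transpose using det_x_unit by (intro mult_dvd_mono)
  then have "\<exists>h. ?P h"
    using hom_exists[OF complete subring_hom_c] by (simp add: subring_hom_UNIV_iff)
  moreover have "g = h" if "?P g" "?P h" for g h
    using that by (intro hom_unique[OF complete]) (auto simp: subring_hom_UNIV_iff)
  ultimately have "\<exists>!h. ?P h" by blast
  from theI'[OF this] have "?P H" unfolding metric_map_def .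
  then show "subring_hom UNIV H" "\<And>r. r \<in> S \<Longrightarrow> H (c r) = c r"
    "map_matrix H x = transpose x ** map_matrix c q ** x" by (auto simp: subring_hom_UNIV_iff)
qed

lemma extends_map_q: "extends \<phi> \<Longrightarrow> map_matrix \<phi> (map_matrix c q) = Q"
  by (simp add: vec_eq_iff extends_c q_in)

text \<open>Both composites are homomorphisms acting on scalars through \<open>f\<close>, so they
  are equal as soon as they agree on \<open>x\<close>.\<close>

lemma metric_lift_iff:
  assumes \<phi>: "extends \<phi>"
  shows "metric_lift p s \<pi> S c x f q \<phi> \<longleftrightarrow>
    transpose (map_matrix \<phi> x) ** Q ** map_matrix \<phi> x =
    entry_power m (transpose x ** map_matrix c q ** x)"
proof -
  interpret \<phi>: subring_hom UNIV \<phi> using extends_hom[OF \<phi>] .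
  interpret H: subring_hom UNIV H by (rule metric_map)
  have lhs: "map_matrix (\<lambda>a. \<phi> (H a)) x = transpose (map_matrix \<phi> x) ** Q ** map_matrix \<phi> x"
    unfolding map_matrix_comp[symmetric] metric_map(3)
    by (simp add: \<phi>.matrix_mult map_matrix_transpose extends_map_q[OF \<phi>])
  have "map_matrix H (entry_power m x) = entry_power m (map_matrix H x)"
    by (simp add: vec_eq_iff H.power)
  then have rhs: "map_matrix (\<lambda>a. H (\<phi>\<^sub>0 a)) x = entry_power m (transpose x ** map_matrix c q ** x)"
    unfolding map_matrix_comp[symmetric] base_lift(2) metric_map(3) .
  have "metric_lift p s \<pi> S c x f q \<phi> \<longleftrightarrow> (\<lambda>a. \<phi> (H a)) = (\<lambda>a. H (\<phi>\<^sub>0 a))"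
    by (simp add: metric_lift_def comp_def)
  also have "\<dots> \<longleftrightarrow> map_matrix (\<lambda>a. \<phi> (H a)) x = map_matrix (\<lambda>a. H (\<phi>\<^sub>0 a)) x"
  proof
    assume "map_matrix (\<lambda>a. \<phi> (H a)) x = map_matrix (\<lambda>a. H (\<phi>\<^sub>0 a)) x"
    then show "(\<lambda>a. \<phi> (H a)) = (\<lambda>a. H (\<phi>\<^sub>0 a))"
      using subring_hom_comp[OF metric_map(1) extends_hom[OF \<phi>]]
        subring_hom_comp[OF extends_hom[OF base_lift(1)] metric_map(1)]
      by (intro hom_unique[OF complete])
        (auto simp: metric_map(2) extends_c[OF \<phi>] extends_c[OF base_lift(1)] f_in)
  qed simp
  finally show ?thesis unfolding lhs rhs .
qed

text \<open>As for the metric condition, equality of the two composites needs checking on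
  \<open>x\<close> only. Multiplication after a tensor product of lifts sends the two factors of the
  bilinear form to their separate images, and one of these lifts maps \<open>x\<close> to
  \<open>xm\<close>.\<close>

lemma symmetric_lift_iff:
  fixes i\<^sub>1 i\<^sub>2 :: "'b \<Rightarrow> 't::comm_ring_1"
  assumes square: "completed_tensor_square p S c i\<^sub>1 i\<^sub>2" and \<phi>: "extends \<phi>"
  shows "symmetric_lift p s \<pi> S c x i\<^sub>1 i\<^sub>2 f q \<phi> \<longleftrightarrow>
    transpose (map_matrix \<phi> x) ** Q ** xm = transpose xm ** Q ** map_matrix \<phi> x"
proof -
  have i: "subring_hom UNIV i\<^sub>1" "subring_hom UNIV i\<^sub>2" and complete_t: "padic_complete p TYPE('t)"
    using square unfolding completed_tensor_square_def subring_hom_UNIV_iff by blast+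
  interpret i\<^sub>1: subring_hom UNIV i\<^sub>1 by fact
  interpret i\<^sub>2: subring_hom UNIV i\<^sub>2 by fact
  note i_c = tensor_square_scalars[OF square]
  let ?\<mu> = "tensor_multiplication i\<^sub>1 i\<^sub>2"
  let ?B = "bilinear_map S c x i\<^sub>1 i\<^sub>2 q"
  let ?Y = "transpose (map_matrix i\<^sub>1 x) ** map_matrix (\<lambda>r. i\<^sub>1 (c r)) q ** map_matrix i\<^sub>2 x"
  have i_c_hom: "subring_hom S (\<lambda>r. i\<^sub>1 (c r))"
    unfolding subring_hom_def using subring_S ring_hom_on_comp[OF c.hom i\<^sub>1.hom] by blast
  have B: "subring_hom UNIV ?B" "\<And>r. r \<in> S \<Longrightarrow> ?B (c r) = i\<^sub>1 (c r)" "map_matrix ?B x = ?Y"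
  proof -
    let ?P = "\<lambda>h. ring_hom_on UNIV UNIV h \<and> (\<forall>r\<in>S. h (c r) = i\<^sub>1 (c r)) \<and> map_matrix h x = ?Y"
    obtain x' where x': "x ** x' = mat 1" using x_inverse by blast
    have "map_matrix i\<^sub>1 x ** map_matrix i\<^sub>1 x' = mat 1" "map_matrix i\<^sub>2 x ** map_matrix i\<^sub>2 x' = mat 1"
      by (simp_all add: x' i\<^sub>1.mat_1 i\<^sub>2.mat_1 flip: i\<^sub>1.matrix_mult i\<^sub>2.matrix_mult)
    then have "det (map_matrix i\<^sub>1 x) dvd 1" "det (map_matrix i\<^sub>2 x) dvd 1"
      by (auto intro: det_unit_if_right_inverse)
    moreover have "det (map_matrix (\<lambda>r. i\<^sub>1 (c r)) q) dvd 1"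
      using map_q_invertible[OF i_c_hom] det_unit_if_right_inverse by blast
    ultimately have "det ?Y dvd 1 * 1 * 1"
      unfolding det_mul det_transpose by (intro mult_dvd_mono)
    then have "\<exists>h. ?P h"
      using hom_exists[OF complete_t i_c_hom] by (simp add: subring_hom_UNIV_iff)
    moreover have "g = h" if "?P g" "?P h" for g h
      using that by (intro hom_unique[OF complete_t]) (auto simp: subring_hom_UNIV_iff)
    ultimately have "\<exists>!h. ?P h" by blast
    from theI'[OF this] have "?P ?B" unfolding bilinear_map_def .
    then show "subring_hom UNIV ?B" "\<And>r. r \<in> S \<Longrightarrow> ?B (c r) = i\<^sub>1 (c r)" "map_matrix ?B x = ?Y"
      by (auto simp: subring_hom_UNIV_iff)
  qed
  have "\<exists>!h. ring_hom_on UNIV UNIV h \<and> (\<forall>a b. h (i\<^sub>1 a * i\<^sub>2 b) = a * b)"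
    by (rule tensor_square_hom_ex1[OF square complete]) (simp_all add: subring_hom_UNIV_iff ring_hom_on_id)
  from theI'[OF this] have \<mu>: "subring_hom UNIV ?\<mu>" "\<And>a b. ?\<mu> (i\<^sub>1 a * i\<^sub>2 b) = a * b"
    unfolding tensor_multiplication_def subring_hom_UNIV_iff by blast+
  \<comment> \<open>Only the composite with multiplication is ever needed; it is the homomorphism
    that acts as \<open>\<alpha>\<close> on the first factor and as \<open>\<beta>\<close> on the
    second.\<close>
  define \<kappa> where "\<kappa> \<alpha> \<beta> t = ?\<mu> (tensor_map i\<^sub>1 i\<^sub>2 \<alpha> \<beta> t)" for \<alpha> \<beta> t
  have \<kappa>: "subring_hom UNIV (\<kappa> \<alpha> \<beta>) \<and> (\<forall>a b. \<kappa> \<alpha> \<beta> (i\<^sub>1 a * i\<^sub>2 b) = \<alpha> a * \<beta> b)"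
    if "extends \<alpha>" "extends \<beta>" for \<alpha> \<beta>
  proof -
    have "\<exists>!h. ring_hom_on UNIV UNIV h \<and> (\<forall>a b. h (i\<^sub>1 a * i\<^sub>2 b) = i\<^sub>1 (\<alpha> a) * i\<^sub>2 (\<beta> b))"
      using that i
      by (intro tensor_square_hom_ex1[OF square complete_t])
        (auto intro: subring_hom_comp extends_hom simp: extends_c i_c f_in)
    from theI'[OF this] have "subring_hom UNIV (tensor_map i\<^sub>1 i\<^sub>2 \<alpha> \<beta>)"
      "\<And>a b. tensor_map i\<^sub>1 i\<^sub>2 \<alpha> \<beta> (i\<^sub>1 a * i\<^sub>2 b) = i\<^sub>1 (\<alpha> a) * i\<^sub>2 (\<beta> b)"
      unfolding tensor_map_def subring_hom_UNIV_iff by blast+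
    then show ?thesis unfolding \<kappa>_def using \<mu> by (auto intro: subring_hom_comp)
  qed
  have \<kappa>_B: "subring_hom UNIV (\<lambda>a. \<kappa> \<alpha> \<beta> (?B a))" "\<And>r. r \<in> S \<Longrightarrow> \<kappa> \<alpha> \<beta> (?B (c r)) = c (f r)"
      "map_matrix (\<lambda>a. \<kappa> \<alpha> \<beta> (?B a)) x = transpose (map_matrix \<alpha> x) ** Q ** map_matrix \<beta> x"
    if \<alpha>: "extends \<alpha>" and \<beta>: "extends \<beta>" for \<alpha> \<beta>
  proof -
    interpret \<kappa>: subring_hom UNIV "\<kappa> \<alpha> \<beta>" using \<kappa>[OF \<alpha> \<beta>] by blast
    have one: "\<alpha> 1 = 1" "\<beta> 1 = 1"
      using subring_hom.one[OF extends_hom[OF \<alpha>]] subring_hom.one[OF extends_hom[OF \<beta>]] by auto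
    have \<kappa>1: "\<kappa> \<alpha> \<beta> (i\<^sub>1 a) = \<alpha> a" for a
      using \<kappa>[OF \<alpha> \<beta>] one i\<^sub>2.one by (metis mult.right_neutral)
    have \<kappa>2: "\<kappa> \<alpha> \<beta> (i\<^sub>2 b) = \<beta> b" for b
      using \<kappa>[OF \<alpha> \<beta>] one i\<^sub>1.one by (metis mult.left_neutral)
    show "subring_hom UNIV (\<lambda>a. \<kappa> \<alpha> \<beta> (?B a))"
      using subring_hom_comp[OF B(1) \<kappa>.subring_hom_axioms] .
    show "\<kappa> \<alpha> \<beta> (?B (c r)) = c (f r)" if "r \<in> S" for r
      using that by (simp add: B(2) \<kappa>1 extends_c[OF \<alpha>])
    have "map_matrix (\<kappa> \<alpha> \<beta>) (map_matrix (\<lambda>r. i\<^sub>1 (c r)) q) = Q"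
      by (simp add: vec_eq_iff \<kappa>1 extends_c[OF \<alpha>] q_in)
    moreover have "map_matrix (\<kappa> \<alpha> \<beta>) (transpose (map_matrix i\<^sub>1 x)) = transpose (map_matrix \<alpha> x)"
      by (simp add: vec_eq_iff transpose_def \<kappa>1)
    moreover have "map_matrix (\<kappa> \<alpha> \<beta>) (map_matrix i\<^sub>2 x) = map_matrix \<beta> x"
      by (simp add: vec_eq_iff \<kappa>2)
    moreover have "map_matrix (\<lambda>a. \<kappa> \<alpha> \<beta> (?B a)) x = map_matrix (\<kappa> \<alpha> \<beta>) ?Y"
      by (simp only: map_matrix_comp flip: B(3))
    ultimately show "map_matrix (\<lambda>a. \<kappa> \<alpha> \<beta> (?B a)) x = transpose (map_matrix \<alpha> x) ** Q ** map_matrix \<beta> x"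
      by (simp only: \<kappa>.matrix_mult UNIV_I)
  qed
  have "symmetric_lift p s \<pi> S c x i\<^sub>1 i\<^sub>2 f q \<phi> \<longleftrightarrow> (\<lambda>a. \<kappa> \<phi> \<phi>\<^sub>0 (?B a)) = (\<lambda>a. \<kappa> \<phi>\<^sub>0 \<phi> (?B a))"
    by (simp add: symmetric_lift_def \<kappa>_def comp_def Let_def)
  also have "\<dots> \<longleftrightarrow> map_matrix (\<lambda>a. \<kappa> \<phi> \<phi>\<^sub>0 (?B a)) x = map_matrix (\<lambda>a. \<kappa> \<phi>\<^sub>0 \<phi> (?B a)) x"
  proof
    assume "map_matrix (\<lambda>a. \<kappa> \<phi> \<phi>\<^sub>0 (?B a)) x = map_matrix (\<lambda>a. \<kappa> \<phi>\<^sub>0 \<phi> (?B a)) x"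
    then show "(\<lambda>a. \<kappa> \<phi> \<phi>\<^sub>0 (?B a)) = (\<lambda>a. \<kappa> \<phi>\<^sub>0 \<phi> (?B a))"
      using \<kappa>_B[OF \<phi> base_lift(1)] \<kappa>_B[OF base_lift(1) \<phi>] by (intro hom_unique[OF complete]) auto
  qed simp
  finally show ?thesis
    unfolding \<kappa>_B(3)[OF \<phi> base_lift(1)] \<kappa>_B(3)[OF base_lift(1) \<phi>] base_lift(2) .
qed

section \<open>The quotient of the two symmetric matrices and its square root\<close>

abbreviation A :: "'b ^ 'n ^ 'n" where
  "A \<equiv> transpose xm ** Q ** xm"

abbreviation B :: "'b ^ 'n ^ 'n" where
  "B \<equiv> entry_power m (transpose x ** map_matrix c q ** x)"

lemma xm_inverse: "\<exists>x'. xm ** x' = mat 1 \<and> x' ** xm = mat 1"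
  by (rule matrix_inverse_exists[OF complete subring_hom_c]) (simp add: det_unit_if_cong)

lemma A_inverse: "\<exists>A'. A ** A' = mat 1 \<and> A' ** A = mat 1"
proof (rule matrix_inverse_exists[OF complete subring_hom_c])
  have "subring_hom S (\<lambda>r. c (f r))"
    unfolding subring_hom_def using subring_S lift c.hom
    unfolding frobenius_lift_on_def by (blast intro: ring_hom_on_comp)
  from map_q_invertible[OF this] have "det Q dvd 1"
    unfolding map_matrix_comp using det_unit_if_right_inverse by blast
  moreover have "det xm dvd 1" by (simp add: det_unit_if_cong)
  ultimately have "det A dvd 1 * 1 * 1"
    unfolding det_mul det_transpose by (intro mult_dvd_mono)
  then show "det A dvd 1" by simp
qed

text \<open>The power is moved inside the triple product modulo \<open>p\<close>, one multiplication
  at a time, and the power of \<open>q\<close> is replaced by \<open>f q\<close> through the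
  Frobenius congruence on the ground ring.\<close>

lemma B_cong_A: "c \<pi> dvd B $ i $ k - A $ i $ k"
proof -
  let ?cq = "map_matrix c q"
  have 1: "c \<pi> dvd entry_power m (transpose x ** ?cq) $ i $ k - (transpose xm ** entry_power m ?cq) $ i $ k"
    for i k
    using Frobenius_matrix_mult[OF prime, of s "transpose x" ?cq i k]
    by (intro p_dvd_imp) (simp add: map_matrix_transpose)
  have 2: "c \<pi> dvd entry_power m ?cq $ i $ k - Q $ i $ k" for i k
  proof -
    obtain b where b: "b \<in> S" "f (q $ i $ k) - q $ i $ k ^ m = \<pi> * b"
      using lift q_in[of i k] unfolding frobenius_lift_on_def by blast
    have "Q $ i $ k - entry_power m ?cq $ i $ k = c (f (q $ i $ k) - q $ i $ k ^ m)"
      by (simp add: c.diff c.power q_in f_in subring_power subring_S)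
    also have "\<dots> = c \<pi> * c b" using b uniformizer_in by (simp add: c.mult)
    finally have "c \<pi> dvd Q $ i $ k - entry_power m ?cq $ i $ k" by simp
    then show ?thesis by (rule dvd_diff_sym)
  qed
  have "c \<pi> dvd (transpose xm ** entry_power m ?cq) $ i $ k - (transpose xm ** Q) $ i $ k" for i k
    by (rule dvd_diff_matrix_mult) (use 2 in auto)
  from dvd_diff_trans[OF 1 this]
  have "c \<pi> dvd (entry_power m (transpose x ** ?cq) ** xm) $ i $ k - A $ i $ k"
    by (intro dvd_diff_matrix_mult) auto
  moreover have "c \<pi> dvd B $ i $ k - (entry_power m (transpose x ** ?cq) ** xm) $ i $ k"
    by (rule p_dvd_imp, rule Frobenius_matrix_mult[OF prime])
  ultimately show ?thesis by (rule dvd_diff_trans[rotated])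
qed

lemma congruent_1_conjugate:
  fixes C D L :: "'b ^ 'n ^ 'n"
  assumes "C ** D = mat 1" "\<And>i k. c \<pi> dvd L $ i $ k - D $ i $ k"
  shows "c \<pi> dvd (C ** L) $ i $ k - mat 1 $ i $ k"
  unfolding assms(1)[symmetric] by (rule dvd_diff_matrix_mult) (use assms(2) in auto)

lemma quotient_sqrt:
  assumes half: "1 / 2 \<in> S" and A': "A ** A' = mat 1" "A' ** A = mat 1"
  shows "\<exists>L. binomial_sqrt p c \<pi> (A' ** B) L \<and> L ** L = A' ** B \<and>
    (\<forall>i k. c \<pi> dvd L $ i $ k - mat 1 $ i $ k)"
proof -
  have "c \<pi> dvd (A' ** B) $ i $ k - mat 1 $ i $ k" for i k
    by (rule congruent_1_conjugate[OF A'(2) B_cong_A])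
  then have "\<forall>i k. \<exists>y. (A' ** B) $ i $ k - mat 1 $ i $ k = c \<pi> * y" by (auto simp: dvd_def)
  then obtain Y where Y: "\<And>i k. (A' ** B) $ i $ k - mat 1 $ i $ k = c \<pi> * Y i k" by metis
  have M: "A' ** B = mat 1 + map_matrix (\<lambda>a. c \<pi> * a) (\<chi> i k. Y i k)"
    by (simp add: vec_eq_iff flip: Y)
  from root.binomial_series_sqrt[OF subring_hom_c half, of "\<chi> i k. Y i k"]
  show ?thesis unfolding binomial_sqrt_def M[symmetric] using M by blast
qed

theorem unique_symmetric_metric_lift:
  fixes i\<^sub>1 i\<^sub>2 :: "'b \<Rightarrow> 't::comm_ring_1"
  assumes half: "1 / 2 \<in> S" and sym: "transpose q = q"
    and square: "completed_tensor_square p S c i\<^sub>1 i\<^sub>2"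
  shows "\<exists>\<phi> L. binomial_sqrt p c \<pi> (matrix_inv A ** B) L \<and> map_matrix \<phi> x = xm ** L \<and>
    (\<forall>\<psi>. extends \<psi> \<and> symmetric_lift p s \<pi> S c x i\<^sub>1 i\<^sub>2 f q \<psi> \<and> metric_lift p s \<pi> S c x f q \<psi>
       \<longleftrightarrow> \<psi> = \<phi>)"
proof -
  define M where "M = A"
  obtain A' where A': "M ** A' = mat 1" "A' ** M = mat 1" using A_inverse unfolding M_def by blast
  have inv: "matrix_inv A = A'" by (rule matrix_inv_eq[OF A'[unfolded M_def]])
  obtain L where L: "binomial_sqrt p c \<pi> (A' ** B) L" and L2: "L ** L = A' ** B"
    and L1: "\<And>i k. c \<pi> dvd L $ i $ k - mat 1 $ i $ k"
    using quotient_sqrt[OF half A'[unfolded M_def]] by blast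
  have "transpose Q = Q" by (simp add: sym flip: map_matrix_transpose)
  then have A_sym: "transpose M = M" by (simp add: M_def matrix_transpose_mul matrix_mul_assoc)
  have "transpose (map_matrix c q) = map_matrix c q" by (simp add: sym flip: map_matrix_transpose)
  then have B_sym: "transpose B = B"
    by (simp add: matrix_transpose_mul matrix_mul_assoc flip: map_matrix_transpose)
  have A'_sym: "transpose A' = A'"
  proof -
    have "transpose A' ** M = transpose (M ** A')" by (simp only: matrix_transpose_mul[of M A'] A_sym)
    then have "transpose A' ** M = mat 1" by (simp add: A' transpose_mat)
    then have "(transpose A' ** M) ** A' = A'" by simp
    then show ?thesis by (simp only: A' matrix_mul_assoc[symmetric] matrix_mul_rid)
  qed
  have AB: "M ** (A' ** B) = B" by (simp add: matrix_mul_assoc A')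
  text \<open>\<open>A\<^sup>-\<^sup>1 L\<^sup>t A\<close> is another square root of \<open>A\<^sup>-\<^sup>1 B\<close> congruent to 1, hence equal to \<open>L\<close>.\<close>
  have "A' ** transpose L ** M = L"
  proof (rule root.matrix_sqrt_unique)
    have "(A' ** transpose L ** M) ** (A' ** transpose L ** M) =
        A' ** transpose L ** (M ** A') ** transpose L ** M"
      by (simp only: matrix_mul_assoc)
    also have "\<dots> = A' ** transpose (L ** L) ** M"
      by (simp only: A' matrix_mul_rid matrix_transpose_mul matrix_mul_assoc)
    also have "\<dots> = A' ** B ** (A' ** M)"
      by (simp only: L2 matrix_transpose_mul A'_sym B_sym matrix_mul_assoc)
    also have "\<dots> = L ** L" by (simp add: A' L2)
    finally show "(A' ** transpose L ** M) ** (A' ** transpose L ** M) = L ** L" .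
    show "c \<pi> dvd L $ i $ k - mat 1 $ i $ k" for i k by (rule L1)
    have "c \<pi> dvd transpose L $ i $ k - mat 1 $ i $ k" for i k
      using L1[of k i] by (simp add: transpose_def mat_def eq_commute)
    then have "c \<pi> dvd (transpose L ** M) $ i $ k - (mat 1 ** M) $ i $ k" for i k
      by (rule dvd_diff_matrix_mult) auto
    then have "c \<pi> dvd (A' ** (transpose L ** M)) $ i $ k - mat 1 $ i $ k" for i k
      by (intro congruent_1_conjugate[OF A'(2)]) simp
    then show "c \<pi> dvd (A' ** transpose L ** M) $ i $ k - mat 1 $ i $ k" for i k
      by (simp only: matrix_mul_assoc)
  qed
  then have "M ** L = M ** (A' ** transpose L ** M)" by simp
  also have "\<dots> = (M ** A') ** transpose L ** M" by (simp only: matrix_mul_assoc)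
  finally have L_sym: "transpose L ** M = M ** L" by (simp add: A')
  have xmL: "c \<pi> dvd (xm ** L) $ i $ k - x $ i $ k ^ m" for i k
  proof -
    have "c \<pi> dvd (xm ** L) $ i $ k - (xm ** mat 1) $ i $ k"
      by (rule dvd_diff_matrix_mult) (use L1 in auto)
    then show ?thesis by simp
  qed
  \<comment> \<open>Writing the image of \<open>x\<close> as \<open>xm ** N\<close> absorbs both
    copies of \<open>xm\<close> into \<open>M\<close>, so the symmetric and metric conditions become
    equations for \<open>N\<close> alone.\<close>
  have eq: "transpose (xm ** N) ** Q ** xm = transpose N ** M" "transpose xm ** Q ** (xm ** N) = M ** N"
    "transpose (xm ** N) ** Q ** (xm ** N) = transpose N ** M ** N" for N
    by (simp_all only: M_def matrix_transpose_mul matrix_mul_assoc)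
  obtain \<phi> where \<phi>: "extends \<phi>" "map_matrix \<phi> x = xm ** L" using lift_exists[OF xmL] by blast
  have \<phi>_sym: "symmetric_lift p s \<pi> S c x i\<^sub>1 i\<^sub>2 f q \<phi>"
    unfolding symmetric_lift_iff[OF square \<phi>(1)] \<phi>(2) eq by (rule L_sym)
  have \<phi>_metric: "metric_lift p s \<pi> S c x f q \<phi>"
  proof -
    \<comment> \<open>Once symmetry is known, the metric condition is the squared equation
      multiplied by \<open>M\<close>.\<close>
    have "transpose L ** M ** L = M ** (L ** L)" by (simp only: L_sym matrix_mul_assoc)
    also have "\<dots> = B" by (simp only: L2 AB)
    finally show ?thesis unfolding metric_lift_iff[OF \<phi>(1)] \<phi>(2) eq .
  qed
  have "\<psi> = \<phi>" if \<psi>: "extends \<psi>" and "symmetric_lift p s \<pi> S c x i\<^sub>1 i\<^sub>2 f q \<psi>"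
      and "metric_lift p s \<pi> S c x f q \<psi>" for \<psi>
  proof -
    obtain x' where x': "xm ** x' = mat 1" "x' ** xm = mat 1" using xm_inverse by blast
    \<comment> \<open>For any lift the image of \<open>x\<close> is congruent to the invertible
      \<open>xm\<close>, so the quotient is congruent to 1 and falls under uniqueness of square
      roots.\<close>
    define \<Lambda> where "\<Lambda> = x' ** map_matrix \<psi> x"
    have \<psi>x: "map_matrix \<psi> x = xm ** \<Lambda>" by (simp add: \<Lambda>_def matrix_mul_assoc x')
    have \<Lambda>1: "c \<pi> dvd \<Lambda> $ i $ k - mat 1 $ i $ k" for i k
      unfolding \<Lambda>_def by (rule congruent_1_conjugate[OF x'(2)]) (simp add: extends_cong[OF \<psi>])
    have \<Lambda>_sym: "transpose \<Lambda> ** M = M ** \<Lambda>"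
      using that(2) unfolding symmetric_lift_iff[OF square \<psi>] \<psi>x eq .
    have "B = transpose \<Lambda> ** M ** \<Lambda>"
      using that(3) unfolding metric_lift_iff[OF \<psi>] \<psi>x eq by simp
    also have "\<dots> = M ** (\<Lambda> ** \<Lambda>)" by (simp only: \<Lambda>_sym matrix_mul_assoc)
    finally have "A' ** B = (A' ** M) ** (\<Lambda> ** \<Lambda>)" by (simp only: matrix_mul_assoc)
    then have "\<Lambda> ** \<Lambda> = L ** L" by (simp add: A' L2)
    then have "\<Lambda> = L" using \<Lambda>1 L1 by (rule root.matrix_sqrt_unique)
    then show ?thesis using lift_unique[OF \<psi> \<phi>(1)] \<psi>x \<phi>(2) by simp
  qed
  then show ?thesis using \<phi> \<phi>_sym \<phi>_metric L unfolding inv by blast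
qed

end

section \<open>Specialization to the p-adic ground ring\<close>

theorem theorem3p38:
  fixes p s n i :: nat
    and \<nu> :: "'k::{alg_closed_field, field_char_0} \<Rightarrow> real"
    and K R R\<^sub>\<pi> :: "'k set"
    and \<pi> :: 'k
    and f :: "nat \<Rightarrow> 'k \<Rightarrow> 'k"
    and j :: "'k polys fract \<Rightarrow> 'b::comm_ring_1"
    and c :: "'k \<Rightarrow> 'b"
    and x :: "'b ^ 'n::finite ^ 'n"
    and i\<^sub>1 i\<^sub>2 :: "'b \<Rightarrow> 't::comm_ring_1"
    and q :: "'k ^ 'n ^ 'n"
  assumes "padic_ambient_field p \<nu>" and "odd p"
    and "R = completed_unramified_integers p \<nu>"
    and "finite_galois_extension (padic_numbers \<nu>) K" and "prime_element_of \<nu> K \<pi>"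
    and "R\<^sub>\<pi> = subring_gen (R \<union> {\<pi>})"
    and "s \<ge> 1" and "n \<ge> 1"
    and "\<forall>k\<in>{1..n}. frobenius_lift_on p s \<pi> R\<^sub>\<pi> (f k)"
    and "padic_completion p (GL_coordinate_ring TYPE('n) R\<^sub>\<pi>) j"
    and "c = (\<lambda>r. j (scalar r))" and "x = map_matrix j indeterminates"
    and "completed_tensor_square p R\<^sub>\<pi> c i\<^sub>1 i\<^sub>2"
    and "q \<in> GL_over R\<^sub>\<pi>" and "transpose q = q"
    and "i \<in> {1..n}"
  shows "(\<exists>!\<phi>. lift_extending p s \<pi> R\<^sub>\<pi> c (f i) \<phi> \<and>
              symmetric_lift p s \<pi> R\<^sub>\<pi> c x i\<^sub>1 i\<^sub>2 (f i) q \<phi> \<and>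
              metric_lift p s \<pi> R\<^sub>\<pi> c x (f i) q \<phi>) \<and>
         (\<forall>\<phi>. lift_extending p s \<pi> R\<^sub>\<pi> c (f i) \<phi> \<and>
              symmetric_lift p s \<pi> R\<^sub>\<pi> c x i\<^sub>1 i\<^sub>2 (f i) q \<phi> \<and>
              metric_lift p s \<pi> R\<^sub>\<pi> c x (f i) q \<phi> \<longrightarrow>
            (\<exists>\<Lambda>. binomial_sqrt p c \<pi>
                   (matrix_inv (transpose (entry_power (p ^ s) x) ** map_matrix c (map_matrix (f i) q)
                                 ** entry_power (p ^ s) x)
                      ** entry_power (p ^ s) (transpose x ** map_matrix c q ** x)) \<Lambda> \<and>
                 map_matrix \<phi> x = entry_power (p ^ s) x ** \<Lambda>))"
proof -
  interpret padic_ambient_field p \<nu> by fact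
  have S: "R\<^sub>\<pi> = subring_gen (completed_unramified_integers p \<nu> \<union> {\<pi>})" using assms(3,6) by simp
  have subring: "is_subring R\<^sub>\<pi>" unfolding S by (rule is_subring_subring_gen)
  have lift: "frobenius_lift_on p s \<pi> R\<^sub>\<pi> (f i)" using assms(9,16) by blast
  \<comment> \<open>Oddness of \<open>p\<close> makes 1/2 a p-adic integer; this gives both the
    coefficients of the binomial series and the invertibility of 2.\<close>
  have "\<not> int p dvd 2"
    using assms(2) prime_p by (metis even_numeral int_dvd_int_iff odd_one of_nat_numeral
      prime_nat_iff primes_dvd_imp_eq two_is_prime_nat dvd_refl)
  from inverse_of_int_in_integers[OF this] have half: "1 / 2 \<in> R\<^sub>\<pi>"
    unfolding S by (auto intro: subring_gen.gen simp: inverse_eq_divide)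
  have \<pi>_in: "\<pi> \<in> R\<^sub>\<pi>" unfolding S by (auto intro: subring_gen.gen)
  interpret completed_GL p R\<^sub>\<pi> j x c indeterminates "GL_coordinate_ring TYPE('n) R\<^sub>\<pi>"
    using assms subring by unfold_locales auto
  interpret c: subring_hom R\<^sub>\<pi> c by (rule subring_hom_c)
  have root: "uniformized_ring p (c \<pi>)"
  proof
    show "padic_complete p TYPE('b)" by (rule completed_GL.complete[OF completed_GL_axioms])
    obtain d w where "w \<in> R\<^sub>\<pi>" "\<pi> ^ d = of_nat p * w"
      using uniformizer_power[OF _ assms(5)] assms(4) unfolding finite_galois_extension_def S by blast
    then have "c \<pi> ^ d = of_nat p * c w"
      using \<pi>_in by (simp add: c.mult c.of_nat subring_of_nat subring flip: c.power)
    then show "\<exists>d w. c \<pi> ^ d = of_nat p * w" by blast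
    \<comment> \<open>The given lift on the ground ring is what certifies that \<open>\<pi>\<close>
      divides \<open>p\<close> there; \<open>c\<close> carries this to the completion.\<close>
    obtain w where "w \<in> R\<^sub>\<pi>" "of_nat p = \<pi> * w"
      using uniformizer_dvd_p[OF assms(7) S lift] by blast
    then have "of_nat p = c \<pi> * c w"
      using \<pi>_in c.of_nat[of p] by (simp add: c.mult)
    then show "c \<pi> dvd of_nat p" by simp
    have "2 * c (1 / 2) = c (2 * (1 / 2))"
      using half c.of_nat[of 2] subring_of_nat[OF subring, of 2] by (subst c.mult) auto
    then have "1 = 2 * c (1 / 2)" by (simp add: c.one)
    then show "(2::'b) dvd 1" ..
  qed
  interpret metric_setup p R\<^sub>\<pi> j x c indeterminates "GL_coordinate_ring TYPE('n) R\<^sub>\<pi>" \<pi> s "f i" q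
    by (intro metric_setup.intro lift_setup.intro lift_setup_axioms.intro metric_setup_axioms.intro
        completed_GL_axioms root prime_p lift \<pi>_in assms(14))
  let ?E = "\<lambda>\<psi>. extends \<psi> \<and> symmetric_lift p s \<pi> R\<^sub>\<pi> c x i\<^sub>1 i\<^sub>2 (f i) q \<psi> \<and>
    metric_lift p s \<pi> R\<^sub>\<pi> c x (f i) q \<psi>"
  obtain \<phi> L where L: "binomial_sqrt p c \<pi> (matrix_inv A ** B) L" "map_matrix \<phi> x = xm ** L"
    and \<phi>: "\<And>\<psi>. ?E \<psi> \<longleftrightarrow> \<psi> = \<phi>"
    using unique_symmetric_metric_lift[OF half assms(15,13)] by (elim exE conjE) (rule that, assumption+, erule spec)
  have "\<exists>!\<phi>. ?E \<phi>" unfolding \<phi> by (rule ex1I[of _ \<phi>]) simp_all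
  moreover have "\<forall>\<psi>. ?E \<psi> \<longrightarrow> (\<exists>\<Lambda>. binomial_sqrt p c \<pi> (matrix_inv A ** B) \<Lambda> \<and> map_matrix \<psi> x = xm ** \<Lambda>)"
    unfolding \<phi> using L by simp blast
  ultimately show ?thesis ..
qed

end
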